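(* Let $F$ be a global function field of characteristic $p$ with field of constants $\mathbb{F}_q$, and let $G=C_p$ be the cyclic group of order $p$. Put $a_p(G)=\frac{1}{p-1}$ and $\beta(F,G)=p-1$. Then the number $Z(F,G;X)$ of extensions $E/F$ with Galois group $G$ and discriminant norm at most $X$ has the asymptotic $$Z(F,G;X)\sim c(F,G)\,X^{a_p(G)}\,\log(X)^{\beta(F,G)-1}$$ with $c(F,G)=\gamma(F,G)/(p-1)^{\beta(F,G)-1}$, where $\gamma(F,G)>0$ is the constant in the conductor asymptotic $$C(F,G;X)\sim\gamma(F,G)\,X\,\log(X)^{\beta(F,G)-1}.$$
   Context: $F$ is a transcendental extension of degree $1$ over the finite field $\mathbb{F}_q$ with $q$ elements, where $\mathbb{F}_q$ is algebraically closed in $F$. All extensions $E/F$ are taken in a fixed algebraic closure of $F$; $\mathfrak{f}(E/F)$ and $\mathfrak{d}(E/F)$ are the relative conductor and relative discriminant (effective divisors of $F$), and $\|\mathfrak m\|=q^{\deg\mathfrak m}$ for a divisor $\mathfrak m$. $$C(F,G;X)=|\{E/F:\mathrm{Gal}(E/F)\simeq G,\ \|\mathfrak{f}(E/F)\|\le X\}|,\quad Z(F,G;X)=|\{E/F:\mathrm{Gal}(E/F)\simeq G,\ \|\mathfrak{d}(E/F)\|\le X\}|.$$ Convention on asymptotic equivalence: $f(X)\sim g(X)$ means that there are integers $\ell\ge 1$, $e\ge 0$ with $\lim_{n\to\infty}f(q^{\ell n+e})/g(q^{\ell n+e})=1$. A constant $\gamma(F,G)>0$ with the stated conductor asymptotic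 exists; it may depend on the arithmetic progression. For general $r\ge1$ the paper defines $a_p(C_p^r)=\frac{1+(p-1)r}{p(p^r-1)}$, which equals $\frac1{p-1}$ for $r=1$. *)

theory Defs
  imports
    Complex_Main
    "HOL-Algebra.Algebraic_Closure_Type"
    "HOL-Algebra.Generated_Fields"
    "HOL-Algebra.Finite_Extensions"
    "HOL-Algebra.Bij"
    "HOL-Algebra.Elementary_Groups"
    "Jordan_Normal_Form.Determinant"
begin

text \<open>
  The fixed algebraic closure of \<open>F\<close> is the whole type \<open>'a\<close> of class \<open>alg_closed_field\<close>, which is
  required to be algebraic over \<open>F\<close>. All fields that occur are subfields of it, given as sets.
\<close>

abbreviation \<Omega> :: "'a::alg_closed_field ring"
  where "\<Omega> \<equiv> ring_of_type_algebra"

abbreviation on_carrier :: "'a::alg_closed_field set \<Rightarrow> 'a ring"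
  where "on_carrier A \<equiv> \<Omega>\<lparr>carrier := A\<rparr>"

definition is_algebraic_closure_of :: "'a::alg_closed_field set \<Rightarrow> bool"
  where "is_algebraic_closure_of F \<longleftrightarrow> subfield F (\<Omega> :: 'a ring) \<and> (\<forall>x. (ring.algebraic \<Omega> over F) x)"

definition global_function_field :: "'a::alg_closed_field set \<Rightarrow> 'a set \<Rightarrow> bool"
  where "global_function_field k F \<longleftrightarrow>
    subfield k \<Omega> \<and> finite k \<and> subfield F \<Omega> \<and> k \<subseteq> F \<and>
    (\<exists>x\<in>F. (ring.transcendental \<Omega> over k) x \<and>
            ring.finite_dimension \<Omega> (generate_field \<Omega> (insert x k)) F) \<and>
    (\<forall>x\<in>F. (ring.algebraic \<Omega> over k) x \<longrightarrow> x \<in> k)"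


section \<open>Galois extensions\<close>

definition gal_group :: "'a::alg_closed_field set \<Rightarrow> 'a set \<Rightarrow> ('a \<Rightarrow> 'a) monoid"
  where "gal_group F E = (BijGroup E)
    \<lparr>carrier := {\<sigma> \<in> Bij E. \<sigma> \<in> Ring.ring_hom (on_carrier E) (on_carrier E) \<and> (\<forall>x\<in>F. \<sigma> x = x)}\<rparr>"

definition galois_extension :: "'a::alg_closed_field set \<Rightarrow> 'a set \<Rightarrow> bool"
  where "galois_extension F E \<longleftrightarrow>
    subfield E \<Omega> \<and> F \<subseteq> E \<and> ring.finite_dimension \<Omega> F E \<and>
    {x \<in> E. \<forall>\<sigma>\<in>carrier (gal_group F E). \<sigma> x = x} = F"

definition gal_trace :: "'a::alg_closed_field set \<Rightarrow> 'a set \<Rightarrow> 'a \<Rightarrow> 'a"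
  where "gal_trace F E x = (\<Sum>\<sigma>\<in>carrier (gal_group F E). \<sigma> x)"


section \<open>Places and divisors\<close>

text \<open>
  A place is represented by its valuation ring \<open>\<O>\<close>, a discrete valuation ring with quotient
  field \<open>K\<close>; its prime is the set of non-units of \<open>\<O>\<close>. A finite constant field lies in every such
  ring automatically, since its nonzero elements are roots of unity.
\<close>

definition unit_set :: "'a::alg_closed_field set \<Rightarrow> 'a set"
  where "unit_set \<O> = {u \<in> \<O>. u \<noteq> 0 \<and> inverse u \<in> \<O>}"

definition max_ideal :: "'a::alg_closed_field set \<Rightarrow> 'a set"
  where "max_ideal \<O> = \<O> - unit_set \<O>"

definition uniformizer :: "'a::alg_closed_field set \<Rightarrow> 'a \<Rightarrow> bool"
  where "uniformizer \<O> t \<longleftrightarrow> t \<in> \<O> \<and> t \<noteq> 0 \<and> max_ideal \<O> = {t * a | a. a \<in> \<O>}"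

definition places :: "'a::alg_closed_field set \<Rightarrow> 'a set set"
  where "places K = {\<O>. subring \<O> \<Omega> \<and> \<O> \<subset> K \<and>
    (\<exists>t. uniformizer \<O> t \<and> (\<forall>z\<in>K - {0}. \<exists>n::int. \<exists>u\<in>unit_set \<O>. z = u * t powi n))}"

text \<open>The normalized valuation; its value at \<open>0\<close> is irrelevant.\<close>

definition ord_at :: "'a::alg_closed_field set \<Rightarrow> 'a \<Rightarrow> int"
  where "ord_at \<O> z = (THE n. \<exists>t u. uniformizer \<O> t \<and> u \<in> unit_set \<O> \<and> z = u * t powi n)"

definition ord_ge :: "'a::alg_closed_field set \<Rightarrow> int \<Rightarrow> 'a \<Rightarrow> bool"
  where "ord_ge \<O> m z \<longleftrightarrow> z = 0 \<or> ord_at \<O> z \<ge> m"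

definition residue_field :: "'a::alg_closed_field set \<Rightarrow> 'a set ring"
  where "residue_field \<O> = on_carrier \<O> Quot max_ideal \<O>"

definition place_degree :: "'a::alg_closed_field set \<Rightarrow> 'a set \<Rightarrow> nat"
  where "place_degree k \<O> = (ring.dim (residue_field \<O>)
    over ((\<lambda>c. max_ideal \<O> +>\<^bsub>on_carrier \<O>\<^esub> c) ` k)) (carrier (residue_field \<O>))"

text \<open>Effective divisors of \<open>F\<close> are the functions \<open>D\<close> with finite support on \<open>places F\<close>.\<close>

definition divisor_degree :: "'a::alg_closed_field set \<Rightarrow> 'a set \<Rightarrow> ('a set \<Rightarrow> nat) \<Rightarrow> nat"
  where "divisor_degree k F D = (\<Sum>\<O> | \<O> \<in> places F \<and> D \<O> \<noteq> 0. D \<O> * place_degree k \<O>)"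

definition divisor_norm :: "'a::alg_closed_field set \<Rightarrow> 'a set \<Rightarrow> ('a set \<Rightarrow> nat) \<Rightarrow> real"
  where "divisor_norm k F D = real (card k) ^ divisor_degree k F D"

text \<open>The places of \<open>E\<close> above the place \<open>\<O>\<close> of \<open>F\<close>.\<close>

definition places_over :: "'a::alg_closed_field set \<Rightarrow> 'a set \<Rightarrow> 'a set \<Rightarrow> 'a set set"
  where "places_over F E \<O> = {\<O>' \<in> places E. \<O>' \<inter> F = \<O>}"


section \<open>The relative discriminant\<close>

definition integral_closure :: "'a::alg_closed_field set \<Rightarrow> 'a set \<Rightarrow> 'a set"
  where "integral_closure \<O> E =
    {x \<in> E. \<exists>f :: 'a Polynomial.poly. Polynomial.lead_coeff f = 1 \<and>
      set (Polynomial.coeffs f) \<subseteq> \<O> \<and> Polynomial.poly f x = 0}"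

definition basis_discriminant :: "'a::alg_closed_field set \<Rightarrow> 'a set \<Rightarrow> 'a list \<Rightarrow> 'a"
  where "basis_discriminant F E bs =
    det (mat (length bs) (length bs) (\<lambda>(i, j). gal_trace F E (bs ! i * bs ! j)))"

text \<open>
  Locally at a place, the discriminant is the ideal generated by the discriminants of all
  \<open>F\<close>-bases of \<open>E\<close> that consist of elements integral at that place. The exponent of this ideal
  is the least valuation of a generator.
\<close>

definition discriminant :: "'a::alg_closed_field set \<Rightarrow> 'a set \<Rightarrow> 'a set \<Rightarrow> nat"
  where "discriminant F E = (\<lambda>\<O>. LEAST d. \<exists>bs. set bs \<subseteq> integral_closure \<O> E \<and>
    ring.independent \<Omega> F bs \<and> ring.Span \<Omega> F bs = E \<and>
    ord_at \<O> (basis_discriminant F E bs) = int d)"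


section \<open>The relative conductor\<close>

text \<open>
  Elements of the completion of \<open>K\<close> at a place \<open>\<O>\<close> are represented by Cauchy sequences in \<open>K\<close>; two
  sequences represent the same element iff their difference is a null sequence.
\<close>

definition cauchy_at :: "'a::alg_closed_field set \<Rightarrow> 'a set \<Rightarrow> (nat \<Rightarrow> 'a) \<Rightarrow> bool"
  where "cauchy_at K \<O> x \<longleftrightarrow> range x \<subseteq> K \<and>
    (\<forall>m. \<exists>N. \<forall>i\<ge>N. \<forall>j\<ge>N. ord_ge \<O> m (x i - x j))"

definition null_at :: "'a::alg_closed_field set \<Rightarrow> (nat \<Rightarrow> 'a) \<Rightarrow> bool"
  where "null_at \<O> x \<longleftrightarrow> (\<forall>m. \<exists>N. \<forall>i\<ge>N. ord_ge \<O> m (x i))"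

text \<open>
  The higher unit groups of the completion: all units for \<open>n = 0\<close>, and the \<open>n\<close>-th principal units
  for \<open>n > 0\<close>.
\<close>

definition local_units :: "'a::alg_closed_field set \<Rightarrow> 'a set \<Rightarrow> nat \<Rightarrow> (nat \<Rightarrow> 'a) set"
  where "local_units K \<O> n = {x. cauchy_at K \<O> x \<and>
    (if n = 0 then \<forall>\<^sub>F i in sequentially. x i \<in> unit_set \<O>
     else \<forall>\<^sub>F i in sequentially. ord_ge \<O> (int n) (x i - 1))}"

text \<open>
  The decomposition group of a place of \<open>E\<close>. Extending automorphisms by continuity identifies it
  with the Galois group of the completion of \<open>E\<close> over the completion of \<open>F\<close>, so that the norm
  between the completions is the product over this group.
\<close>

definition decomposition_group :: "'a::alg_closed_field set \<Rightarrow> 'a set \<Rightarrow> 'a set \<Rightarrow> ('a \<Rightarrow> 'a) set"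
  where "decomposition_group F E \<O>' = {\<sigma> \<in> carrier (gal_group F E). \<sigma> ` \<O>' = \<O>'}"

text \<open>
  The sequences in \<open>F\<close> that represent norms of nonzero elements of the completion of \<open>E\<close> at the
  place \<open>\<O>'\<close>. The comparison takes place in the completion of \<open>E\<close>, since the approximating products
  need not lie in \<open>F\<close>.
\<close>

definition local_norms :: "'a::alg_closed_field set \<Rightarrow> 'a set \<Rightarrow> 'a set \<Rightarrow> (nat \<Rightarrow> 'a) set"
  where "local_norms F E \<O>' = {x. cauchy_at F (\<O>' \<inter> F) x \<and>
    (\<exists>y. cauchy_at E \<O>' y \<and> \<not> null_at \<O>' y \<and>
      null_at \<O>' (\<lambda>i. (\<Prod>\<sigma>\<in>decomposition_group F E \<O>'. \<sigma> (y i)) - x i))}"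

text \<open>
  The conductor of an abelian extension. Its exponent at a place is the least \<open>n\<close> such that the
  \<open>n\<close>-th unit group consists of local norms. The choice of the place of \<open>E\<close> above it is irrelevant.
\<close>

definition conductor :: "'a::alg_closed_field set \<Rightarrow> 'a set \<Rightarrow> 'a set \<Rightarrow> nat"
  where "conductor F E = (\<lambda>\<O>. LEAST n. \<forall>\<O>'\<in>places_over F E \<O>. local_units F \<O> n \<subseteq> local_norms F E \<O>')"


section \<open>Counting functions and asymptotics\<close>

definition count_conductor ::
    "'a::alg_closed_field set \<Rightarrow> 'a set \<Rightarrow> ('g, 'm) monoid_scheme \<Rightarrow> real \<Rightarrow> nat"
  where "count_conductor k F G B =
    card {E. galois_extension F E \<and> is_iso (gal_group F E) G \<and> divisor_norm k F (conductor F E) \<le> B}"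

definition count_discriminant ::
    "'a::alg_closed_field set \<Rightarrow> 'a set \<Rightarrow> ('g, 'm) monoid_scheme \<Rightarrow> real \<Rightarrow> nat"
  where "count_discriminant k F G B =
    card {E. galois_extension F E \<and> is_iso (gal_group F E) G \<and> divisor_norm k F (discriminant F E) \<le> B}"

text \<open>Asymptotic equivalence along some arithmetic progression of exponents of \<open>q\<close>.\<close>

definition asymp_equiv_q :: "nat \<Rightarrow> (real \<Rightarrow> real) \<Rightarrow> (real \<Rightarrow> real) \<Rightarrow> bool"
  where "asymp_equiv_q q f g \<longleftrightarrow> (\<exists>l e :: nat. l \<ge> 1 \<and>
    (\<lambda>n. f (real q ^ (l * n + e)) / g (real q ^ (l * n + e))) \<longlonglongrightarrow> 1)"

definition disc_exponent :: "nat \<Rightarrow> real"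
  where "disc_exponent p = 1 / (real p - 1)"

definition log_exponent :: "nat \<Rightarrow> nat"
  where "log_exponent p = p - 1"

end

theory Submission
  imports Defs "HOL-Number_Theory.Residues" "HOL-Computational_Algebra.Polynomial_FPS"
begin

text \<open>
  At every place the discriminant exponent of a \<open>C\<^sub>p\<close>-extension is \<open>p - 1\<close> times its conductor exponent,
  so the two counting functions agree up to replacing \<open>X\<close> by \<open>X\<^sup>p\<^sup>-\<^sup>1\<close>, and the progression of the
  conductor asymptotics only has to be multiplied by \<open>p - 1\<close>.

  Locally, \<open>E = F(y)\<close> with \<open>f = y\<^sup>p - y \<in> F\<close>, and since the residue field is perfect \<open>y\<close> can be chosen
  such that \<open>f\<close> is integral or has a pole of order \<open>m\<close> prime to \<open>p\<close>. Giving \<open>a y\<^sup>i\<close> the weight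
  \<open>p v(a) - m i\<close> defines a multiplicative filtration on \<open>E\<close>. The trace form is antitriangular in the
  basis \<open>1, y, \<dots>, y\<^sup>p\<^sup>-\<^sup>1\<close>, which gives the discriminant exponent \<open>(p - 1)(m + 1)\<close>. Newton's identities
  bound the error of \<open>N(1 + b) = 1 + Tr b + N b\<close> in the filtration. Therefore units of level above \<open>m\<close> are
  norms by successive approximation, while at level \<open>m\<close> the norms are governed by \<open>c \<mapsto> c\<^sup>p - c\<close> on the finite
  residue field, which is not surjective. Hence the conductor exponent is \<open>m + 1\<close>. Both exponents vanish if \<open>f\<close>
  is integral.
\<close>

section \<open>Subfields and discrete valuations\<close>

text \<open>Above an unramified place \<open>E\<close> may split, so no single valuation of
  \<open>E\<close> is at hand, and the conductor quantifies over all places above. The filtration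
  \<open>W\<close> is the substitute: it is defined by coordinates alone and bounds the valuation at
  every place above from below. In the ramified case it turns out to belong to the valuation sending
  \<open>z\<close> to \<open>v (N z)\<close>, and this valuation also produces the place above on
  which the lower bound for the conductor rests. Both exponents have one source: the trace reads off
  the coordinate of \<open>y ^ (p - 1)\<close> and so gains \<open>m * (p - 1)\<close> in weight.
  For the discriminant, the factor \<open>p - 1\<close> appears because bringing
  \<open>y ^ j\<close> and \<open>y ^ (p - j)\<close> into \<open>W 0\<close> costs
  \<open>m + 1\<close> powers of \<open>t\<close> together, and the determinant enters squared.
  Completions are never formed: a norm equation is solved along a Cauchy sequence in
  \<open>F\<close>, with targets that move with the index. A place is given only as a discrete
  valuation ring, so finiteness of its residue field has to be proved. It makes p-th roots of
  residues available and turns non-injectivity of the Artin-Schreier map into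
  non-surjectivity.\<close>

locale subfield_set =
  fixes K :: "'a::field set"
  assumes one_mem [simp, intro]: "1 \<in> K"
    and diff_mem [intro]: "a \<in> K \<Longrightarrow> b \<in> K \<Longrightarrow> a - b \<in> K"
    and mult_mem [intro]: "a \<in> K \<Longrightarrow> b \<in> K \<Longrightarrow> a * b \<in> K"
    and inverse_mem [intro]: "a \<in> K \<Longrightarrow> inverse a \<in> K"
begin

lemma zero_mem [simp, intro]: "0 \<in> K"
  using diff_mem[OF one_mem one_mem] by simp

lemma uminus_mem [intro]: "a \<in> K \<Longrightarrow> - a \<in> K"
  using diff_mem[OF zero_mem, of a] by simp

lemma add_mem [intro]: "a \<in> K \<Longrightarrow> b \<in> K \<Longrightarrow> a + b \<in> K"
  using diff_mem[OF _ uminus_mem, of a b] by simp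

lemma divide_mem [intro]: "a \<in> K \<Longrightarrow> b \<in> K \<Longrightarrow> a / b \<in> K"
  by (simp add: divide_inverse inverse_mem mult_mem)

lemma power_mem [intro]: "a \<in> K \<Longrightarrow> a ^ n \<in> K"
  by (induction n) auto

lemma power_int_mem [intro]: "a \<in> K \<Longrightarrow> a powi n \<in> K"
  by (simp add: power_int_def inverse_mem power_mem)

lemma sum_mem [intro]: "(\<And>i. i \<in> I \<Longrightarrow> f i \<in> K) \<Longrightarrow> sum f I \<in> K"
  by (induction I rule: infinite_finite_induct) auto

lemma prod_mem [intro]: "(\<And>i. i \<in> I \<Longrightarrow> f i \<in> K) \<Longrightarrow> prod f I \<in> K"
  by (induction I rule: infinite_finite_induct) auto

lemma of_nat_mem [simp, intro]: "of_nat n \<in> K"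
  by (induction n) auto

end

section \<open>From the HOL-Algebra ring on the type to type-class arithmetic\<close>

lemma m_inv_ring_of_type:
  fixes x :: "'a::alg_closed_field"
  assumes "x \<noteq> 0" shows "inv\<^bsub>\<Omega>\<^esub> x = inverse x"
proof -
  interpret field "\<Omega> :: 'a ring" by (rule field_from_type_algebra)
  show ?thesis
    using assms by (intro inv_char) (auto simp: ring_of_type_algebra_def)
qed

lemma a_inv_ring_of_type:
  fixes x :: "'a::alg_closed_field"
  shows "\<ominus>\<^bsub>\<Omega>\<^esub> x = - x"
proof -
  interpret field "\<Omega> :: 'a ring" by (rule field_from_type_algebra)
  show ?thesis
    by (intro add.inv_equality[unfolded a_inv_def[symmetric]])
       (auto simp: ring_of_type_algebra_def a_inv_def)
qed

lemma subring_closed: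
  fixes A :: "'a::alg_closed_field set"
  assumes "subring A \<Omega>"
  shows "0 \<in> A" "1 \<in> A" "a \<in> A \<Longrightarrow> b \<in> A \<Longrightarrow> a + b \<in> A" "a \<in> A \<Longrightarrow> b \<in> A \<Longrightarrow> a * b \<in> A"
    "a \<in> A \<Longrightarrow> - a \<in> A"
  using subringE(2,3,6,7)[OF assms] subringE(5)[OF assms, of a] a_inv_ring_of_type[of a]
  by (simp_all add: ring_of_type_algebra_def)

lemma subfield_set_of_subfield:
  fixes K :: "'a::alg_closed_field set"
  assumes "subfield K \<Omega>"
  shows "subfield_set K"
proof -
  interpret field "\<Omega> :: 'a ring" by (rule field_from_type_algebra)
  have sr: "subring K \<Omega>" using assms by (rule subfieldE(1))
  note sc = subring_closed[OF sr]
  show ?thesis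
  proof
    show "1 \<in> K" by (rule sc)
    show "a - b \<in> K" if "a \<in> K" "b \<in> K" for a b
      using sc(3)[OF that(1) sc(5)[OF that(2)]] by simp
    show "a * b \<in> K" if "a \<in> K" "b \<in> K" for a b using sc(4) that by blast
    show "inverse a \<in> K" if "a \<in> K" for a
    proof (cases "a = 0")
      case False
      then have "inv\<^bsub>\<Omega>\<^esub> a \<in> K"
        using subfield_m_inv(1)[OF assms, of a] that by (auto simp: ring_of_type_algebra_def)
      then show ?thesis using m_inv_ring_of_type[OF False] by simp
    qed (use sc in auto)
  qed
qed

text \<open>Stands in for the convention that \<open>0\<close> has infinite valuation:
  \<open>v\<close> takes integer values, and its value at \<open>0\<close> carries no
  information.\<close>

definition val_ge :: "('a::field \<Rightarrow> int) \<Rightarrow> int \<Rightarrow> 'a \<Rightarrow> bool"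
  where "val_ge v n z \<longleftrightarrow> z = 0 \<or> v z \<ge> n"

lemma ord_ge_eq_val_ge: "ord_ge \<O> = val_ge (ord_at \<O>)"
  by (auto simp: fun_eq_iff ord_ge_def val_ge_def)

lemma val_ge_0 [simp]: "val_ge v n 0"
  by (simp add: val_ge_def)

lemma val_ge_mono: "val_ge v n z \<Longrightarrow> m \<le> n \<Longrightarrow> val_ge v m z"
  by (auto simp: val_ge_def)

text \<open>Independent of any place, because it serves three kinds of functions:
  \<open>ord_at \<O>\<close> on \<open>F\<close>, \<open>ord_at \<O>'\<close> on \<open>E\<close>,
  and \<open>z\<close> mapped to \<open>v (N z)\<close> on \<open>E\<close>. All laws are relative
  to \<open>K\<close>, since \<open>v\<close> is a total function on the ambient type.\<close>

locale discrete_valuation = subfield_set K for K :: "'a::field set" +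
  fixes v :: "'a \<Rightarrow> int" and t :: 'a
  assumes val_mult: "a \<in> K \<Longrightarrow> b \<in> K \<Longrightarrow> a \<noteq> 0 \<Longrightarrow> b \<noteq> 0 \<Longrightarrow> v (a * b) = v a + v b"
    and val_add: "a \<in> K \<Longrightarrow> b \<in> K \<Longrightarrow> a \<noteq> 0 \<Longrightarrow> b \<noteq> 0 \<Longrightarrow> a + b \<noteq> 0 \<Longrightarrow> v (a + b) \<ge> min (v a) (v b)"
    and t_mem [simp]: "t \<in> K" and t_nonzero [simp]: "t \<noteq> 0" and val_t [simp]: "v t = 1"
begin

abbreviation "vge \<equiv> val_ge v"

lemma val_one [simp]: "v 1 = 0"
  using val_mult[of 1 1] by simp

lemma val_neg_one [simp]: "v (- 1) = 0"
  using val_mult[of "-1" "-1"] by (simp add: uminus_mem)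

lemma val_minus [simp]: "a \<in> K \<Longrightarrow> v (- a) = v a"
  using val_mult[of "-1" a] by (cases "a = 0") (auto simp add: uminus_mem)

lemma val_inverse: "a \<in> K \<Longrightarrow> a \<noteq> 0 \<Longrightarrow> v (inverse a) = - v a"
  using val_mult[of a "inverse a"] by (simp add: inverse_mem)

lemma val_divide: "a \<in> K \<Longrightarrow> b \<in> K \<Longrightarrow> a \<noteq> 0 \<Longrightarrow> b \<noteq> 0 \<Longrightarrow> v (a / b) = v a - v b"
  by (simp add: divide_inverse val_mult val_inverse inverse_mem)

lemma val_power: "a \<in> K \<Longrightarrow> a \<noteq> 0 \<Longrightarrow> v (a ^ n) = int n * v a"
  by (induction n) (auto simp: val_mult power_mem algebra_simps)

lemma val_power_int: "a \<in> K \<Longrightarrow> a \<noteq> 0 \<Longrightarrow> v (a powi n) = n * v a"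
  by (auto simp: power_int_def val_power val_inverse power_mem inverse_mem)

lemma val_prod:
  "(\<And>i. i \<in> I \<Longrightarrow> f i \<in> K) \<Longrightarrow> (\<And>i. i \<in> I \<Longrightarrow> f i \<noteq> 0) \<Longrightarrow> v (prod f I) = (\<Sum>i\<in>I. v (f i))"
  by (induction I rule: infinite_finite_induct) (auto simp: val_mult prod_mem)

lemma vge_add: "a \<in> K \<Longrightarrow> b \<in> K \<Longrightarrow> vge n a \<Longrightarrow> vge n b \<Longrightarrow> vge n (a + b)"
  using val_add[of a b] by (fastforce simp: val_ge_def)

lemma vge_minus: "a \<in> K \<Longrightarrow> vge n a \<Longrightarrow> vge n (- a)"
  by (auto simp: val_ge_def)

lemma vge_diff: "a \<in> K \<Longrightarrow> b \<in> K \<Longrightarrow> vge n a \<Longrightarrow> vge n b \<Longrightarrow> vge n (a - b)"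
  using vge_add[of a "- b" n] vge_minus[of b n] by (auto simp: uminus_mem)

lemma vge_diff_commute: "a \<in> K \<Longrightarrow> b \<in> K \<Longrightarrow> vge n (a - b) \<Longrightarrow> vge n (b - a)"
  using vge_minus[of "a - b" n] by (auto simp: diff_mem)

lemma vge_diff_trans:
  "a \<in> K \<Longrightarrow> b \<in> K \<Longrightarrow> c \<in> K \<Longrightarrow> vge n (a - b) \<Longrightarrow> vge n (b - c) \<Longrightarrow> vge n (a - c)"
  using vge_add[of "a - b" "b - c" n] by (auto simp: diff_mem)

lemma vge_one [simp]: "vge 0 1"
  by (simp add: val_ge_def)

lemma vge_mult: "a \<in> K \<Longrightarrow> b \<in> K \<Longrightarrow> vge n a \<Longrightarrow> vge m b \<Longrightarrow> vge (n + m) (a * b)"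
  by (cases "a = 0 \<or> b = 0") (auto simp: val_ge_def val_mult)

lemma vge_mult0: "a \<in> K \<Longrightarrow> b \<in> K \<Longrightarrow> vge 0 a \<Longrightarrow> vge m b \<Longrightarrow> vge m (a * b)"
  using vge_mult[of a b 0 m] by simp

lemma vge_power: "a \<in> K \<Longrightarrow> vge n a \<Longrightarrow> vge (int k * n) (a ^ k)"
proof (induction k)
  case 0
  then show ?case by (simp add: val_ge_def)
next
  case (Suc k)
  then show ?case using vge_mult[of a "a ^ k" n "int k * n"] by (auto simp: algebra_simps power_mem)
qed

lemma vge_power0: "a \<in> K \<Longrightarrow> vge 0 a \<Longrightarrow> vge 0 (a ^ k)"
  using vge_power[of a 0 k] by simp

lemma vge_sum: "(\<And>i. i \<in> I \<Longrightarrow> f i \<in> K) \<Longrightarrow> (\<And>i. i \<in> I \<Longrightarrow> vge n (f i)) \<Longrightarrow> vge n (sum f I)"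
  by (induction I rule: infinite_finite_induct) (auto intro!: vge_add sum_mem)

lemma vge_prod:
  "(\<And>i. i \<in> I \<Longrightarrow> f i \<in> K) \<Longrightarrow> (\<And>i. i \<in> I \<Longrightarrow> vge (n i) (f i)) \<Longrightarrow> vge (\<Sum>i\<in>I. n i) (prod f I)"
  by (induction I rule: infinite_finite_induct) (auto intro!: vge_mult prod_mem)

text \<open>Ultrametric principle: if \<open>v a\<close> exceeded \<open>v b\<close>, then
  \<open>b = a - (a - b)\<close> would have too large a valuation.\<close>

lemma val_eq_of_close:
  assumes "a \<in> K" "b \<in> K" "b \<noteq> 0" "vge n (a - b)" "v b < n"
  shows "a \<noteq> 0" "v a = v b"
proof -
  show a: "a \<noteq> 0"
    using assms by (auto simp: val_ge_def)
  have "vge (min n (v b)) ((a - b) + b)"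
    using assms by (intro vge_add) (auto simp: val_ge_def)
  then have "v a \<ge> v b" using a assms(5) by (simp add: val_ge_def)
  moreover have "\<not> v a > v b"
  proof
    assume gt: "v a > v b"
    have "vge (min n (v a)) (a - (a - b))"
      using assms by (intro vge_diff val_ge_mono[OF assms(4)]) (auto simp: val_ge_def)
    then have "vge (min n (v a)) b" by simp
    then show False using assms gt by (auto simp: val_ge_def min_def split: if_splits)
  qed
  ultimately show "v a = v b" by simp
qed

text \<open>A pole of \<open>x\<close> would make \<open>x ^ n\<close> the only term of smallest
  valuation, so the terms of the equation could not cancel.\<close>

lemma vge_root_of_monic:
  assumes "x \<in> K" "poly f x = 0" "lead_coeff f = 1" "\<And>i. coeff f i \<in> K" "\<And>i. vge 0 (coeff f i)"
  shows "vge 0 x"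
proof (rule ccontr)
  assume "\<not> vge 0 x"
  then have x: "x \<noteq> 0" "v x < 0" by (auto simp: val_ge_def)
  define n where "n = degree f"
  have "f \<noteq> 0" using assms(3) by auto
  have "poly f x = (\<Sum>i<n. coeff f i * x ^ i) + x ^ n"
    using assms(3) by (simp add: poly_altdef n_def lessThan_Suc_atMost[symmetric])
  then have eq: "x ^ n = - (\<Sum>i<n. coeff f i * x ^ i)"
    using assms(2) by (simp add: eq_neg_iff_add_eq_0 add.commute)
  have "vge (int n * v x + 1) (coeff f i * x ^ i)" if "i < n" for i
  proof -
    have "int n * v x + 1 \<le> int i * v x"
    proof -
      have "(int n - int i) * v x \<le> 1 * v x"
        using that x by (intro mult_right_mono_neg) auto
      then show ?thesis using x by (simp add: algebra_simps)
    qed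
    then have "vge (int n * v x + 1) (x ^ i)"
      using assms(1) x by (simp add: val_ge_def val_power)
    then show ?thesis using assms by (intro vge_mult0) auto
  qed
  then have "vge (int n * v x + 1) (- (\<Sum>i<n. coeff f i * x ^ i))"
    using assms by (intro vge_minus vge_sum) auto
  then have "vge (int n * v x + 1) (x ^ n)" using eq by simp
  then show False using x assms(1) by (simp add: val_ge_def val_power)
qed

end

subsection \<open>Places as valuation rings\<close>

locale place = subfield_set K for K :: "'a::alg_closed_field set" +
  fixes \<O> :: "'a set"
  assumes place: "\<O> \<in> places K"
begin

lemma O_subring: "subring \<O> \<Omega>" and O_subset: "\<O> \<subseteq> K"
  using place by (auto simp: places_def)

lemmas O_closed = subring_closed[OF O_subring]

lemma O_power: "a \<in> \<O> \<Longrightarrow> a ^ n \<in> \<O>"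
  by (induction n) (auto intro: O_closed)

lemma unit_mult: "a \<in> unit_set \<O> \<Longrightarrow> b \<in> unit_set \<O> \<Longrightarrow> a * b \<in> unit_set \<O>"
  by (auto simp: unit_set_def O_closed)

lemma unit_one: "1 \<in> unit_set \<O>"
  by (auto simp: unit_set_def O_closed)

lemma unit_inverse: "a \<in> unit_set \<O> \<Longrightarrow> inverse a \<in> unit_set \<O>"
  by (auto simp: unit_set_def)

lemma unit_power: "a \<in> unit_set \<O> \<Longrightarrow> a ^ n \<in> unit_set \<O>"
  by (induction n) (auto intro: unit_mult unit_one)

lemma unit_power_int: "a \<in> unit_set \<O> \<Longrightarrow> a powi n \<in> unit_set \<O>"
  by (auto simp: power_int_def intro: unit_power unit_inverse)

lemma uniformizer_not_unit: "uniformizer \<O> t \<Longrightarrow> t \<notin> unit_set \<O>"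
proof
  assume t: "uniformizer \<O> t" "t \<in> unit_set \<O>"
  then have "1 = t * inverse t" "inverse t \<in> \<O>" by (auto simp: unit_set_def)
  then have "1 \<in> {t * a |a. a \<in> \<O>}" by blast
  then have "1 \<in> max_ideal \<O>" using t by (simp add: uniformizer_def)
  then show False using unit_one by (auto simp: max_ideal_def)
qed

text \<open>A nontrivial power that is a unit would make \<open>t\<close> itself a unit, since
  \<open>inverse t\<close> is \<open>t ^ j\<close> times the inverse of \<open>t ^ Suc j\<close>.
  This is what makes exponents of \<open>t\<close> unique.\<close>

lemma uniformizer_power_not_unit:
  assumes t: "uniformizer \<O> t" and u: "t powi n \<in> unit_set \<O>"
  shows "n = 0"
proof (rule ccontr)
  assume n: "n \<noteq> 0"
  have t0: "t \<in> \<O>" "t \<noteq> 0" using t by (auto simp: uniformizer_def)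
  define m where "m = nat \<bar>n\<bar>"
  have um: "t ^ m \<in> unit_set \<O>"
  proof (cases "n > 0")
    case True then show ?thesis using u by (simp add: power_int_def m_def)
  next
    case False
    then have "inverse (t powi n) = t ^ m"
      by (simp add: power_int_def m_def power_inverse)
    then show ?thesis using unit_inverse[OF u] by simp
  qed
  obtain j where j: "m = Suc j" using n by (cases m) (auto simp: m_def)
  have "inverse t = t ^ j * inverse (t ^ m)" using t0 by (simp add: j)
  moreover have "t ^ j * inverse (t ^ m) \<in> \<O>"
    using um t0 by (intro O_closed O_power) (auto simp: unit_set_def)
  ultimately have "t \<in> unit_set \<O>" using t0 by (simp add: unit_set_def)
  then show False using uniformizer_not_unit[OF t] by simp
qed

text \<open>\<open>ord_at\<close> is a definite description that ranges over all uniformizers. Two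
  of them generate the same ideal, so they differ by a unit \<open>b\<close>, and comparing
  exponents leaves a power of \<open>t\<close> that is a unit.\<close>

lemma ord_at_eqI:
  assumes t: "uniformizer \<O> t" and u: "u \<in> unit_set \<O>" and z: "z = u * t powi n"
  shows "ord_at \<O> z = n"
  unfolding ord_at_def
proof (rule the_equality)
  show "\<exists>t u. uniformizer \<O> t \<and> u \<in> unit_set \<O> \<and> z = u * t powi n"
    using assms by blast
next
  fix m assume "\<exists>t u. uniformizer \<O> t \<and> u \<in> unit_set \<O> \<and> z = u * t powi m"
  then obtain t' u' where 1: "uniformizer \<O> t'" "u' \<in> unit_set \<O>" "z = u' * t' powi m"
    by blast
  have t0: "t \<in> \<O>" "t \<noteq> 0" "t' \<in> \<O>" "t' \<noteq> 0" using t 1 by (auto simp: uniformizer_def)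
  have "t' * 1 \<in> {t' * a |a. a \<in> \<O>}" using O_closed(2) by blast
  then have "t' \<in> {t * a |a. a \<in> \<O>}" using t 1 by (auto simp: uniformizer_def)
  then obtain b where b: "b \<in> \<O>" "t' = t * b" by blast
  have "t * 1 \<in> {t * a |a. a \<in> \<O>}" using O_closed(2) by blast
  then have "t \<in> {t' * a |a. a \<in> \<O>}" using t 1 by (auto simp: uniformizer_def)
  then obtain c where c: "c \<in> \<O>" "t = t' * c" by blast
  have "t * (b * c) = t * 1" using b c by (metis mult.assoc mult.right_neutral)
  then have bc: "b * c = 1" using t0 by simp
  then have "inverse b = c" "b \<noteq> 0" using inverse_unique[of b c] by auto
  then have b': "b \<in> unit_set \<O>" using b c by (simp add: unit_set_def)
  have "u * t powi n = u' * b powi m * t powi m"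
    using 1(3) z b by (simp add: power_int_mult_distrib)
  moreover have "u \<noteq> 0" "u' \<noteq> 0" using u 1 by (auto simp: unit_set_def)
  ultimately have "t powi (n - m) = inverse u * (u' * b powi m)"
    using t0 by (simp add: power_int_diff field_simps)
  moreover have "inverse u * (u' * b powi m) \<in> unit_set \<O>"
    using u 1 b' by (intro unit_mult unit_inverse unit_power_int)
  ultimately have "n - m = 0" using uniformizer_power_not_unit[OF t] by metis
  then show "m = n" by simp
qed

lemma obtain_uniformizer:
  obtains t where "uniformizer \<O> t" "\<And>z. z \<in> K \<Longrightarrow> z \<noteq> 0 \<Longrightarrow> \<exists>u\<in>unit_set \<O>. z = u * t powi (ord_at \<O> z)"
proof -
  obtain t where t: "uniformizer \<O> t" "\<forall>z\<in>K - {0}. \<exists>n::int. \<exists>u\<in>unit_set \<O>. z = u * t powi n"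
    using place by (auto simp: places_def)
  have "\<exists>u\<in>unit_set \<O>. z = u * t powi (ord_at \<O> z)" if z: "z \<in> K" "z \<noteq> 0" for z
  proof -
    obtain n u where "u \<in> unit_set \<O>" "z = u * t powi n" using t z by blast
    then show ?thesis using ord_at_eqI[OF t(1)] by metis
  qed
  with t(1) that show thesis by blast
qed

lemma O_iff_ord: "z \<in> K \<Longrightarrow> z \<in> \<O> \<longleftrightarrow> val_ge (ord_at \<O>) 0 z"
proof -
  assume z: "z \<in> K"
  obtain t where t: "uniformizer \<O> t" "\<And>z. z \<in> K \<Longrightarrow> z \<noteq> 0 \<Longrightarrow> \<exists>u\<in>unit_set \<O>. z = u * t powi (ord_at \<O> z)"
    using obtain_uniformizer by metis
  have t0: "t \<in> \<O>" "t \<noteq> 0" using t(1) by (auto simp: uniformizer_def)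
  show ?thesis
  proof (cases "z = 0")
    case False
    define n where "n = ord_at \<O> z"
    obtain u where u: "u \<in> unit_set \<O>" "z = u * t powi n" using t(2)[OF z False] n_def by blast
    show ?thesis
    proof (cases "n \<ge> 0")
      case True
      then have "z \<in> \<O>" using u t0 by (auto simp: power_int_def unit_set_def O_closed O_power)
      then show ?thesis using True by (simp add: val_ge_def n_def)
    next
      case neg: False
      have "z \<notin> \<O>"
      proof
        assume "z \<in> \<O>"
        \<comment> \<open>With \<open>z = u * t powi n\<close> and \<open>n < 0\<close>, this
          exponent leaves exactly \<open>inverse t\<close>.\<close>
        then have "z * inverse u * t ^ (nat (- n) - 1) \<in> \<O>"
          using u t0 by (intro O_closed O_power) (auto simp: unit_set_def)
        moreover have "z * inverse u * t ^ (nat (- n) - 1) = inverse t"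
        proof -
          obtain j where j: "nat (- n) = Suc j" using neg by (cases "nat (-n)") auto
          have "z * inverse u = t powi n" using u by (auto simp: unit_set_def)
          also have "\<dots> = inverse (t ^ Suc j)" using neg by (simp add: power_int_def j power_inverse)
          finally show ?thesis using t0 by (simp add: j field_simps)
        qed
        ultimately have "t \<in> unit_set \<O>" using t0 by (simp add: unit_set_def)
        then show False using uniformizer_not_unit t(1) by simp
      qed
      then show ?thesis using neg False by (simp add: val_ge_def n_def)
    qed
  qed (auto simp: O_closed)
qed

lemma valuation: obtains t where "uniformizer \<O> t" "discrete_valuation K (ord_at \<O>) t"
proof -
  obtain t where t: "uniformizer \<O> t" "\<And>z. z \<in> K \<Longrightarrow> z \<noteq> 0 \<Longrightarrow> \<exists>u\<in>unit_set \<O>. z = u * t powi (ord_at \<O> z)"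
    using obtain_uniformizer by metis
  have t0: "t \<in> \<O>" "t \<noteq> 0" using t(1) by (auto simp: uniformizer_def)
  have t1: "ord_at \<O> t = 1" using ord_at_eqI[OF t(1) unit_one, of t 1] by simp
  have mult: "ord_at \<O> (a * b) = ord_at \<O> a + ord_at \<O> b"
    if ab: "a \<in> K" "b \<in> K" "a \<noteq> 0" "b \<noteq> 0" for a b
  proof -
    obtain u w where u: "u \<in> unit_set \<O>" "w \<in> unit_set \<O>"
      "a = u * t powi (ord_at \<O> a)" "b = w * t powi (ord_at \<O> b)"
      using t(2)[OF ab(1,3)] t(2)[OF ab(2,4)] by blast
    have "a * b = (u * t powi (ord_at \<O> a)) * (w * t powi (ord_at \<O> b))"
      by (rule arg_cong2[OF u(3,4)])
    also have "\<dots> = (u * w) * t powi (ord_at \<O> a + ord_at \<O> b)"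
      using t0 by (simp add: power_int_add mult_ac)
    finally have "a * b = (u * w) * t powi (ord_at \<O> a + ord_at \<O> b)" .
    then show ?thesis using ord_at_eqI[OF t(1) unit_mult[OF u(1,2)]] by metis
  qed
  have add: "min (ord_at \<O> a) (ord_at \<O> b) \<le> ord_at \<O> (a + b)"
    if ab: "a \<in> K" "b \<in> K" "a \<noteq> 0" "b \<noteq> 0" "a + b \<noteq> 0" for a b
  proof -
    \<comment> \<open>Dividing by \<open>t powi n\<close> moves both summands into
      \<open>\<O>\<close>, where closure under addition gives the claim.\<close>
    define n where "n = min (ord_at \<O> a) (ord_at \<O> b)"
    have tn: "t powi n \<in> K" "t powi n \<noteq> 0" "ord_at \<O> (t powi n) = n"
      using t0 O_subset ord_at_eqI[OF t(1) unit_one, of "t powi n" n] by auto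
    have div: "c / t powi n \<in> \<O>" if c: "c \<in> K" "c \<noteq> 0" "ord_at \<O> c \<ge> n" for c
    proof -
      have "ord_at \<O> c = ord_at \<O> (c / t powi n * t powi n)" using t0 by simp
      also have "\<dots> = ord_at \<O> (c / t powi n) + n"
        using c tn mult by (subst mult) auto
      finally show ?thesis using c tn by (subst O_iff_ord) (auto simp: val_ge_def)
    qed
    have "a / t powi n + b / t powi n \<in> \<O>"
      using ab by (intro O_closed div) (auto simp: n_def)
    then have "(a + b) / t powi n \<in> \<O>" by (simp add: add_divide_distrib)
    then have "ord_at \<O> ((a + b) / t powi n) \<ge> 0"
      using ab tn by (subst (asm) O_iff_ord) (auto simp: val_ge_def)
    moreover have "ord_at \<O> (a + b) = ord_at \<O> ((a + b) / t powi n * t powi n)" using t0 by simp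
    moreover have "\<dots> = ord_at \<O> ((a + b) / t powi n) + n"
      using ab tn by (subst mult) auto
    ultimately show ?thesis by (simp add: n_def)
  qed
  have "discrete_valuation K (ord_at \<O>) t"
    by unfold_locales (use mult add t0 t1 O_subset in auto)
  with t(1) that show thesis by blast
qed

end

text \<open>Converse to the passage from places to valuations. It is needed to obtain a place of
  \<open>E\<close> from the valuation \<open>v (N z)\<close>.\<close>

lemma vring_place:
  fixes K :: "'a::alg_closed_field set"
  assumes "discrete_valuation K v t"
  shows "{z \<in> K. val_ge v 0 z} \<in> places K"
    and "z \<in> K \<Longrightarrow> z \<noteq> 0 \<Longrightarrow> ord_at {z \<in> K. val_ge v 0 z} z = v z"
proof -
  interpret discrete_valuation K v t by fact
  interpret R: ring "\<Omega> :: 'a ring" by (rule ring_from_type_algebra)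
  define A where "A = {z \<in> K. vge 0 z}"
  have units: "unit_set A = {z \<in> K. z \<noteq> 0 \<and> v z = 0}"
    by (auto simp: unit_set_def A_def val_ge_def val_inverse inverse_mem)
  have max: "max_ideal A = {z \<in> K. vge 1 z}"
    unfolding max_ideal_def units by (auto simp: A_def val_ge_def)
  have unif: "uniformizer A t"
    unfolding uniformizer_def max
  proof (intro conjI)
    show "{z \<in> K. vge 1 z} = {t * a |a. a \<in> A}"
    proof (intro equalityI subsetI)
      fix z assume "z \<in> {z \<in> K. vge 1 z}"
      then have "z = t * (z / t)" "z / t \<in> A"
        using val_divide[of z t] by (cases "z = 0"; force simp: A_def val_ge_def)+
      then show "z \<in> {t * a |a. a \<in> A}" by blast
    next
      fix z assume "z \<in> {t * a |a. a \<in> A}"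
      then obtain a where "z = t * a" "a \<in> K" "vge 0 a" by (auto simp: A_def)
      then show "z \<in> {z \<in> K. vge 1 z}" using vge_mult[of t a 1 0] by (auto simp: val_ge_def)
    qed
  qed (auto simp: A_def val_ge_def)
  have dec: "\<exists>u\<in>unit_set A. z = u * t powi (v z)" if "z \<in> K" "z \<noteq> 0" for z
  proof (rule bexI)
    show "z = z / t powi (v z) * t powi (v z)" by simp
    have "v (z / t powi (v z)) = v z - v (t powi (v z))"
      using that by (intro val_divide) auto
    then show "z / t powi (v z) \<in> unit_set A"
      using that by (auto simp: units val_power_int intro!: divide_mem power_int_mem)
  qed
  have "subring A \<Omega>"
  proof (rule R.subringI)
    show "A \<subseteq> carrier \<Omega>" by (simp add: ring_of_type_algebra_def)
    show "\<one>\<^bsub>\<Omega>\<^esub> \<in> A" by (simp add: ring_of_type_algebra_def A_def)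
    show "\<ominus>\<^bsub>\<Omega>\<^esub> h \<in> A" if "h \<in> A" for h
      using that by (auto simp: a_inv_ring_of_type A_def intro: vge_minus)
    show "h1 \<otimes>\<^bsub>\<Omega>\<^esub> h2 \<in> A" "h1 \<oplus>\<^bsub>\<Omega>\<^esub> h2 \<in> A" if "h1 \<in> A" "h2 \<in> A" for h1 h2
      using that by (auto simp: ring_of_type_algebra_def A_def intro: vge_mult0 vge_add)
  qed
  moreover have "A \<subset> K"
  proof -
    have "inverse t \<in> K - A" by (auto simp: A_def val_ge_def val_inverse)
    then show ?thesis by (auto simp: A_def)
  qed
  ultimately have pl: "A \<in> places K"
    unfolding places_def by (intro CollectI conjI exI[of _ t]) (use unif dec in auto)
  then show "{z \<in> K. val_ge v 0 z} \<in> places K" by (simp add: A_def)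
  interpret place K A by unfold_locales (rule pl)
  show "ord_at {z \<in> K. val_ge v 0 z} z = v z" if "z \<in> K" "z \<noteq> 0"
    using dec[OF that] ord_at_eqI[OF unif] unfolding A_def[symmetric] by blast
qed

section \<open>Finiteness of the residue field\<close>

subsection \<open>Algebraic elements in terms of type-class polynomials\<close>

text \<open>HOL-Algebra stores a polynomial with the leading coefficient first, \<open>Poly\<close>
  with the constant term first; hence \<open>rev\<close>.\<close>

lemma eval_ring_of_type:
  fixes x :: "'a::alg_closed_field"
  shows "ring.eval \<Omega> p x = poly (Poly (rev p)) x"
proof -
  interpret R: ring "\<Omega> :: 'a ring" by (rule ring_from_type_algebra)
  have pow: "x [^]\<^bsub>\<Omega>\<^esub> n = x ^ n" for n :: nat
    by (induction n) (auto simp: ring_of_type_algebra_def nat_pow_def mult.commute)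
  have zero: "\<zero>\<^bsub>\<Omega>\<^esub> = (0::'a)" and add: "a \<oplus>\<^bsub>\<Omega>\<^esub> b = a + b" and mult: "a \<otimes>\<^bsub>\<Omega>\<^esub> b = a * b" for a b :: 'a
    by (simp_all add: ring_of_type_algebra_def)
  have "R.eval p x = (\<Sum>i<length p. p ! i * x ^ (length p - Suc i))"
  proof (induction p)
    case (Cons a p)
    show ?case
      by (simp add: Cons.IH sum.lessThan_Suc_shift pow add mult del: sum.lessThan_Suc)
  qed (simp add: zero)
  also have "\<dots> = (\<Sum>i<length p. rev p ! i * x ^ i)"
    by (rule sum.reindex_bij_witness[where i = "\<lambda>i. length p - Suc i" and j = "\<lambda>i. length p - Suc i"])
       (auto simp: rev_nth)
  also have "\<dots> = poly (Poly (rev p)) x"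
  proof -
    have "poly (Poly xs) x = (\<Sum>i<length xs. xs ! i * x ^ i)" for xs
    proof (induction xs)
      case (Cons a xs)
      then show ?case
        by (simp add: sum.lessThan_Suc_shift sum_distrib_left mult_ac del: sum.lessThan_Suc)
    qed auto
    from this[of "rev p"] show ?thesis by simp
  qed
  finally show ?thesis .
qed

definition coeffs_in :: "'a::zero set \<Rightarrow> 'a poly \<Rightarrow> bool"
  where "coeffs_in K f \<longleftrightarrow> (\<forall>i. coeff f i \<in> K)"

lemma algebraic_iff_root:
  fixes x :: "'a::alg_closed_field"
  assumes "subring K \<Omega>"
  shows "(ring.algebraic \<Omega> over K) x \<longleftrightarrow> (\<exists>f. f \<noteq> 0 \<and> coeffs_in K f \<and> poly f x = 0)"
proof -
  interpret R: field "\<Omega> :: 'a ring" by (rule field_from_type_algebra)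
  have K0: "0 \<in> K" using subring_closed(1)[OF assms] .
  have carr: "p \<in> carrier (K[X]\<^bsub>\<Omega>\<^esub>) \<longleftrightarrow> set p \<subseteq> K \<and> (p \<noteq> [] \<longrightarrow> hd p \<noteq> 0)" for p
    by (auto simp: univ_poly_def polynomial_def ring_of_type_algebra_def)
  show ?thesis
  proof
    assume alg: "(ring.algebraic \<Omega> over K) x"
    obtain p where p: "p \<in> carrier (K[X]\<^bsub>\<Omega>\<^esub>)" "p \<noteq> []" "R.eval p x = \<zero>\<^bsub>\<Omega>\<^esub>"
      using R.algebraicE[OF assms _ alg] by (auto simp: ring_of_type_algebra_def)
    obtain a q where aq: "p = a # q" using p(2) by (cases p) auto
    have "coeff (Poly (rev p)) (length q) = a"
      by (simp add: aq nth_default_append)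
    moreover have "a \<noteq> 0" using p(1) aq by (auto simp: carr)
    ultimately have "Poly (rev p) \<noteq> 0" by (metis coeff_0)
    moreover have "coeffs_in K (Poly (rev p))"
      using p(1) K0 unfolding carr coeffs_in_def
      by (auto simp: nth_default_def) (metis nth_mem length_rev set_rev subsetD)
    ultimately show "\<exists>f. f \<noteq> 0 \<and> coeffs_in K f \<and> poly f x = 0"
      using p(3)[unfolded eval_ring_of_type] by (auto simp: ring_of_type_algebra_def)
  next
    assume "\<exists>f. f \<noteq> 0 \<and> coeffs_in K f \<and> poly f x = 0"
    then obtain f where f: "f \<noteq> 0" "coeffs_in K f" "poly f x = 0" by blast
    have "rev (coeffs f) \<in> carrier (K[X]\<^bsub>\<Omega>\<^esub>)"
      using f unfolding carr
      by (auto simp: coeffs_in_def hd_rev last_coeffs_eq_coeff_degree coeffs_def)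
    moreover have "R.eval (rev (coeffs f)) x = \<zero>\<^bsub>\<Omega>\<^esub>"
      unfolding eval_ring_of_type using f(3) by (simp add: ring_of_type_algebra_def)
    ultimately show "(ring.algebraic \<Omega> over K) x"
      using f(1) by (intro R.algebraicI[of "rev (coeffs f)"]) auto
  qed
qed

lemma combine_ring_of_type:
  fixes Ks Us :: "'a::alg_closed_field list"
  assumes "length Ks = length Us"
  shows "ring.combine \<Omega> Ks Us = (\<Sum>i<length Us. Ks ! i * Us ! i)"
proof -
  interpret R: ring "\<Omega> :: 'a ring" by (rule ring_from_type_algebra)
  have zero: "\<zero>\<^bsub>\<Omega>\<^esub> = (0::'a)" and add: "a \<oplus>\<^bsub>\<Omega>\<^esub> b = a + b" and mult: "a \<otimes>\<^bsub>\<Omega>\<^esub> b = a * b" for a b :: 'a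
    by (simp_all add: ring_of_type_algebra_def)
  show ?thesis using assms
  proof (induction Ks Us rule: list_induct2)
    case (Cons k Ks u Us)
    then show ?case
      by (simp add: sum.lessThan_Suc_shift add mult del: sum.lessThan_Suc)
  qed (simp add: zero)
qed

lemma poly_altdef_le: "degree f \<le> n \<Longrightarrow> poly f x = (\<Sum>i\<le>n. coeff f i * x ^ i)"
  for f :: "'a::comm_ring_1 poly"
  unfolding poly_altdef by (rule sum.mono_neutral_left) (auto simp: coeff_eq_0)

text \<open>With \<open>n\<close> the dimension, the \<open>n + 1\<close> powers
  \<open>1, z, ..., z ^ n\<close> are dependent. The point is that the bound does not depend on
  \<open>z\<close>: it leaves only finitely many candidates for the reduced equations of
  residues.\<close>

lemma finite_dimension_bounded_degree:
  fixes K F :: "'a::alg_closed_field set"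
  assumes K: "subfield K \<Omega>" and F: "subfield F \<Omega>" and fd: "ring.finite_dimension \<Omega> K F"
  obtains d where
    "\<And>z. z \<in> F \<Longrightarrow> \<exists>f. f \<noteq> 0 \<and> degree f \<le> d \<and> coeffs_in K f \<and> poly f z = 0"
proof -
  interpret R: field "\<Omega> :: 'a ring" by (rule field_from_type_algebra)
  interpret F: subfield_set F by (rule subfield_set_of_subfield[OF F])
  interpret K: subfield_set K by (rule subfield_set_of_subfield[OF K])
  obtain n where n: "R.dimension n K F" using fd by auto
  have "\<exists>f. f \<noteq> 0 \<and> degree f \<le> n \<and> coeffs_in K f \<and> poly f z = 0" if z: "z \<in> F" for z
  proof -
    define Us where "Us = map (\<lambda>i. z ^ i) [0..<Suc n]"
    have Us: "set Us \<subseteq> F" "length Us = Suc n" using z by (auto simp: Us_def)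
    have "\<not> R.independent K Us"
      using R.independent_length_le_dimension[OF K n _ Us(1)] Us(2) by auto
    then obtain Ks where Ks: "length Ks = length Us" "R.combine Ks Us = \<zero>\<^bsub>\<Omega>\<^esub>" "set Ks \<subseteq> K"
      "set Ks \<noteq> {\<zero>\<^bsub>\<Omega>\<^esub>}"
      using R.dependent_imp_non_trivial_combine[OF K, of Us] by (auto simp: ring_of_type_algebra_def)
    define f where "f = Poly Ks"
    have cf: "coeff f i = (if i < Suc n then Ks ! i else 0)" for i
      using Ks(1) Us(2) by (simp add: f_def nth_default_def)
    have "f \<noteq> 0"
    proof
      assume "f = 0"
      then have "Ks ! i = 0" if "i < Suc n" for i using cf[of i] that by simp
      then have "set Ks = {0}" using Ks(1) Us(2) by (force simp: set_conv_nth)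
      then show False using Ks(4) by (simp add: ring_of_type_algebra_def)
    qed
    moreover have "degree f \<le> n" by (rule degree_le) (simp add: cf)
    moreover have "coeffs_in K f"
      using Ks(1,3) Us(2) unfolding coeffs_in_def cf by (auto simp: subset_iff)
    moreover have "poly f z = 0"
    proof -
      have "poly f z = (\<Sum>i\<le>n. coeff f i * z ^ i)"
        using \<open>degree f \<le> n\<close> by (rule poly_altdef_le)
      also have "\<dots> = (\<Sum>i<Suc n. Ks ! i * z ^ i)"
        by (simp add: lessThan_Suc_atMost cf)
      also have "\<dots> = R.combine Ks Us"
        using Us(2) by (subst combine_ring_of_type[OF Ks(1)]) (auto simp: Us_def intro!: sum.cong simp del: upt_Suc)
      finally show ?thesis using Ks(2) by (simp add: ring_of_type_algebra_def)
    qed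
    ultimately show ?thesis by blast
  qed
  with that show thesis by blast
qed

context subfield_set
begin

lemma coeffs_in_zero [simp]: "coeffs_in K 0"
  by (simp add: coeffs_in_def)

lemma coeffs_in_one [simp]: "coeffs_in K 1"
  by (simp add: coeffs_in_def one_pCons coeff_pCons split: nat.split)

lemma coeffs_in_pCons [simp]: "coeffs_in K (pCons a f) \<longleftrightarrow> a \<in> K \<and> coeffs_in K f"
  by (auto simp: coeffs_in_def coeff_pCons split: nat.splits)

lemma coeffs_in_add: "coeffs_in K f \<Longrightarrow> coeffs_in K g \<Longrightarrow> coeffs_in K (f + g)"
  by (auto simp: coeffs_in_def)

lemma coeffs_in_minus: "coeffs_in K f \<Longrightarrow> coeffs_in K (- f)"
  by (auto simp: coeffs_in_def)

lemma coeffs_in_mult: "coeffs_in K f \<Longrightarrow> coeffs_in K g \<Longrightarrow> coeffs_in K (f * g)"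
  by (auto simp: coeffs_in_def coeff_mult)

lemma coeffs_in_prod: "(\<And>i. i \<in> I \<Longrightarrow> coeffs_in K (f i)) \<Longrightarrow> coeffs_in K (prod f I)"
  by (induction I rule: infinite_finite_induct) (auto intro: coeffs_in_mult)

lemma poly_mem: "coeffs_in K f \<Longrightarrow> x \<in> K \<Longrightarrow> poly f x \<in> K"
  by (induction f) auto

end

lemma generate_field_quotients:
  fixes k :: "'a::alg_closed_field set"
  assumes k: "subfield k \<Omega>" and c: "c \<in> generate_field \<Omega> (insert x k)"
  obtains P Q where "coeffs_in k P" "coeffs_in k Q" "poly Q x \<noteq> 0" "c = poly P x / poly Q x"
proof -
  interpret k: subfield_set k by (rule subfield_set_of_subfield[OF k])
  have "\<exists>P Q. coeffs_in k P \<and> coeffs_in k Q \<and> poly Q x \<noteq> 0 \<and> c = poly P x / poly Q x"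
    using c
  proof (induction rule: generate_field.induct)
    case one
    show ?case by (rule exI[of _ 1], rule exI[of _ 1]) (simp add: ring_of_type_algebra_def)
  next
    case (incl h)
    then consider "h = x" | "h \<in> k" by blast
    then show ?case
    proof cases
      case 1 then show ?thesis by (intro exI[of _ "[:0, 1:]"] exI[of _ 1]) simp
    next
      case 2 then show ?thesis by (intro exI[of _ "[:h:]"] exI[of _ 1]) simp
    qed
  next
    case (a_inv h)
    then obtain P Q where "coeffs_in k P" "coeffs_in k Q" "poly Q x \<noteq> 0" "h = poly P x / poly Q x" by blast
    then show ?case
      by (intro exI[of _ "- P"] exI[of _ Q]) (simp add: a_inv_ring_of_type k.coeffs_in_minus)
  next
    case (m_inv h)
    then obtain P Q where "coeffs_in k P" "coeffs_in k Q" "poly Q x \<noteq> 0" "h = poly P x / poly Q x" by blast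
    with m_inv(2) show ?case
      by (intro exI[of _ Q] exI[of _ P])
         (auto simp: m_inv_ring_of_type ring_of_type_algebra_def[THEN arg_cong, of ring.zero])
  next
    case (eng_add g h)
    then obtain P Q P' Q' where "coeffs_in k P" "coeffs_in k Q" "poly Q x \<noteq> 0" "g = poly P x / poly Q x"
      "coeffs_in k P'" "coeffs_in k Q'" "poly Q' x \<noteq> 0" "h = poly P' x / poly Q' x" by blast
    then show ?case
      by (intro exI[of _ "P * Q' + P' * Q"] exI[of _ "Q * Q'"])
         (auto simp: ring_of_type_algebra_def add_frac_eq intro!: k.coeffs_in_add k.coeffs_in_mult)
  next
    case (eng_mult g h)
    then obtain P Q P' Q' where "coeffs_in k P" "coeffs_in k Q" "poly Q x \<noteq> 0" "g = poly P x / poly Q x"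
      "coeffs_in k P'" "coeffs_in k Q'" "poly Q' x \<noteq> 0" "h = poly P' x / poly Q' x" by blast
    then show ?case
      by (intro exI[of _ "P * P'"] exI[of _ "Q * Q'"])
         (auto simp: ring_of_type_algebra_def intro!: k.coeffs_in_mult)
  qed
  with that show thesis by blast
qed

lemma subfield_generate:
  fixes k :: "'a::alg_closed_field set"
  shows "subfield (generate_field \<Omega> (insert x k)) \<Omega>"
proof -
  interpret R: field "\<Omega> :: 'a ring" by (rule field_from_type_algebra)
  show ?thesis by (rule R.generate_field_is_subfield) (simp add: ring_of_type_algebra_def)
qed

text \<open>The exchange argument: in a relation between \<open>t\<close> and \<open>x\<close> over \<open>k\<close>, both variables occur.\<close>

lemma algebraic_exchange:
  fixes k :: "'a::alg_closed_field set"
  assumes k: "subfield k \<Omega>"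
    and t_alg: "(ring.algebraic \<Omega> over generate_field \<Omega> (insert x k)) t"
    and t_trans: "\<not> (ring.algebraic \<Omega> over k) t"
  shows "(ring.algebraic \<Omega> over generate_field \<Omega> (insert t k)) x"
proof -
  interpret R: field "\<Omega> :: 'a ring" by (rule field_from_type_algebra)
  interpret k: subfield_set k by (rule subfield_set_of_subfield[OF k])
  let ?kt = "generate_field \<Omega> (insert t k)"
  interpret kt: subfield_set ?kt by (rule subfield_set_of_subfield[OF subfield_generate])
  have kt: "k \<subseteq> ?kt" "t \<in> ?kt" by (auto intro: generate_field.incl)
  obtain f where f: "f \<noteq> 0" "coeffs_in (generate_field \<Omega> (insert x k)) f" "poly f t = 0"
    using t_alg algebraic_iff_root[OF subfieldE(1)[OF subfield_generate]] by blast
  have "\<forall>i. \<exists>P Q. coeffs_in k P \<and> coeffs_in k Q \<and> poly Q x \<noteq> 0 \<and> coeff f i = poly P x / poly Q x"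
    using f(2) generate_field_quotients[OF k] unfolding coeffs_in_def[of _ f] by metis
  then obtain P Q where PQ: "\<And>i. coeffs_in k (P i)" "\<And>i. coeffs_in k (Q i)" "\<And>i. poly (Q i) x \<noteq> 0"
    "\<And>i. coeff f i = poly (P i) x / poly (Q i) x" by metis
  define n where "n = degree f"
  \<comment> \<open>\<open>R i\<close> is the \<open>i\<close>-th coefficient after clearing all
    denominators; \<open>c\<close> is the value of the common denominator at
    \<open>x\<close>.\<close>
  define R where "R i = P i * (\<Prod>j\<in>{..n} - {i}. Q j)" for i
  define c where "c = (\<Prod>j\<le>n. poly (Q j) x)"
  have c: "c \<noteq> 0" using PQ(3) by (auto simp: c_def)
  have R: "poly (R i) x = c * coeff f i" if "i \<le> n" for i
    using PQ(3)[of i] that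
    by (simp add: R_def c_def poly_prod PQ(4) prod.remove[of "{..n}" i])
  have Rk: "coeffs_in k (R i)" for i
    unfolding R_def using PQ by (intro k.coeffs_in_mult k.coeffs_in_prod) auto
  define N where "N = Max ((\<lambda>i. degree (R i)) ` {..n})"
  have N: "degree (R i) \<le> N" if "i \<le> n" for i unfolding N_def using that by (intro Max_ge) auto
  \<comment> \<open>Regrouping by powers of \<open>x\<close>: \<open>S j\<close> is the coefficient
    of \<open>x ^ j\<close>, read as a polynomial over \<open>k\<close> to be evaluated at
    \<open>t\<close>. So \<open>g\<close> is the same relation, viewed as a polynomial in
    \<open>x\<close> over the field generated by \<open>t\<close>.\<close>
  define S where "S j = (\<Sum>i\<le>n. monom (coeff (R i) j) i)" for j
  have cS: "coeff (S j) i = (if i \<le> n then coeff (R i) j else 0)" for i j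
    by (simp add: S_def coeff_sum)
  define g where "g = (\<Sum>j\<le>N. monom (poly (S j) t) j)"
  have cg: "coeff g j = (if j \<le> N then poly (S j) t else 0)" for j
    by (simp add: g_def coeff_sum)
  have Sk: "coeffs_in k (S j)" for j
    using Rk by (auto simp: coeffs_in_def cS)
  have "poly g x = (\<Sum>j\<le>N. poly (S j) t * x ^ j)"
    by (simp add: g_def poly_sum poly_monom)
  also have "\<dots> = (\<Sum>j\<le>N. \<Sum>i\<le>n. coeff (R i) j * t ^ i * x ^ j)"
    by (simp add: S_def poly_sum poly_monom sum_distrib_right)
  also have "\<dots> = (\<Sum>i\<le>n. \<Sum>j\<le>N. coeff (R i) j * t ^ i * x ^ j)"
    by (rule sum.swap)
  also have "\<dots> = (\<Sum>i\<le>n. poly (R i) x * t ^ i)"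
    by (intro sum.cong refl) (simp add: poly_altdef_le[OF N] sum_distrib_left sum_distrib_right mult_ac)
  also have "\<dots> = c * poly f t"
    using R by (simp add: poly_altdef n_def sum_distrib_left mult_ac)
  finally have "poly g x = 0" using f(3) by simp
  moreover have "coeffs_in ?kt g"
  proof -
    have "coeffs_in ?kt (S j)" for j using Sk[of j] kt(1) by (auto simp: coeffs_in_def)
    then show ?thesis unfolding coeffs_in_def[of _ g] cg using kt(2) by (auto intro: kt.poly_mem)
  qed
  moreover have "g \<noteq> 0"
  proof
    \<comment> \<open>As \<open>t\<close> is transcendental over \<open>k\<close>, vanishing of
      \<open>S j\<close> at \<open>t\<close> kills the polynomial \<open>S j\<close>. Then the
      leading coefficient of \<open>f\<close> would vanish.\<close>
    assume g0: "g = 0"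
    have "coeff (R n) j = 0" for j
    proof (cases "j \<le> N")
      case True
      then have "poly (S j) t = 0" using cg[of j] g0 by simp
      then have "S j = 0" using Sk[of j] t_trans algebraic_iff_root[OF subfieldE(1)[OF k]] by blast
      then show ?thesis using cS[of j n] by simp
    next
      case False
      then show ?thesis using N[of n] by (intro coeff_eq_0) auto
    qed
    then have "R n = 0" by (simp add: poly_eq_iff)
    then have "c * coeff f n = 0" using R[of n] by simp
    then show False using c f(1) by (simp add: n_def)
  qed
  ultimately show ?thesis
    using algebraic_iff_root[OF subfieldE(1)[OF subfield_generate]] by blast
qed

text \<open>Tower argument with \<open>L = k(t)(x)\<close>: it is finite over \<open>k(t)\<close> by
  the exchange, and a list spanning \<open>F\<close> over \<open>k(x)\<close> also spans it over
  \<open>L\<close>, which contains \<open>k(x)\<close>.\<close>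

lemma finite_dimension_exchange:
  fixes k F :: "'a::alg_closed_field set"
  assumes k: "subfield k \<Omega>" and F: "subfield F \<Omega>" and kF: "k \<subseteq> F" "x \<in> F" "t \<in> F"
    and fd: "ring.finite_dimension \<Omega> (generate_field \<Omega> (insert x k)) F"
    and t_trans: "\<not> (ring.algebraic \<Omega> over k) t"
  shows "ring.finite_dimension \<Omega> (generate_field \<Omega> (insert t k)) F"
proof -
  interpret R: field "\<Omega> :: 'a ring" by (rule field_from_type_algebra)
  let ?kx = "generate_field \<Omega> (insert x k)" and ?kt = "generate_field \<Omega> (insert t k)"
  note sf = subfield_generate[of _ k]
  have carr [simp]: "A \<subseteq> carrier \<Omega>" "a \<in> carrier \<Omega>" for A and a :: 'a
    by (auto simp: ring_of_type_algebra_def)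
  have t_alg: "(ring.algebraic \<Omega> over ?kx) t"
    by (rule R.finite_dimension_imp_algebraic[OF sf subfieldE(1)[OF F] fd kF(3)])
  note x_alg = algebraic_exchange[OF k t_alg t_trans]
  define L where "L = R.simple_extension ?kt x"
  have L: "subfield L \<Omega>" unfolding L_def
    using R.simple_extension_is_subfield[OF sf] x_alg by auto
  have fdL: "R.finite_dimension ?kt L" unfolding L_def
    using R.finite_dimension_simple_extension[OF sf] x_alg by auto
  have ktF: "?kt \<subseteq> F" by (rule R.generate_field_min_subfield1[OF _ F]) (use kF in auto)
  have LF: "L \<subseteq> F" unfolding L_def
    by (rule R.simple_extension_subring_incl[OF subfieldE(1)[OF F] ktF kF(2)])
  have "?kt \<subseteq> L" unfolding L_def by (rule R.simple_extension_incl) auto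
  moreover have "k \<subseteq> ?kt" by (auto intro: generate_field.incl)
  moreover have "x \<in> L" unfolding L_def
    by (rule R.simple_extension_mem[OF subfieldE(1)[OF sf]]) auto
  ultimately have kxL: "?kx \<subseteq> L"
    by (intro R.generate_field_min_subfield1[OF _ L]) auto
  obtain n where n: "R.dimension n ?kx F" using fd by auto
  obtain Us where Us: "R.Span ?kx Us = F" "set Us \<subseteq> F"
    using R.exists_base[OF sf n] R.Span_base_incl[OF sf] by (metis carr(1))
  have "R.Span L Us = F"
  proof
    have sub: "subalgebra L F \<Omega>"
    proof (intro subalgebra.intro subalgebra_axioms.intro)
      show "subgroup F (add_monoid \<Omega>)"
        using subring.axioms(1)[OF subfieldE(1)[OF F]] .
      show "c \<otimes>\<^bsub>\<Omega>\<^esub> v \<in> F" if "c \<in> L" "v \<in> F" for c v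
        using subringE(6)[OF subfieldE(1)[OF F]] that LF by blast
    qed
    show "R.Span L Us \<subseteq> F"
      by (rule R.subalgebra_Span_incl[OF L sub Us(2)])
    show "F \<subseteq> R.Span L Us"
    proof
      fix a assume "a \<in> F"
      then obtain Ks where "set Ks \<subseteq> ?kx" "length Ks = length Us" "a = R.combine Ks Us"
        using R.Span_mem_iff_length_version[OF sf, of Us] Us(1) by auto
      then show "a \<in> R.Span L Us"
        using R.Span_mem_iff_length_version[OF L, of Us] kxL by auto
    qed
  qed
  then have "R.finite_dimension L F"
    using R.Span_finite_dimension[OF L, of Us] by simp
  then show ?thesis
    using R.telescopic_base_dim(1)[OF sf L fdL] by blast
qed

subsection \<open>Residues\<close>

context discrete_valuation
begin

text \<open>A nonzero polynomial over the residue field has finitely many roots. The quotient is not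
  formed: \<open>S\<close> collects integral representatives, and each induction step splits off a
  root modulo the maximal ideal by synthetic division.\<close>

lemma finite_roots_mod:
  assumes "degree h \<le> n" "coeffs_in K h" "\<And>i. vge 0 (coeff h i)" "\<not> (\<forall>i. vge 1 (coeff h i))"
  shows "\<exists>S. finite S \<and> S \<subseteq> {z\<in>K. vge 0 z} \<and>
    (\<forall>z\<in>K. vge 0 z \<longrightarrow> vge 1 (poly h z) \<longrightarrow> (\<exists>s\<in>S. vge 1 (z - s)))"
  using assms
proof (induction n arbitrary: h)
  case 0
  then obtain a where "h = [:a:]" by (metis degree_eq_zeroE le_zero_eq)
  with 0(4) have "\<not> vge 1 a" using val_ge_0 by (metis coeff_pCons_0 coeff_pCons_Suc coeff_0 not0_implies_Suc)
  with \<open>h = [:a:]\<close> show ?case by (intro exI[of _ "{}"]) auto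
next
  case (Suc n)
  show ?case
  proof (cases "\<exists>z0\<in>K. vge 0 z0 \<and> vge 1 (poly h z0)")
    case False then show ?thesis by (intro exI[of _ "{}"]) auto
  next
    case True
    then obtain z0 where z0: "z0 \<in> K" "vge 0 z0" "vge 1 (poly h z0)" by blast
    define q where "q = synthetic_div h z0"
    have h: "h = [:-z0, 1:] * q + [:poly h z0:]"
      unfolding q_def by (rule synthetic_div_correct'[symmetric])
    have vp: "poly g z \<in> K \<and> vge 0 (poly g z)"
      if "coeffs_in K g" "\<forall>i. vge 0 (coeff g i)" "z \<in> K" "vge 0 z" for g z
      using that
    proof (induction g)
      case (pCons a g)
      then have "\<forall>i. vge 0 (coeff g i)" "vge 0 a" by (metis coeff_pCons_Suc, metis coeff_pCons_0)
      with pCons show ?case by (auto intro!: vge_add vge_mult0)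
    qed auto
    have q: "coeffs_in K (synthetic_div g z0) \<and> (\<forall>i. vge 0 (coeff (synthetic_div g z0) i))"
      if "coeffs_in K g" "\<forall>i. vge 0 (coeff g i)" for g
      using that
    proof (induction g)
      case (pCons a g)
      then have "\<forall>i. vge 0 (coeff g i)" by (metis coeff_pCons_Suc)
      with pCons vp[of g z0] z0 show ?case by (auto simp: coeff_pCons split: nat.split)
    qed auto
    have qK: "coeffs_in K q" "\<And>i. vge 0 (coeff q i)" using q[of h] Suc.prems by (auto simp: q_def)
    have "\<not> (\<forall>i. vge 1 (coeff q i))"
    proof
      assume q1: "\<forall>i. vge 1 (coeff q i)"
      have qi: "coeff q i \<in> K" for i using qK(1) by (simp add: coeffs_in_def)
      have "vge 1 (coeff h i)" for i
      proof -
        have hi: "coeff h i = - (z0 * coeff q i) + (case i of 0 \<Rightarrow> poly h z0 | Suc j \<Rightarrow> coeff q j)"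
          by (subst h) (simp add: coeff_pCons algebra_simps split: nat.split)
        have "poly h z0 \<in> K" using Suc.prems z0 by (intro poly_mem)
        then show ?thesis unfolding hi using q1 z0 qi
          by (auto intro!: vge_add vge_diff vge_minus vge_mult0 split: nat.split)
      qed
      then show False using Suc.prems by blast
    qed
    moreover have "degree q \<le> n" using Suc.prems by (simp add: q_def degree_synthetic_div)
    ultimately obtain S where S: "finite S" "S \<subseteq> {z\<in>K. vge 0 z}"
      "\<forall>z\<in>K. vge 0 z \<longrightarrow> vge 1 (poly q z) \<longrightarrow> (\<exists>s\<in>S. vge 1 (z - s))"
      using Suc.IH[of q] qK by blast
    have "\<exists>s\<in>insert z0 S. vge 1 (z - s)" if z: "z \<in> K" "vge 0 z" "vge 1 (poly h z)" for z
    proof -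
      have pq: "poly q z \<in> K" "vge 0 (poly q z)" using vp[of q z] qK z by auto
      have "poly h z = (z - z0) * poly q z + poly h z0" by (subst h) (simp add: algebra_simps)
      moreover have "vge 1 (poly h z - poly h z0)"
        using z z0 Suc.prems by (intro vge_diff poly_mem) auto
      ultimately have 1: "vge 1 ((z - z0) * poly q z)" by simp
      \<comment> \<open>The residue ring is a domain: two factors of valuation \<open>0\<close> have
        a product of valuation \<open>0\<close>.\<close>
      have "vge 1 (z - z0) \<or> vge 1 (poly q z)"
      proof (rule ccontr)
        assume "\<not> ?thesis"
        moreover have "vge 0 (z - z0)" using z z0 by (intro vge_diff)
        ultimately show False using 1 pq z z0 by (auto simp: val_ge_def val_mult diff_mem)
      qed
      then show ?thesis using S(3) z by blast
    qed
    then show ?thesis using S z0 by (intro exI[of _ "insert z0 S"]) auto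
  qed
qed

end

lemma finite_coeffs_in:
  fixes k :: "'a::zero set"
  assumes "finite k" shows "finite {f. degree f \<le> d \<and> coeffs_in k f}"
proof -
  have "{f. degree f \<le> d \<and> coeffs_in k f} \<subseteq> Poly ` {xs. set xs \<subseteq> k \<and> length xs = Suc d}"
  proof
    fix f assume f: "f \<in> {f. degree f \<le> d \<and> coeffs_in k f}"
    have "f = Poly (map (coeff f) [0..<Suc d])"
      using f by (intro poly_eqI) (auto simp: nth_default_def coeff_eq_0 simp del: upt_Suc)
    then show "f \<in> Poly ` {xs. set xs \<subseteq> k \<and> length xs = Suc d}"
      using f by (intro image_eqI[of _ _ "map (coeff f) [0..<Suc d]"]) (auto simp: coeffs_in_def)
  qed
  moreover have "finite {xs. set xs \<subseteq> k \<and> length xs = Suc d}"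
    using finite_lists_length_eq[OF assms] .
  ultimately show ?thesis by (meson finite_imageI finite_subset)
qed

text \<open>Finiteness of the residue field, stated through representatives so that no quotient ring
  enters.\<close>

locale finite_residue_valuation = discrete_valuation +
  assumes finite_residues:
    "\<exists>S. finite S \<and> S \<subseteq> {z\<in>K. vge 0 z} \<and> (\<forall>z\<in>K. vge 0 z \<longrightarrow> (\<exists>s\<in>S. vge 1 (z - s)))"

text \<open>
  A uniformizer \<open>t\<close> is transcendental over \<open>k\<close>, so \<open>F\<close> is finite over \<open>k(t)\<close>, whose residue field is \<open>k\<close>. The
  residues of \<open>F\<close> are thus roots of finitely many polynomials over \<open>k\<close>.
\<close>

lemma finite_residue_valuation_of_function_field:
  fixes k F :: "'a::alg_closed_field set"
  assumes gff: "global_function_field k F" and val: "discrete_valuation F v t"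
  shows "finite_residue_valuation F v t"
proof -
  interpret R: field "\<Omega> :: 'a ring" by (rule field_from_type_algebra)
  obtain x where gff': "subfield k \<Omega>" "finite k" "subfield F \<Omega>" "k \<subseteq> F" "x \<in> F"
    "R.finite_dimension (generate_field \<Omega> (insert x k)) F"
    "\<And>x. x \<in> F \<Longrightarrow> (ring.algebraic \<Omega> over k) x \<Longrightarrow> x \<in> k"
    using gff unfolding global_function_field_def by blast
  interpret discrete_valuation F v t by (rule val)
  interpret k: subfield_set k by (rule subfield_set_of_subfield[OF gff'(1)])
  \<comment> \<open>A nonzero constant has only finitely many powers, so two of them
    coincide.\<close>
  have k_unit: "v c = 0" if c: "c \<in> k" "c \<noteq> 0" for c
  proof -
    have "finite (range (\<lambda>n::nat. c ^ n))"
      using gff'(2) c by (elim finite_subset[rotated]) auto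
    then have "\<not> inj (\<lambda>n::nat. c ^ n)" using finite_imageD infinite_UNIV_nat by blast
    then obtain i j :: nat where "i \<noteq> j" "c ^ i = c ^ j" by (auto simp: inj_on_def)
    then have "int i * v c = int j * v c" using val_power[of c i] val_power[of c j] c gff'(4) by auto
    then show ?thesis using \<open>i \<noteq> j\<close> by simp
  qed
  have k0: "vge 0 c" if "c \<in> k" for c using k_unit[OF that] by (cases "c = 0") (auto simp: val_ge_def)
  \<comment> \<open>Elements of \<open>F\<close> that are algebraic over \<open>k\<close> lie in
    \<open>k\<close> and have valuation \<open>0\<close> unless they vanish, whereas
    \<open>v t = 1\<close>.\<close>
  have "\<not> (ring.algebraic \<Omega> over k) t" using gff'(7)[of t] k_unit[of t] by auto
  then have "R.finite_dimension (generate_field \<Omega> (insert t k)) F"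
    using finite_dimension_exchange[OF gff'(1,3,4,5)] gff'(6) by simp
  then obtain d where d: "\<And>z. z \<in> F \<Longrightarrow>
      \<exists>f. f \<noteq> 0 \<and> degree f \<le> d \<and> coeffs_in (generate_field \<Omega> (insert t k)) f \<and> poly f z = 0"
    using finite_dimension_bounded_degree[OF subfield_generate gff'(3)] by metis
  have ktF: "generate_field \<Omega> (insert t k) \<subseteq> F"
    by (rule R.generate_field_min_subfield1[OF _ gff'(3)]) (use gff'(4) in \<open>auto simp: ring_of_type_algebra_def\<close>)
  interpret kt: subfield_set "generate_field \<Omega> (insert t k)" by (rule subfield_set_of_subfield[OF subfield_generate])
  have t0: "vge 0 t" by (simp add: val_ge_def)
  have poly_int: "poly P t \<in> F \<and> vge 0 (poly P t)" if "coeffs_in k P" for P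
    using that
  proof (induction P)
    case (pCons a P)
    then have IH: "poly P t \<in> F" "vge 0 (poly P t)" "a \<in> F" "vge 0 a" using gff'(4) k0 by auto
    have "vge 0 (t * poly P t)" using IH t0 by (intro vge_mult0) auto
    then have "vge 0 (a + t * poly P t)" using IH by (intro vge_add mult_mem) auto
    moreover have "a + t * poly P t \<in> F" using IH by (intro add_mem mult_mem) auto
    ultimately show ?case by simp
  qed auto
  \<comment> \<open>Pulling out the lowest power of \<open>t\<close> shows a nonzero polynomial in
    \<open>t\<close> to be a power of \<open>t\<close> times a unit with residue in
    \<open>k\<close>.\<close>
  have leading: "poly P t = 0 \<or> (\<exists>n c w. c \<in> k \<and> c \<noteq> 0 \<and> w \<in> F \<and> vge 0 w \<and> poly P t = t ^ n * (c + t * w))"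
    if "coeffs_in k P" for P
    using that
  proof (induction P)
    case (pCons a P)
    then have P: "coeffs_in k P" "a \<in> k" by auto
    consider "a \<noteq> 0" | "a = 0" "poly P t = 0" | "a = 0" "poly P t \<noteq> 0" by blast
    then show ?case
    proof cases
      case 1
      have "poly (pCons a P) t = t ^ 0 * (a + t * poly P t)" by simp
      then show ?thesis using 1 P poly_int[OF P(1)] by blast
    next
      case 3
      then obtain n c w where ncw: "c \<in> k" "c \<noteq> 0" "w \<in> F" "vge 0 w" "poly P t = t ^ n * (c + t * w)"
        using pCons.IH[OF P(1)] by blast
      have "poly (pCons a P) t = t ^ Suc n * (c + t * w)" using ncw(5) 3 by simp
      then show ?thesis using ncw(1-4) by blast
    qed simp
  qed simp
  have residue_kt: "\<exists>c'\<in>k. vge 1 (c - c')" if c: "c \<in> generate_field \<Omega> (insert t k)" "vge 0 c" for c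
  proof (cases "vge 1 c")
    case True then show ?thesis by (intro bexI[of _ 0]) auto
  next
    case False
    then have c0: "c \<noteq> 0" "v c = 0" using c(2) by (auto simp: val_ge_def)
    obtain P Q where PQ: "coeffs_in k P" "coeffs_in k Q" "poly Q t \<noteq> 0" "c = poly P t / poly Q t"
      using generate_field_quotients[OF gff'(1) c(1)] by metis
    obtain n a w where P: "a \<in> k" "a \<noteq> 0" "w \<in> F" "vge 0 w" "poly P t = t ^ n * (a + t * w)"
      using leading[OF PQ(1)] PQ c0 by auto
    obtain n' b w' where Q: "b \<in> k" "b \<noteq> 0" "w' \<in> F" "vge 0 w'" "poly Q t = t ^ n' * (b + t * w')"
      using leading[OF PQ(2)] PQ by auto
    have unit: "a + t * w \<noteq> 0" "v (a + t * w) = 0" "a + t * w \<in> F"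
      if "a \<in> k" "a \<noteq> 0" "w \<in> F" "vge 0 w" for a w
    proof -
      have tw: "vge 1 (t * w)" using vge_mult[of t w 1 0] that by (auto simp: val_ge_def)
      moreover show aw: "a + t * w \<in> F" using that gff'(4) by (intro add_mem mult_mem) auto
      ultimately show "a + t * w \<noteq> 0" "v (a + t * w) = 0"
        using val_eq_of_close[OF aw, of a 1] that k_unit[of a] gff'(4) by auto
    qed
    note ua = unit[OF P(1-4)] and ub = unit[OF Q(1-4)]
    have "v c = int n - int n'"
      using ua ub by (simp add: PQ(4) P(5) Q(5) val_divide val_mult val_power power_mem mult_mem)
    then have "n = n'" using c0 by simp
    then have c_eq: "c = (a + t * w) / (b + t * w')" using ub by (simp add: PQ(4) P(5) Q(5))
    have "c - a / b = t * (w - a / b * w') / (b + t * w')"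
      using ub Q(2) unfolding c_eq by (simp add: field_simps)
    also have "\<dots> = (w - a / b * w') * inverse (b + t * w') * t" by (simp add: divide_inverse)
    also have "vge 1 \<dots>"
    proof (intro vge_mult0)
      show "vge 0 (w - a / b * w')"
        using P Q gff'(4) k0 by (intro vge_diff vge_mult0) (auto intro!: divide_mem mult_mem)
      show "vge 0 (inverse (b + t * w'))" using ub by (simp add: val_ge_def val_inverse)
      show "vge 1 t" by (simp add: val_ge_def)
    qed (use P Q ub gff'(4) in \<open>auto intro!: divide_mem mult_mem diff_mem inverse_mem\<close>)
    finally show ?thesis using P Q by (intro bexI[of _ "a / b"]) auto
  qed
  \<comment> \<open>Finitely many nonzero polynomials over \<open>k\<close>; every integral
    \<open>z\<close> will be a root of one of them modulo the maximal ideal.\<close>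
  define H where "H = {h. degree h \<le> d \<and> coeffs_in k h} - {0}"
  have "finite H" unfolding H_def using finite_coeffs_in[OF gff'(2)] by auto
  have "\<forall>h\<in>H. \<exists>S. finite S \<and> S \<subseteq> {z\<in>F. vge 0 z} \<and>
      (\<forall>z\<in>F. vge 0 z \<longrightarrow> vge 1 (poly h z) \<longrightarrow> (\<exists>s\<in>S. vge 1 (z - s)))"
  proof (rule ballI, rule finite_roots_mod)
    fix h assume h: "h \<in> H"
    show "degree h \<le> d" "coeffs_in F h" "\<And>i. vge 0 (coeff h i)"
      using h gff'(4) k0 by (auto simp: H_def coeffs_in_def)
    have "coeff h (degree h) \<in> k" "coeff h (degree h) \<noteq> 0" using h by (auto simp: H_def coeffs_in_def)
    then have "\<not> vge 1 (coeff h (degree h))" using k_unit[of "coeff h (degree h)"] by (simp add: val_ge_def)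
    then show "\<not> (\<forall>i. vge 1 (coeff h i))" by blast
  qed
  from bchoice[OF this] obtain S where S: "\<forall>h\<in>H. finite (S h) \<and> S h \<subseteq> {z\<in>F. vge 0 z} \<and>
      (\<forall>z\<in>F. vge 0 z \<longrightarrow> vge 1 (poly h z) \<longrightarrow> (\<exists>s\<in>S h. vge 1 (z - s)))" ..
  have "\<exists>h\<in>H. vge 1 (poly h z)" if z: "z \<in> F" "vge 0 z" for z
  proof -
    obtain f where f: "f \<noteq> 0" "degree f \<le> d" "coeffs_in (generate_field \<Omega> (insert t k)) f" "poly f z = 0"
      using d[OF z(1)] by blast
    define I where "I = {i. i \<le> degree f \<and> coeff f i \<noteq> 0}"
    have "finite I" "I \<noteq> {}" using f(1) by (auto simp: I_def intro!: exI[of _ "degree f"])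
    \<comment> \<open>Dividing by a coefficient of least valuation makes all coefficients integral
      and one of them \<open>1\<close>, so the reduction modulo the maximal ideal is
      nonzero.\<close>
    then obtain i0 where i0: "i0 \<in> I" "\<And>i. i \<in> I \<Longrightarrow> v (coeff f i0) \<le> v (coeff f i)"
    proof -
      have "Min ((\<lambda>i. v (coeff f i)) ` I) \<in> (\<lambda>i. v (coeff f i)) ` I"
        using \<open>finite I\<close> \<open>I \<noteq> {}\<close> by (intro Min_in) auto
      then obtain i0 where "i0 \<in> I" "v (coeff f i0) = Min ((\<lambda>i. v (coeff f i)) ` I)" by auto
      then show thesis using that[of i0] \<open>finite I\<close> by simp
    qed
    define g where "g = smult (inverse (coeff f i0)) f"
    have fF: "coeff f i \<in> F" "coeff f i \<in> generate_field \<Omega> (insert t k)" for i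
      using f(3) ktF by (auto simp: coeffs_in_def)
    have c0: "coeff f i0 \<noteq> 0" using i0 by (simp add: I_def)
    have gi: "coeff g i \<in> generate_field \<Omega> (insert t k)" "coeff g i \<in> F" "vge 0 (coeff g i)" for i
    proof -
      show "coeff g i \<in> generate_field \<Omega> (insert t k)"
        using fF by (auto simp: g_def)
      then show "coeff g i \<in> F" using ktF by blast
      show "vge 0 (coeff g i)"
      proof (cases "coeff f i = 0")
        case False
        then have "i \<in> I" using le_degree by (auto simp: I_def)
        then show ?thesis using i0(2)[of i] False c0 fF
          by (simp add: g_def val_ge_def val_mult val_inverse inverse_mem)
      qed (simp add: g_def)
    qed
    have g1: "coeff g i0 = 1" using c0 by (simp add: g_def)
    obtain \<kappa> where \<kappa>: "\<And>i. \<kappa> i \<in> k" "\<And>i. vge 1 (coeff g i - \<kappa> i)"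
    proof -
      have "\<forall>i. \<exists>c'. c' \<in> k \<and> vge 1 (coeff g i - c')" using residue_kt gi(1,3) by blast
      then show thesis using that by metis
    qed
    have \<kappa>F: "\<kappa> i \<in> F" for i using \<kappa>(1) gff'(4) by blast
    define h where "h = (\<Sum>i\<le>d. monom (\<kappa> i) i)"
    have ch: "coeff h i = (if i \<le> d then \<kappa> i else 0)" for i
      by (simp add: h_def coeff_sum)
    have dg: "degree g \<le> d" using f(2) by (simp add: g_def c0)
    have "h \<noteq> 0"
    proof
      assume "h = 0"
      moreover have "i0 \<le> d" using i0(1) f(2) by (auto simp: I_def)
      ultimately have "\<kappa> i0 = 0" using ch[of i0] by simp
      then show False using \<kappa>(2)[of i0] g1 by (simp add: val_ge_def)
    qed
    moreover have "degree h \<le> d" by (rule degree_le) (simp add: ch)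
    moreover have "coeffs_in k h" using \<kappa>(1) by (simp add: coeffs_in_def ch)
    moreover have "vge 1 (poly h z)"
    proof -
      have "poly g z = 0" using f(4) by (simp add: g_def)
      then have "poly h z = - (\<Sum>i\<le>d. (coeff g i - \<kappa> i) * z ^ i)"
        using dg by (simp add: h_def poly_sum poly_monom poly_altdef_le[OF dg] sum_subtractf left_diff_distrib)
      also have "vge 1 \<dots>"
      proof (intro vge_minus vge_sum)
        fix i
        have "vge 1 (z ^ i * (coeff g i - \<kappa> i))"
          using z gi \<kappa> \<kappa>F by (intro vge_mult0 vge_power0) auto
        then show "vge 1 ((coeff g i - \<kappa> i) * z ^ i)" by (simp add: mult.commute)
      qed (use z gi \<kappa>F in \<open>auto intro!: sum_mem mult_mem diff_mem\<close>)
      finally show ?thesis .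
    qed
    ultimately show ?thesis by (auto simp: H_def)
  qed
  then have "\<forall>z\<in>F. vge 0 z \<longrightarrow> (\<exists>s\<in>\<Union>(S ` H). vge 1 (z - s))"
    using S by (meson UN_I)
  moreover have "finite (\<Union>(S ` H))" "\<Union>(S ` H) \<subseteq> {z\<in>F. vge 0 z}" using S \<open>finite H\<close> by auto
  ultimately have "\<exists>S. finite S \<and> S \<subseteq> {z\<in>F. vge 0 z} \<and> (\<forall>z\<in>F. vge 0 z \<longrightarrow> (\<exists>s\<in>S. vge 1 (z - s)))"
    by (intro exI[of _ "\<Union>(S ` H)"]) simp
  then show ?thesis by unfold_locales
qed

section \<open>Power maps on the finite residue field\<close>

context finite_residue_valuation
begin

text \<open>Turns self-maps of the residue field into self-maps of a finite set: \<open>r\<close>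
  picks a representative that depends only on the residue class.\<close>

lemma residue_representatives:
  "\<exists>S r. finite S \<and> S \<subseteq> {z\<in>K. vge 0 z} \<and>
    (\<forall>z\<in>K. vge 0 z \<longrightarrow> r z \<in> S \<and> vge 1 (z - r z)) \<and> (\<forall>s\<in>S. r s = s) \<and>
    (\<forall>z\<in>K. \<forall>z'\<in>K. vge 0 z \<longrightarrow> vge 0 z' \<longrightarrow> vge 1 (z - z') \<longrightarrow> r z = r z')"
proof -
  obtain S where S: "finite S" "S \<subseteq> {z\<in>K. vge 0 z}" "\<And>z. z \<in> K \<Longrightarrow> vge 0 z \<Longrightarrow> \<exists>s\<in>S. vge 1 (z - s)"
    using finite_residues by blast
  define r where "r z = (SOME s. s \<in> S \<and> vge 1 (z - s))" for z
  have r: "r z \<in> S \<and> vge 1 (z - r z)" if "z \<in> K" "vge 0 z" for z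
    unfolding r_def by (rule someI_ex) (use S(3)[OF that] in blast)
  have eq: "r z = r z'" if "z \<in> K" "z' \<in> K" "vge 0 z" "vge 0 z'" "vge 1 (z - z')" for z z'
  proof -
    \<comment> \<open>Congruent arguments give the same predicate, hence the same choice.\<close>
    have "(\<lambda>s. s \<in> S \<and> vge 1 (z - s)) = (\<lambda>s. s \<in> S \<and> vge 1 (z' - s))"
      using that S(2) vge_diff_trans[of z z' _ 1] vge_diff_trans[of z' z _ 1] vge_diff_commute[of z z' 1]
      by (intro ext conj_cong refl iffI) blast+
    then show ?thesis by (simp add: r_def)
  qed
  \<comment> \<open>Keeping only the representatives that are actually chosen makes \<open>r\<close>
    the identity on the set.\<close>
  define T where "T = r ` {z\<in>K. vge 0 z}"
  have TS: "T \<subseteq> S" using r by (auto simp: T_def)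
  have "r s = s" if sT: "s \<in> T" for s
  proof -
    obtain z where z: "z \<in> K" "vge 0 z" "s = r z" using sT unfolding T_def by blast
    then have "r z = r s" using r[OF z(1,2)] S(2) by (intro eq) auto
    then show ?thesis using z by simp
  qed
  then have "\<forall>s\<in>T. r s = s" by blast
  moreover have "\<forall>z\<in>K. vge 0 z \<longrightarrow> r z \<in> T \<and> vge 1 (z - r z)"
    using r by (simp add: T_def)
  moreover have "\<forall>z\<in>K. \<forall>z'\<in>K. vge 0 z \<longrightarrow> vge 0 z' \<longrightarrow> vge 1 (z - z') \<longrightarrow> r z = r z'"
    by (intro ballI impI) (rule eq)
  moreover have "finite T" "T \<subseteq> {z\<in>K. vge 0 z}" using finite_subset[OF TS S(1)] TS S(2) by blast+
  ultimately show ?thesis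
    by (intro exI[of _ T] exI[of _ r] conjI)
qed

text \<open>The identity \<open>s ^ p - s' ^ p = (s - s') ^ p\<close> makes the Frobenius map
  injective on residues, and an injective self-map of a finite set is onto.\<close>

lemma frobenius_residue_surj:
  assumes p: "prime p" "CHAR('a) = p" and u: "u \<in> K" "vge 0 u"
  shows "\<exists>w\<in>K. vge 0 w \<and> vge 1 (u - w ^ p)"
proof -
  obtain S r where S: "finite S" "S \<subseteq> {z\<in>K. vge 0 z}"
    "\<forall>z\<in>K. vge 0 z \<longrightarrow> r z \<in> S \<and> vge 1 (z - r z)" "\<forall>s\<in>S. r s = s"
    "\<forall>z\<in>K. \<forall>z'\<in>K. vge 0 z \<longrightarrow> vge 0 z' \<longrightarrow> vge 1 (z - z') \<longrightarrow> r z = r z'"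
    using residue_representatives by (elim exE conjE) (rule that)
  define g where "g s = r (s ^ p)" for s
  have gS: "g ` S \<subseteq> S" using S(2,3) by (auto simp: g_def intro!: vge_power0)
  have "inj_on g S"
  proof (rule inj_onI)
    fix s s' assume s: "s \<in> S" "s' \<in> S" "g s = g s'"
    then have sK: "s \<in> K" "vge 0 s" "s' \<in> K" "vge 0 s'" using S(2) by blast+
    then have "vge 1 (s ^ p - g s)" "vge 1 (s' ^ p - g s')" "g s \<in> K"
    proof -
      have int: "s ^ p \<in> K" "vge 0 (s ^ p)" "s' ^ p \<in> K" "vge 0 (s' ^ p)"
        using sK by (auto intro: vge_power0)
      then show "vge 1 (s ^ p - g s)" "vge 1 (s' ^ p - g s')" "g s \<in> K"
        unfolding g_def using S(2,3) by blast+
    qed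
    then have "vge 1 (s ^ p - s' ^ p)"
      using sK(1,3) s(3) by (metis power_mem vge_diff_commute vge_diff_trans)
    moreover have "((s - s') + s') ^ p = (s - s') ^ p + s' ^ p"
      by (rule freshmans_dream) (simp_all add: p)
    then have "s ^ p - s' ^ p = (s - s') ^ p" by simp
    ultimately have "vge 1 ((s - s') ^ p)" by simp
    then have "vge 1 (s - s')"
    proof (rule contrapos_pp)
      assume n: "\<not> vge 1 (s - s')"
      then have "s - s' \<noteq> 0" "v (s - s') \<le> 0" by (auto simp: val_ge_def)
      then show "\<not> vge 1 ((s - s') ^ p)"
        using sK mult_nonneg_nonpos[of "int p" "v (s - s')"] by (auto simp: val_ge_def val_power diff_mem)
    qed
    then have "r s = r s'" using S(5) sK by blast
    then show "s = s'" using S(4) s by simp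
  qed
  then have "g ` S = S" by (rule endo_inj_surj[OF S(1) gS])
  then obtain s where s: "s \<in> S" "r u = g s" using S(3) u by (metis imageE)
  then have sK: "s \<in> K" "vge 0 s" using S(2) by auto
  then have "vge 1 (s ^ p - r u)" "vge 1 (u - r u)" "r u \<in> K"
  proof -
    show "vge 1 (u - r u)" "r u \<in> K" using S(2,3) u by blast+
    have "s ^ p \<in> K" "vge 0 (s ^ p)" using sK by (auto intro: vge_power0)
    then show "vge 1 (s ^ p - r u)" using S(3) unfolding s(2) g_def by blast
  qed
  then have "vge 1 (u - s ^ p)"
    using u(1) sK(1) by (meson power_mem vge_diff_commute vge_diff_trans)
  then show ?thesis using sK by blast
qed

text \<open>The Artin-Schreier map kills \<open>0\<close> and \<open>1\<close>, so it is not injective on the finite residue field.\<close>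

lemma artin_schreier_residue_not_surj:
  assumes p: "prime p"
  shows "\<exists>a\<in>K. vge 0 a \<and> (\<forall>c\<in>K. vge 0 c \<longrightarrow> \<not> vge 1 (c ^ p - c - a))"
proof (rule ccontr)
  assume contr: "\<not> ?thesis"
  obtain S r where S: "finite S" "S \<subseteq> {z\<in>K. vge 0 z}"
    "\<forall>z\<in>K. vge 0 z \<longrightarrow> r z \<in> S \<and> vge 1 (z - r z)" "\<forall>s\<in>S. r s = s"
    "\<forall>z\<in>K. \<forall>z'\<in>K. vge 0 z \<longrightarrow> vge 0 z' \<longrightarrow> vge 1 (z - z') \<longrightarrow> r z = r z'"
    using residue_representatives by (elim exE conjE) (rule that)
  define g where "g s = r (s ^ p - s)" for s
  have int: "z ^ p - z \<in> K" "vge 0 (z ^ p - z)" if "z \<in> K" "vge 0 z" for z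
    using that by (auto intro: vge_diff vge_power0)
  have gS: "g ` S \<subseteq> S" using S(2,3) int by (auto simp: g_def)
  have gr: "g (r z) = r (z ^ p - z)" if z: "z \<in> K" "vge 0 z" for z
  proof -
    have rz: "r z \<in> K" "vge 0 (r z)" "vge 1 (z - r z)" using S(2,3) z by auto
    \<comment> \<open>\<open>z - r z\<close> divides the difference of powers, so the Artin-Schreier
      map respects residue classes and \<open>g\<close> represents it.\<close>
    have "z ^ p - r z ^ p = (z - r z) * (\<Sum>i<p. r z ^ (p - Suc i) * z ^ i)"
      by (rule power_diff_sumr2)
    also have "\<dots> = (\<Sum>i<p. r z ^ (p - Suc i) * z ^ i) * (z - r z)" by (rule mult.commute)
    also have "vge 1 \<dots>"
      using rz z by (intro vge_mult0 vge_sum vge_power0 sum_mem mult_mem power_mem diff_mem)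
    finally have "vge 1 (z ^ p - r z ^ p)" .
    then have "vge 1 ((z ^ p - r z ^ p) - (z - r z))"
      by (rule vge_diff[rotated 2]) (use rz z in \<open>auto intro: diff_mem\<close>)
    moreover have "(z ^ p - r z ^ p) - (z - r z) = (z ^ p - z) - (r z ^ p - r z)" by simp
    ultimately have "vge 1 ((z ^ p - z) - (r z ^ p - r z))" by simp
    then have "vge 1 ((r z ^ p - r z) - (z ^ p - z))"
      by (rule vge_diff_commute[rotated 2]) (rule int rz z)+
    then show ?thesis unfolding g_def using int[OF rz(1,2)] int[OF z] S(5) by blast
  qed
  have "S \<subseteq> g ` S"
  proof
    fix a assume a: "a \<in> S"
    then have aK: "a \<in> K" "vge 0 a" using S(2) by blast+
    with contr have "\<exists>c\<in>K. vge 0 c \<and> vge 1 (c ^ p - c - a)" by blast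
    then obtain c where c: "c \<in> K" "vge 0 c" "vge 1 (c ^ p - c - a)" by blast
    then have "r (c ^ p - c) = r a" using S(5) int[OF c(1,2)] aK by blast
    then have "g (r c) = a" using gr[OF c(1,2)] S(4) a by simp
    moreover have "r c \<in> S" using S(3) c by blast
    ultimately show "a \<in> g ` S" by blast
  qed
  then have "inj_on g S" using finite_surj_inj[OF S(1)] by blast
  moreover have "g (r 0) = g (r 1)" using gr[of 0] gr[of 1] prime_gt_0_nat[OF p] by (simp add: zero_power)
  moreover have r01: "r 0 \<in> S" "r 1 \<in> S" "vge 1 (0 - r 0)" "vge 1 (1 - r 1)"
    using bspec[OF S(3) zero_mem] bspec[OF S(3) one_mem] by simp_all
  ultimately have "r 0 = r 1" by (simp add: inj_on_eq_iff)
  moreover have "r 0 \<in> K" using r01 S(2) by blast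
  then have m: "1 - r 0 \<in> K" "0 - r 0 \<in> K" by auto
  ultimately have "vge 1 1" using r01(3,4) vge_diff[OF m, of 1] by simp
  then show False by (simp add: val_ge_def)
qed

end

section \<open>Power sums in characteristic \<open>p\<close>\<close>

lemma of_nat_power_CHAR_minus_one:
  assumes p: "prime p" "CHAR('a::field) = p" and j: "0 < j" "j < p"
  shows "(of_nat j :: 'a) ^ (p - 1) = 1"
proof -
  have "\<not> p dvd j" using j by (auto dest: dvd_imp_le)
  then have "[j ^ (p - 1) = 1] (mod p)" by (rule fermat_theorem[OF p(1)])
  then have "(of_nat (j ^ (p - 1)) :: 'a) = of_nat 1"
    by (subst of_nat_eq_iff_cong_CHAR) (simp add: p)
  then show ?thesis by simp
qed

text \<open>Summing \<open>(x + j + 1) ^ Suc n - (x + j) ^ Suc n\<close> over \<open>j < p\<close>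
  telescopes to \<open>0\<close>, because \<open>p = 0\<close> in the field. In the binomial
  expansion the power sums of exponent below \<open>n\<close> vanish by induction, and the factor
  \<open>Suc n < p\<close> in front of the last one is invertible.\<close>

lemma sum_power_translates_zero:
  fixes x :: "'a::field"
  assumes p: "prime p" "CHAR('a) = p" and n: "n < p - 1"
  shows "(\<Sum>j<p. (x + of_nat j) ^ n) = 0"
  using n
proof (induction n rule: less_induct)
  case (less n)
  let ?P = "\<lambda>l. \<Sum>j<p. (x + of_nat j) ^ l"
  have step: "(z + 1) ^ Suc n - z ^ Suc n = (\<Sum>l\<le>n. of_nat (Suc n choose l) * z ^ l)" for z :: 'a
    by (subst binomial_ring) (simp del: power_Suc)
  have "0 = (x + of_nat p) ^ Suc n - (x + of_nat 0) ^ Suc n"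
    using of_nat_CHAR[where 'a='a] p by simp
  also have "\<dots> = (\<Sum>j<p. (x + of_nat (Suc j)) ^ Suc n - (x + of_nat j) ^ Suc n)"
    by (rule sum_lessThan_telescope[symmetric])
  also have "\<dots> = (\<Sum>j<p. \<Sum>l\<le>n. of_nat (Suc n choose l) * (x + of_nat j) ^ l)"
  proof (rule sum.cong[OF refl])
    fix j
    have "x + of_nat (Suc j) = (x + of_nat j) + 1" by simp
    then show "(x + of_nat (Suc j)) ^ Suc n - (x + of_nat j) ^ Suc n =
        (\<Sum>l\<le>n. of_nat (Suc n choose l) * (x + of_nat j) ^ l)"
      by (simp only: step)
  qed
  also have "\<dots> = (\<Sum>l\<le>n. of_nat (Suc n choose l) * ?P l)"
    by (subst sum.swap) (simp add: sum_distrib_left)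
  also have "\<dots> = (\<Sum>l<n. of_nat (Suc n choose l) * ?P l) + of_nat (Suc n) * ?P n"
    by (simp add: lessThan_Suc_atMost[symmetric] del: of_nat_Suc)
  also have "(\<Sum>l<n. of_nat (Suc n choose l) * ?P l) = 0"
    using less by (intro sum.neutral) auto
  finally have "of_nat (Suc n) * ?P n = 0" by simp
  moreover have "(of_nat (Suc n) :: 'a) \<noteq> 0"
    unfolding of_nat_eq_0_iff_char_dvd p(2) using less.prems by (auto dest: dvd_imp_le)
  ultimately show ?case by simp
qed

text \<open>After expansion in \<open>x\<close>, the power sums of \<open>j\<close> with exponent
  below \<open>p - 1\<close> are \<open>0\<close>; what remains is the sum of
  \<open>j ^ (p - 1)\<close>, to which Fermat's theorem gives \<open>p - 1\<close> ones.\<close>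

lemma sum_power_translates_minus_one:
  fixes x :: "'a::field"
  assumes p: "prime p" "CHAR('a) = p"
  shows "(\<Sum>j<p. (x + of_nat j) ^ (p - 1)) = -1"
proof -
  have p2: "p \<ge> 2" using prime_ge_2_nat[OF p(1)] .
  let ?s = "\<lambda>m. \<Sum>j<p. (of_nat j :: 'a) ^ m"
  have s0: "?s m = 0" if "m < p - 1" for m
    using sum_power_translates_zero[OF p that, of 0] by simp
  have "?s (p - 1) = (\<Sum>j\<in>{..<p} - {0}. 1)"
    using p2 of_nat_power_CHAR_minus_one[OF p]
    by (subst sum.remove[of _ 0]) (auto simp: zero_power)
  also have "\<dots> = of_nat (p - 1)" using p2 by (simp add: card_Diff_singleton)
  also have "\<dots> = -1"
    using of_nat_CHAR[where 'a='a] p p2 by (simp add: of_nat_diff)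
  finally have s1: "?s (p - 1) = -1" .
  have "(\<Sum>j<p. (x + of_nat j) ^ (p - 1)) =
      (\<Sum>j<p. \<Sum>l\<le>p - 1. of_nat (p - 1 choose l) * x ^ l * of_nat j ^ (p - 1 - l))"
    by (subst binomial_ring) simp
  also have "\<dots> = (\<Sum>l\<le>p - 1. of_nat (p - 1 choose l) * x ^ l * ?s (p - 1 - l))"
    by (subst sum.swap) (simp add: sum_distrib_left)
  also have "\<dots> = (\<Sum>l\<in>{0}. of_nat (p - 1 choose l) * x ^ l * ?s (p - 1 - l))"
  proof (rule sum.mono_neutral_right)
    show "\<forall>i\<in>{..p - 1} - {0}. of_nat (p - 1 choose i) * x ^ i * ?s (p - 1 - i) = 0"
    proof
      fix i assume "i \<in> {..p - 1} - {0}"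
      then have "p - 1 - i < p - 1" using p2 by auto
      then show "of_nat (p - 1 choose i) * x ^ i * ?s (p - 1 - i) = 0" using s0 by simp
    qed
  qed auto
  finally show ?thesis using s1 by simp
qed

text \<open>Both sides are monic of degree \<open>p\<close> in \<open>x\<close> and vanish at all
  \<open>-j\<close>, the right-hand side by Fermat's theorem. Their difference has degree below
  \<open>p\<close> but \<open>p\<close> roots.\<close>

lemma prod_translates:
  fixes x :: "'a::field"
  assumes p: "prime p" "CHAR('a) = p"
  shows "(\<Prod>j<p. (x + of_nat j)) = x ^ p - x"
proof -
  have p2: "p \<ge> 2" using prime_ge_2_nat[OF p(1)] .
  define A :: "'a poly" where "A = (\<Prod>j<p. [:of_nat j, 1:])"
  define q where "q = A - (monom 1 p - monom 1 1)"
  have "degree A = p" "lead_coeff A = 1"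
    unfolding A_def by (subst degree_prod_eq_sum_degree) (auto simp: lead_coeff_prod)
  then have cA: "coeff A p = 1" "degree A \<le> p" by auto
  have "degree q \<le> p" unfolding q_def
    using cA p2 by (intro degree_diff_le) (auto simp: degree_monom_eq)
  moreover have "coeff q p = 0" using cA p2 by (simp add: q_def)
  ultimately have deg: "q \<noteq> 0 \<Longrightarrow> degree q < p"
    using leading_coeff_0_iff[of q] by (cases "degree q = p") auto
  have roots: "(\<lambda>j. - of_nat j) ` {..<p} \<subseteq> {x. poly q x = 0}"
  proof
    fix z :: 'a assume "z \<in> (\<lambda>j. - of_nat j) ` {..<p}"
    then obtain j where j: "j < p" "z = - of_nat j" by auto
    have "poly A z = 0" using j unfolding A_def poly_prod by (intro prod_zero) auto
    moreover have "z ^ p = z"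
    proof (cases "j = 0")
      case False
      have "(of_nat j :: 'a) ^ p = of_nat j ^ (p - 1) * of_nat j"
        using p2 by (metis Suc_diff_1 power_Suc2 pos2 order_less_le_trans)
      also have "\<dots> = of_nat j" using of_nat_power_CHAR_minus_one[OF p] j False by simp
      finally show ?thesis using minus_power_prime_CHAR[of p "of_nat j :: 'a"] p j by simp
    qed (use j p2 in auto)
    ultimately show "z \<in> {x. poly q x = 0}" by (simp add: q_def poly_monom)
  qed
  have inj: "inj_on (\<lambda>j. - of_nat j :: 'a) {..<p}"
    by (auto simp: inj_on_def of_nat_eq_iff_cong_CHAR p cong_def)
  have "q = 0"
  proof (rule ccontr)
    assume q: "q \<noteq> 0"
    have "p = card ((\<lambda>j. - of_nat j :: 'a) ` {..<p})" using inj by (simp add: card_image)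
    also have "\<dots> \<le> card {x. poly q x = 0}"
      using roots q by (intro card_mono poly_roots_finite)
    also have "\<dots> \<le> degree q" by (rule card_poly_roots_bound[OF q])
    finally show False using deg[OF q] by simp
  qed
  then have "poly A x = x ^ p - x" using arg_cong[of q 0 "\<lambda>q. poly q x"] by (simp add: q_def poly_monom)
  then show ?thesis by (simp add: A_def poly_prod add.commute)
qed

section \<open>Newton's identities\<close>

text \<open>Logarithmic derivative of the product as a formal power series, compared at degree
  \<open>n\<close>. Solving for the coefficient of degree \<open>Suc n\<close> is left to the
  application, where \<open>Suc n < p\<close> is invertible.\<close>

lemma newton_identity:
  fixes b :: "'i \<Rightarrow> 'a::field"
  assumes "finite I"
  shows "of_nat (Suc n) * coeff (\<Prod>i\<in>I. [:1, b i:]) (Suc n) =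
    (\<Sum>k\<le>n. coeff (\<Prod>i\<in>I. [:1, b i:]) k * ((-1) ^ (n - k) * (\<Sum>i\<in>I. b i ^ Suc (n - k))))"
proof -
  \<comment> \<open>The expansion of \<open>c / (1 + c X)\<close>, the logarithmic derivative of the
    factor \<open>[:1, c:]\<close>.\<close>
  define G where "G c = Abs_fps (\<lambda>n. c * (- c) ^ n)" for c :: 'a
  have lin: "fps_of_poly [:1, c:] * G c = fps_const c" for c :: 'a
  proof (rule fps_ext)
    fix n
    have "fps_of_poly [:1, c:] = 1 + fps_const c * fps_X"
      by (rule fps_ext) (auto simp: coeff_pCons fps_X_def split: nat.split)
    then have "fps_of_poly [:1, c:] * G c = G c + fps_const c * (fps_X * G c)"
      by (simp only: distrib_right mult.assoc mult_1)
    then show "fps_nth (fps_of_poly [:1, c:] * G c) n = fps_nth (fps_const c) n"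
      by (cases n) (simp_all add: G_def)
  qed
  define A where "A J = fps_of_poly (\<Prod>i\<in>J. [:1, b i:])" for J
  have deriv: "fps_deriv (A I) = A I * (\<Sum>i\<in>I. G (b i))"
    using assms
  proof (induction I rule: finite_induct)
    case empty
    then show ?case by (simp add: A_def)
  next
    case (insert i J)
    have A: "A (insert i J) = fps_of_poly [:1, b i:] * A J"
      using insert by (simp add: A_def fps_of_poly_mult)
    have "fps_deriv (fps_of_poly [:1, b i:]) = fps_const (b i)"
      by (simp add: fps_of_poly_pderiv[symmetric] pderiv_pCons fps_of_poly_const)
    then have "fps_deriv (A (insert i J)) =
        fps_of_poly [:1, b i:] * (A J * (\<Sum>i\<in>J. G (b i))) + fps_const (b i) * A J"
      using insert.IH by (simp add: A)
    also have "\<dots> = A (insert i J) * (\<Sum>i\<in>insert i J. G (b i))"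
      using insert(1,2) lin[of "b i"] by (simp add: A algebra_simps)
    finally show ?case .
  qed
  have "of_nat (Suc n) * coeff (\<Prod>i\<in>I. [:1, b i:]) (Suc n) = fps_nth (fps_deriv (A I)) n"
    by (simp add: A_def)
  also have "\<dots> = (\<Sum>k\<le>n. fps_nth (A I) k * (\<Sum>i\<in>I. fps_nth (G (b i)) (n - k)))"
    by (simp add: deriv fps_mult_nth fps_sum_nth atLeast0AtMost)
  also have "\<dots> = (\<Sum>k\<le>n. coeff (\<Prod>i\<in>I. [:1, b i:]) k * ((-1) ^ (n - k) * (\<Sum>i\<in>I. b i ^ Suc (n - k))))"
  proof (rule sum.cong[OF refl])
    fix k
    have "fps_nth (G c) m = (-1) ^ m * c ^ Suc m" for c m
      by (simp add: G_def power_minus[of c] mult_ac)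
    then show "fps_nth (A I) k * (\<Sum>i\<in>I. fps_nth (G (b i)) (n - k)) =
      coeff (\<Prod>i\<in>I. [:1, b i:]) k * ((-1) ^ (n - k) * (\<Sum>i\<in>I. b i ^ Suc (n - k)))"
      by (simp add: A_def sum_distrib_left)
  qed
  finally show ?thesis .
qed

section \<open>Artin-Schreier extensions\<close>

text \<open>Only a generator \<open>\<sigma>\<close> of the Galois group is kept: what it fixes is
  fixed by the whole group. As \<open>\<sigma>\<close> is a total function, its laws are relative to
  \<open>E\<close>.\<close>

locale cyclic_extension = E: subfield_set E for E :: "'a::field set" +
  fixes F :: "'a set" and \<sigma> :: "'a \<Rightarrow> 'a" and p :: nat
  assumes F: "subfield_set F" and prime_p: "prime p" and CHAR_p: "CHAR('a) = p" and F_subset: "F \<subseteq> E"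
    and \<sigma>_mem: "z \<in> E \<Longrightarrow> \<sigma> z \<in> E"
    and \<sigma>_add: "z \<in> E \<Longrightarrow> w \<in> E \<Longrightarrow> \<sigma> (z + w) = \<sigma> z + \<sigma> w"
    and \<sigma>_mult: "z \<in> E \<Longrightarrow> w \<in> E \<Longrightarrow> \<sigma> (z * w) = \<sigma> z * \<sigma> w"
    and \<sigma>_fixed_iff: "z \<in> E \<Longrightarrow> \<sigma> z = z \<longleftrightarrow> z \<in> F"
    and \<sigma>_order: "z \<in> E \<Longrightarrow> (\<sigma> ^^ p) z = z"
begin

sublocale F: subfield_set F by (rule F)

lemma F_E: "c \<in> F \<Longrightarrow> c \<in> E"
  using F_subset by blast

lemma p_ge_2: "p \<ge> 2" and p_gt_0: "p > 0"
  using prime_ge_2_nat[OF prime_p] by auto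

lemma \<sigma>_F: "c \<in> F \<Longrightarrow> \<sigma> c = c"
  using \<sigma>_fixed_iff F_E by blast

lemma \<sigma>_diff: "z \<in> E \<Longrightarrow> w \<in> E \<Longrightarrow> \<sigma> (z - w) = \<sigma> z - \<sigma> w"
  using \<sigma>_add[of "z - w" w] by (simp add: E.diff_mem)

lemma pow_mem: "z \<in> E \<Longrightarrow> (\<sigma> ^^ j) z \<in> E"
  by (induction j) (auto intro: \<sigma>_mem)

lemma pow_add: "z \<in> E \<Longrightarrow> w \<in> E \<Longrightarrow> (\<sigma> ^^ j) (z + w) = (\<sigma> ^^ j) z + (\<sigma> ^^ j) w"
  by (induction j) (auto simp: \<sigma>_add pow_mem)

lemma pow_mult: "z \<in> E \<Longrightarrow> w \<in> E \<Longrightarrow> (\<sigma> ^^ j) (z * w) = (\<sigma> ^^ j) z * (\<sigma> ^^ j) w"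
  by (induction j) (auto simp: \<sigma>_mult pow_mem)

lemma pow_F: "c \<in> F \<Longrightarrow> (\<sigma> ^^ j) c = c"
  by (induction j) (auto simp: \<sigma>_F)

lemma pow_sum: "(\<And>i. i \<in> I \<Longrightarrow> g i \<in> E) \<Longrightarrow> (\<sigma> ^^ j) (sum g I) = (\<Sum>i\<in>I. (\<sigma> ^^ j) (g i))"
proof (induction I rule: infinite_finite_induct)
  case (insert x I)
  then show ?case by (simp add: pow_add E.sum_mem)
qed (use pow_F[of 0] in auto)

lemma pow_power: "z \<in> E \<Longrightarrow> (\<sigma> ^^ j) (z ^ n) = (\<sigma> ^^ j) z ^ n"
  by (induction n) (use pow_F[of 1] in \<open>auto simp: pow_mult E.power_mem\<close>)

lemma \<sigma>_power: "z \<in> E \<Longrightarrow> \<sigma> (z ^ n) = \<sigma> z ^ n"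
  using pow_power[of z 1 n] by simp

lemma \<sigma>_prod: "(\<And>i. i \<in> I \<Longrightarrow> g i \<in> E) \<Longrightarrow> \<sigma> (prod g I) = (\<Prod>i\<in>I. \<sigma> (g i))"
proof (induction I rule: infinite_finite_induct)
  case (insert x I)
  then show ?case by (simp add: \<sigma>_mult E.prod_mem)
qed (use \<sigma>_F[of 1] in auto)

lemma pow_eq_0: "z \<in> E \<Longrightarrow> (\<sigma> ^^ j) z = 0 \<Longrightarrow> z = 0"
proof (rule ccontr)
  assume z: "z \<in> E" "(\<sigma> ^^ j) z = 0" "z \<noteq> 0"
  have "(\<sigma> ^^ j) (z * inverse z) = (\<sigma> ^^ j) z * (\<sigma> ^^ j) (inverse z)"
    using z(1) by (intro pow_mult E.inverse_mem)
  then show False using z pow_F[OF F.one_mem] by simp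
qed

text \<open>The difference operator plays the part of a derivative: it is nilpotent and lowers the
  degree in \<open>y\<close>.\<close>

definition \<Delta> :: "'a \<Rightarrow> 'a" where "\<Delta> z = \<sigma> z - z"

lemma \<Delta>_mem: "z \<in> E \<Longrightarrow> (\<Delta> ^^ n) z \<in> E"
  by (induction n) (auto simp: \<Delta>_def intro: \<sigma>_mem)

lemma \<Delta>_add: "z \<in> E \<Longrightarrow> w \<in> E \<Longrightarrow> \<Delta> (z + w) = \<Delta> z + \<Delta> w"
  by (simp add: \<Delta>_def \<sigma>_add)

lemma \<Delta>_F_mult: "c \<in> F \<Longrightarrow> z \<in> E \<Longrightarrow> \<Delta> (c * z) = c * \<Delta> z"
  by (simp add: \<Delta>_def \<sigma>_mult \<sigma>_F F_E algebra_simps)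

lemma \<sigma>_pow_eq_binomial: "z \<in> E \<Longrightarrow> (\<sigma> ^^ n) z = (\<Sum>i\<le>n. of_nat (n choose i) * (\<Delta> ^^ i) z)"
proof (induction n)
  case (Suc n)
  let ?g = "\<lambda>i. (\<Delta> ^^ i) z"
  have E: "of_nat (n choose i) * ?g i \<in> E" for i
    using Suc.prems by (intro E.mult_mem \<Delta>_mem) auto
  have shift: "(\<Sum>i\<le>n. of_nat (n choose i) * ?g i) = ?g 0 + (\<Sum>i\<le>n. of_nat (n choose Suc i) * ?g (Suc i))"
  proof -
    have "(\<Sum>i\<le>n. of_nat (n choose i) * ?g i) = (\<Sum>i\<le>Suc n. of_nat (n choose i) * ?g i)"
      by (simp add: binomial_eq_0)
    then show ?thesis by (subst (asm) sum.atMost_Suc_shift) simp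
  qed
  have "(\<sigma> ^^ Suc n) z = \<sigma> (\<Sum>i\<le>n. of_nat (n choose i) * ?g i)"
    using Suc.IH[OF Suc.prems] by simp
  also have "\<dots> = (\<Sum>i\<le>n. \<sigma> (of_nat (n choose i) * ?g i))"
    using pow_sum[of "{..n}" "\<lambda>i. of_nat (n choose i) * ?g i" 1] E by simp
  also have "\<dots> = (\<Sum>i\<le>n. of_nat (n choose i) * (?g i + ?g (Suc i)))"
    using Suc.prems by (intro sum.cong refl) (simp add: \<sigma>_mult \<Delta>_mem \<sigma>_F, simp add: \<Delta>_def)
  also have "\<dots> = (\<Sum>i\<le>n. of_nat (n choose i) * ?g i) + (\<Sum>i\<le>n. of_nat (n choose i) * ?g (Suc i))"
    by (simp add: distrib_left sum.distrib)
  also have "\<dots> =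
      ?g 0 + (\<Sum>i\<le>n. of_nat (Suc n choose Suc i) * ?g (Suc i))"
    unfolding shift by (simp add: sum.distrib[symmetric] algebra_simps)
  also have "\<dots> = (\<Sum>i\<le>Suc n. of_nat (Suc n choose i) * ?g i)"
    by (subst sum.atMost_Suc_shift) simp
  finally show ?case .
qed simp

text \<open>In characteristic \<open>p\<close>, \<open>(\<sigma> - 1)\<^sup>p = \<sigma>\<^sup>p - 1\<close>.\<close>

lemma \<Delta>_nilpotent: "z \<in> E \<Longrightarrow> (\<Delta> ^^ p) z = 0"
proof -
  assume z: "z \<in> E"
  have "z = (\<Sum>i\<le>p. of_nat (p choose i) * (\<Delta> ^^ i) z)"
    using \<sigma>_pow_eq_binomial[OF z, of p] \<sigma>_order[OF z] by simp
  also have "\<dots> = (\<Sum>i\<in>{0, p}. of_nat (p choose i) * (\<Delta> ^^ i) z)"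
  proof (rule sum.mono_neutral_right)
    show "\<forall>i\<in>{..p} - {0, p}. of_nat (p choose i) * (\<Delta> ^^ i) z = 0"
    proof
      fix i assume "i \<in> {..p} - {0, p}"
      then have "p dvd (p choose i)" by (intro dvd_choose_prime prime_p) auto
      then have "(of_nat (p choose i) :: 'a) = 0" by (simp add: of_nat_eq_0_iff_char_dvd CHAR_p)
      then show "of_nat (p choose i) * (\<Delta> ^^ i) z = 0" by simp
    qed
  qed auto
  also have "\<dots> = z + (\<Delta> ^^ p) z" using p_gt_0 by simp
  finally show ?thesis by simp
qed

text \<open>Let \<open>z\<close> and \<open>\<Delta> z\<close> be the last two nonzero iterates of
  the nilpotent \<open>\<Delta>\<close> on some \<open>w\<close> outside \<open>F\<close>. As
  \<open>\<Delta>\<close> kills \<open>\<Delta> z\<close>, this is a scalar from \<open>F\<close>,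
  and dividing \<open>z\<close> by it gives a solution.\<close>

lemma exists_artin_schreier_generator:
  assumes "E \<noteq> F"
  shows "\<exists>y\<in>E. \<sigma> y = y + 1"
proof -
  obtain w where w: "w \<in> E" "w \<notin> F" using assms F_subset by blast
  define k where "k = (LEAST k. (\<Delta> ^^ k) w = 0)"
  have k: "(\<Delta> ^^ k) w = 0" unfolding k_def by (rule LeastI) (rule \<Delta>_nilpotent[OF w(1)])
  have kmin: "(\<Delta> ^^ j) w \<noteq> 0" if "j < k" for j
    using not_less_Least[of j] that unfolding k_def by blast
  have "k \<noteq> 0" using k w(2) by (cases k) auto
  moreover have "k \<noteq> 1" using k w \<sigma>_fixed_iff[OF w(1)] by (auto simp: \<Delta>_def)
  ultimately have "k = Suc (Suc (k - 2))" by simp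
  then obtain j where j: "k = Suc (Suc j)" ..
  define z where "z = (\<Delta> ^^ j) w"
  have z: "z \<in> E" "\<Delta> z \<noteq> 0" "\<Delta> (\<Delta> z) = 0"
    using \<Delta>_mem[OF w(1)] kmin[of "Suc j"] k by (auto simp: z_def j)
  have c: "\<Delta> z \<in> F" using z \<sigma>_fixed_iff[of "\<Delta> z"] \<Delta>_mem[of z 1] by (simp add: \<Delta>_def[of "\<Delta> z"])
  have inv: "inverse (\<Delta> z) \<in> F" using c by (rule F.inverse_mem)
  have "\<Delta> (inverse (\<Delta> z) * z) = 1" using \<Delta>_F_mult[OF inv z(1)] z(2) by simp
  then have "\<sigma> (inverse (\<Delta> z) * z) = inverse (\<Delta> z) * z + 1" by (simp add: \<Delta>_def diff_eq_eq add.commute)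
  then show ?thesis using inv z(1) F_E by (intro bexI[of _ "inverse (\<Delta> z) * z"]) auto
qed

definition Tr :: "'a \<Rightarrow> 'a" where "Tr z = (\<Sum>j<p. (\<sigma> ^^ j) z)"

definition N :: "'a \<Rightarrow> 'a" where "N z = (\<Prod>j<p. (\<sigma> ^^ j) z)"

text \<open>\<open>\<sigma>\<close> shifts the factors cyclically. The comparison of the two
  products cancels a factor \<open>z\<close>, so \<open>z = 0\<close> is treated apart.\<close>

lemma N_mem: "z \<in> E \<Longrightarrow> N z \<in> F"
proof (cases "z = 0")
  case True
  then show ?thesis using pow_F[of 0] p_gt_0 by (simp add: N_def zero_power)
next
  case False
  assume z: "z \<in> E"
  have "\<sigma> (N z) = (\<Prod>j<p. (\<sigma> ^^ Suc j) z)"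
    unfolding N_def using z by (subst \<sigma>_prod) (auto intro: pow_mem)
  moreover have "z * (\<Prod>j<p. (\<sigma> ^^ Suc j) z) = (\<Prod>j<Suc p. (\<sigma> ^^ j) z)"
    by (subst prod.lessThan_Suc_shift) simp
  moreover have "\<dots> = z * N z" using \<sigma>_order[OF z] by (simp add: N_def mult.commute)
  ultimately have "\<sigma> (N z) = N z" using False by simp
  moreover have "N z \<in> E" unfolding N_def using z by (intro E.prod_mem pow_mem)
  ultimately show ?thesis using \<sigma>_fixed_iff by blast
qed

lemma N_mult: "z \<in> E \<Longrightarrow> w \<in> E \<Longrightarrow> N (z * w) = N z * N w"
  by (simp add: N_def pow_mult prod.distrib)

lemma N_F: "c \<in> F \<Longrightarrow> N c = c ^ p"
  by (simp add: N_def pow_F)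

lemma N_eq_0_iff: "z \<in> E \<Longrightarrow> N z = 0 \<longleftrightarrow> z = 0"
  using pow_eq_0 pow_F[of 0] p_gt_0 by (auto simp: N_def)

lemma N_one [simp]: "N 1 = 1"
  by (simp add: N_F)

lemma N_zero [simp]: "N 0 = 0"
  using N_eq_0_iff[of 0] by simp

lemma N_inverse: "z \<in> E \<Longrightarrow> N (inverse z) = inverse (N z)"
  using N_mult[of z "inverse z"] N_eq_0_iff[of z]
  by (cases "z = 0") (auto simp: E.inverse_mem inverse_unique)

lemma N_power: "z \<in> E \<Longrightarrow> N (z ^ n) = N z ^ n"
  by (induction n) (auto simp: N_mult E.power_mem)

end

locale artin_schreier = cyclic_extension +
  fixes y :: 'a
  assumes y_mem [simp]: "y \<in> E" and \<sigma>_y: "\<sigma> y = y + 1"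
begin

definition f :: 'a where "f = y ^ p - y"

lemma pow_y: "(\<sigma> ^^ j) y = y + of_nat j"
proof (induction j)
  case (Suc j)
  then show ?case using \<sigma>_add[of y "of_nat j"] \<sigma>_F[of "of_nat j"] by (simp add: \<sigma>_y)
qed simp

lemma f_mem [simp]: "f \<in> F"
proof -
  have "\<sigma> f = (y + 1) ^ p - (y + 1)"
    by (simp add: f_def \<sigma>_diff \<sigma>_power \<sigma>_y E.power_mem)
  also have "(y + 1) ^ p = y ^ p + 1 ^ p"
    by (rule freshmans_dream) (simp_all add: prime_p CHAR_p)
  also have "y ^ p + 1 ^ p - (y + 1) = f" by (simp add: f_def)
  finally have "\<sigma> f = f" .
  moreover have "f \<in> E" unfolding f_def by (intro E.diff_mem E.power_mem y_mem)
  ultimately show ?thesis using \<sigma>_fixed_iff by blast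
qed

lemma N_y: "N y = f"
  by (simp add: N_def pow_y f_def prod_translates[OF prime_p CHAR_p])

text \<open>The conjugates of \<open>y\<close> are its translates by the prime field, so these
  traces are the power sums over translates.\<close>

lemma Tr_y_power: "i < p \<Longrightarrow> Tr (y ^ i) = (if i = p - 1 then -1 else 0)"
  using sum_power_translates_zero[OF prime_p CHAR_p, of i y]
    sum_power_translates_minus_one[OF prime_p CHAR_p, of y]
  by (auto simp: Tr_def pow_power pow_y)

lemma Tr_F_mult: "c \<in> F \<Longrightarrow> z \<in> E \<Longrightarrow> Tr (c * z) = c * Tr z"
  by (simp add: Tr_def pow_mult F_E pow_F sum_distrib_left)

lemma Tr_sum: "(\<And>i. i \<in> I \<Longrightarrow> g i \<in> E) \<Longrightarrow> Tr (sum g I) = (\<Sum>i\<in>I. Tr (g i))"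
  unfolding Tr_def by (subst sum.swap) (simp add: pow_sum)

definition span :: "nat \<Rightarrow> 'a set"
  where "span n = {z. \<exists>a. (\<forall>i. a i \<in> F) \<and> z = (\<Sum>i<n. a i * y ^ i)}"

lemma monom_mem: "c \<in> F \<Longrightarrow> c * y ^ i \<in> E"
  by (intro E.mult_mem E.power_mem y_mem) (rule F_E)

lemma span_subset_E: "z \<in> span n \<Longrightarrow> z \<in> E"
  by (auto simp: span_def intro!: E.sum_mem monom_mem)

lemma span_add: "z \<in> span n \<Longrightarrow> w \<in> span n \<Longrightarrow> z + w \<in> span n"
proof -
  assume "z \<in> span n" "w \<in> span n"
  then obtain a b where "\<forall>i. a i \<in> F" "z = (\<Sum>i<n. a i * y ^ i)" "\<forall>i. b i \<in> F" "w = (\<Sum>i<n. b i * y ^ i)"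
    unfolding span_def by blast
  then show ?thesis unfolding span_def
    by (intro CollectI exI[of _ "\<lambda>i. a i + b i"]) (auto simp: algebra_simps sum.distrib)
qed

lemma span_mono: "z \<in> span n \<Longrightarrow> n \<le> m \<Longrightarrow> z \<in> span m"
proof -
  assume "z \<in> span n" and nm: "n \<le> m"
  then obtain a where a: "\<forall>i. a i \<in> F" "z = (\<Sum>i<n. a i * y ^ i)" unfolding span_def by blast
  have "z = (\<Sum>i<m. (if i < n then a i else 0) * y ^ i)"
    unfolding a(2) using nm by (intro sum.mono_neutral_cong_left) auto
  then show ?thesis unfolding span_def
    by (intro CollectI exI[of _ "\<lambda>i. if i < n then a i else 0"]) (use a in auto)
qed

lemma span_monom: "c \<in> F \<Longrightarrow> i < n \<Longrightarrow> c * y ^ i \<in> span n"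
  unfolding span_def
  by (intro CollectI exI[of _ "\<lambda>j. if j = i then c else 0"])
     (auto simp: if_distrib[of "\<lambda>x. x * _"] sum.delta cong: if_cong)

lemma span_sum: "(\<And>i. i \<in> I \<Longrightarrow> g i \<in> span n) \<Longrightarrow> sum g I \<in> span n"
proof (induction I rule: infinite_finite_induct)
  case (insert x I)
  then show ?case by (simp add: span_add)
qed (auto simp: span_def intro!: exI[of _ "\<lambda>i. 0"])

text \<open>\<open>\<Delta>\<close> maps \<open>y ^ Suc n\<close> to \<open>Suc n * y ^ n\<close>
  plus lower terms, and \<open>Suc n\<close> is invertible as long as it is below \<open>p\<close>.
  So the top term can be integrated, and the rest is left to the induction.\<close>

lemma \<Delta>_surj_span:
  assumes "u \<in> span n" "n < p"
  shows "\<exists>w\<in>span (Suc n). \<Delta> w = u"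
  using assms
proof (induction n arbitrary: u)
  case 0
  then have "u = 0" by (auto simp: span_def)
  moreover have "0 \<in> span 1" using span_monom[of 0 0 1] by simp
  moreover have "\<Delta> 0 = 0" using \<sigma>_F[of 0] by (simp add: \<Delta>_def)
  ultimately show ?case by (intro bexI[of _ 0]) auto
next
  case (Suc n)
  obtain a where a: "\<forall>i. a i \<in> F" "u = (\<Sum>i<Suc n. a i * y ^ i)" using Suc.prems unfolding span_def by blast
  define b where "b = a n / of_nat (Suc n)"
  have nz: "(of_nat (Suc n) :: 'a) \<noteq> 0"
    unfolding of_nat_eq_0_iff_char_dvd CHAR_p using Suc.prems by (auto dest: dvd_imp_le)
  have b: "b \<in> F" "b * of_nat (Suc n) = a n" using a nz by (auto simp: b_def simp del: of_nat_Suc)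
  define r where "r = (\<Sum>l<n. (b * of_nat (Suc n choose l)) * y ^ l)"
  have r: "r \<in> span n" unfolding r_def using b by (intro span_sum span_monom) auto
  have "\<Delta> (y ^ Suc n) = (y + 1) ^ Suc n - y ^ Suc n"
    by (simp add: \<Delta>_def \<sigma>_power \<sigma>_y del: power_Suc)
  also have "\<dots> = (\<Sum>l<Suc n. of_nat (Suc n choose l) * y ^ l)"
    by (subst binomial_ring) (simp add: lessThan_Suc_atMost[symmetric] del: power_Suc)
  also have "b * \<dots> = r + a n * y ^ n"
    using b(2) by (simp add: r_def sum_distrib_left distrib_left mult.assoc[symmetric] del: of_nat_Suc)
  finally have \<Delta>b: "\<Delta> (b * y ^ Suc n) = r + a n * y ^ n"
    using b by (simp add: \<Delta>_F_mult E.power_mem del: power_Suc)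
  define u' where "u' = (\<Sum>i<n. a i * y ^ i) + (-1) * r"
  have "(-1) * r \<in> span n"
  proof -
    have "(-1) * r = (\<Sum>l<n. (- (b * of_nat (Suc n choose l))) * y ^ l)"
      by (simp add: r_def sum_negf)
    then show ?thesis using b by (simp only:, intro span_sum span_monom F.uminus_mem) auto
  qed
  moreover have "(\<Sum>i<n. a i * y ^ i) \<in> span n" using a by (auto simp: span_def)
  ultimately have "u' \<in> span n" unfolding u'_def by (rule span_add[rotated])
  then obtain w where w: "w \<in> span (Suc n)" "\<Delta> w = u'" using Suc by auto
  have "\<Delta> (w + b * y ^ Suc n) = u"
    using w \<Delta>b b by (subst \<Delta>_add) (auto simp: u'_def a(2) intro: span_subset_E monom_mem simp del: power_Suc)
  moreover have "w + b * y ^ Suc n \<in> span (Suc (Suc n))"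
    using b by (intro span_add span_monom span_mono[OF w(1)]) auto
  ultimately show ?case by blast
qed

text \<open>Lift \<open>\<Delta> z\<close> to some \<open>w\<close> of one degree more; then
  \<open>z - w\<close> is fixed by \<open>\<sigma>\<close>, hence a constant. For
  \<open>n = p\<close> this shows that the powers of \<open>y\<close> span \<open>E\<close>.\<close>

lemma in_span_of_\<Delta>_nilpotent: "n \<le> p \<Longrightarrow> z \<in> E \<Longrightarrow> (\<Delta> ^^ n) z = 0 \<Longrightarrow> z \<in> span n"
proof (induction n arbitrary: z)
  case 0
  then show ?case by (simp add: span_def) (use F.zero_mem in blast)
next
  case (Suc n)
  have "\<Delta> z \<in> span n"
    using Suc.IH[of "\<Delta> z"] Suc.prems \<Delta>_mem[of z 1] by (simp add: funpow_swap1)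
  then obtain w where w: "w \<in> span (Suc n)" "\<Delta> w = \<Delta> z"
    using \<Delta>_surj_span[of "\<Delta> z" n] Suc.prems by auto
  have wE: "w \<in> E" using w span_subset_E by blast
  have "\<sigma> (z - w) = z - w" using w(2) Suc.prems(2) wE by (simp add: \<Delta>_def \<sigma>_diff algebra_simps)
  then have "z - w \<in> F" using \<sigma>_fixed_iff[of "z - w"] Suc.prems(2) wE by auto
  then have "(z - w) * y ^ 0 \<in> span (Suc n)" by (intro span_monom) auto
  then show ?case using span_add[OF w(1)] by fastforce
qed

lemma E_eq_span: "E = span p"
  using in_span_of_\<Delta>_nilpotent[of p] \<Delta>_nilpotent span_subset_E by blast

text \<open>Applying the automorphisms to the relation gives a polynomial of degree below
  \<open>p\<close> that vanishes at the \<open>p\<close> distinct conjugates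
  \<open>y + j\<close>.\<close>

lemma power_y_independent:
  assumes a: "\<And>i. i < p \<Longrightarrow> a i \<in> F" and eq: "(\<Sum>i<p. a i * y ^ i) = 0" and i: "i < p"
  shows "a i = 0"
proof -
  define q where "q = (\<Sum>i<p. monom (a i) i)"
  have cq: "coeff q i = (if i < p then a i else 0)" for i
    by (simp add: q_def coeff_sum)
  have deg: "q \<noteq> 0 \<Longrightarrow> degree q < p" using cq leading_coeff_0_iff[of q] by metis
  have inj: "inj_on (\<lambda>j. y + of_nat j) {..<p}"
    by (auto simp: inj_on_def of_nat_eq_iff_cong_CHAR CHAR_p cong_def)
  have roots: "(\<lambda>j. y + of_nat j) ` {..<p} \<subseteq> {x. poly q x = 0}"
  proof
    fix x assume "x \<in> (\<lambda>j. y + of_nat j) ` {..<p}"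
    then obtain j where x: "x = (\<sigma> ^^ j) y" by (auto simp: pow_y)
    have "poly q x = (\<Sum>i<p. a i * ((\<sigma> ^^ j) y) ^ i)" by (simp add: q_def poly_sum poly_monom x)
    also have "\<dots> = (\<sigma> ^^ j) (\<Sum>i<p. a i * y ^ i)"
      using a by (subst pow_sum) (auto simp: pow_mult pow_power pow_F F_E E.power_mem intro!: sum.cong monom_mem)
    finally show "x \<in> {x. poly q x = 0}" using eq pow_F[of 0] by simp
  qed
  have "q = 0"
  proof (rule ccontr)
    assume q: "q \<noteq> 0"
    have "p = card ((\<lambda>j. y + of_nat j) ` {..<p})" using inj by (simp add: card_image)
    also have "\<dots> \<le> card {x. poly q x = 0}"
      using roots q by (intro card_mono poly_roots_finite)
    also have "\<dots> \<le> degree q" by (rule card_poly_roots_bound[OF q])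
    finally show False using deg[OF q] by simp
  qed
  then show ?thesis using cq[of i] i by simp
qed

text \<open>For \<open>z\<close> in \<open>E\<close> the choice is determined at the indices
  \<open>i < p\<close> only; beyond them the values are arbitrary elements of
  \<open>F\<close>.\<close>

definition coord :: "'a \<Rightarrow> nat \<Rightarrow> 'a"
  where "coord z = (SOME a. (\<forall>i. a i \<in> F) \<and> z = (\<Sum>i<p. a i * y ^ i))"

lemma coord: "z \<in> E \<Longrightarrow> coord z i \<in> F" "z \<in> E \<Longrightarrow> z = (\<Sum>i<p. coord z i * y ^ i)"
proof -
  have ex: "z \<in> E \<Longrightarrow> \<exists>a. (\<forall>i. a i \<in> F) \<and> z = (\<Sum>i<p. a i * y ^ i)"
    using E_eq_span unfolding span_def by blast
  show "z \<in> E \<Longrightarrow> coord z i \<in> F" "z \<in> E \<Longrightarrow> z = (\<Sum>i<p. coord z i * y ^ i)"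
    using someI_ex[OF ex] unfolding coord_def by blast+
qed

lemma coord_eqI:
  assumes "\<And>i. i < p \<Longrightarrow> a i \<in> F" "i < p"
  shows "coord (\<Sum>i<p. a i * y ^ i) i = a i"
proof -
  define z where "z = (\<Sum>i<p. a i * y ^ i)"
  have z: "z \<in> E" using assms(1) by (auto simp: z_def intro!: E.sum_mem monom_mem)
  have "(\<Sum>i<p. (coord z i - a i) * y ^ i) = 0"
    using coord(2)[OF z] by (simp add: left_diff_distrib sum_subtractf z_def[symmetric])
  then have "coord z i - a i = 0"
    using assms coord(1)[OF z] by (intro power_y_independent[of "\<lambda>i. coord z i - a i"]) auto
  then show ?thesis by (simp add: z_def)
qed

lemma Tr_eq: "z \<in> E \<Longrightarrow> Tr z = - coord z (p - 1)"
proof -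
  assume z: "z \<in> E"
  have "Tr z = Tr (\<Sum>i<p. coord z i * y ^ i)" using coord(2)[OF z] by simp
  also have "\<dots> = (\<Sum>i<p. coord z i * Tr (y ^ i))"
    using coord(1)[OF z] by (subst Tr_sum) (auto simp: Tr_F_mult E.power_mem intro!: monom_mem)
  also have "\<dots> = (\<Sum>i<p. if i = p - 1 then - coord z i else 0)"
    by (intro sum.cong refl) (auto simp: Tr_y_power)
  also have "\<dots> = - coord z (p - 1)" using p_gt_0 by (simp add: sum.delta)
  finally show ?thesis .
qed

lemma Tr_mem: "z \<in> E \<Longrightarrow> Tr z \<in> F"
  by (simp add: Tr_eq coord F.uminus_mem)

end

section \<open>The weight filtration of an Artin-Schreier extension\<close>

lemma coeff_prod_linear:
  "degree (\<Prod>i<n. [:1, b i:]) \<le> n \<and> coeff (\<Prod>i<n. [:1, b i:]) n = (\<Prod>i<n. b i)"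
  for b :: "nat \<Rightarrow> 'a::comm_ring_1"
proof (induction n)
  case (Suc n)
  let ?Q = "\<Prod>i<n. [:1, b i:]"
  have eq: "(\<Prod>i<Suc n. [:1, b i:]) = ?Q + pCons 0 (smult (b n) ?Q)"
    by (simp add: mult.commute[of ?Q])
  have "degree (pCons 0 (smult (b n) ?Q)) \<le> Suc n"
    using Suc degree_pCons_le[of 0 "smult (b n) ?Q"] degree_smult_le[of "b n" ?Q] by linarith
  then have "degree (?Q + pCons 0 (smult (b n) ?Q)) \<le> Suc n"
    using Suc by (intro degree_add_le) auto
  moreover have "coeff ?Q (Suc n) = 0" using Suc by (intro coeff_eq_0) auto
  ultimately show ?case using Suc unfolding eq by (simp add: mult.commute)
qed simp

text \<open>Only a lower bound on \<open>v f\<close> is required, so that the locale covers the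
  unramified case as \<open>m = 0\<close> as well as the ramified one, where equality is added
  later.\<close>

locale artin_schreier_valuation = artin_schreier E F \<sigma> p y + V: finite_residue_valuation F v t
  for E F :: "'a::field set" and \<sigma> p y v t +
  fixes m :: nat
  assumes val_f: "val_ge v (- int m) f"
begin

text \<open>Scaling the valuation by \<open>p\<close> matches the weights of the filtration \<open>W\<close> below.\<close>

definition S :: "int \<Rightarrow> 'a set"
  where "S s = {c \<in> F. c = 0 \<or> s \<le> int p * v c}"

lemma S_F: "c \<in> S s \<Longrightarrow> c \<in> F"
  by (simp add: S_def)

lemma S_zero [simp]: "0 \<in> S s"
  by (simp add: S_def)

lemma S_mono: "c \<in> S s \<Longrightarrow> r \<le> s \<Longrightarrow> c \<in> S r"
  by (auto simp: S_def)

lemma S_iff_vge: "c \<in> F \<Longrightarrow> c \<in> S (int p * n) \<longleftrightarrow> V.vge n c"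
  using p_gt_0 by (auto simp: S_def val_ge_def)

text \<open>Integrality of \<open>v\<close>: a weight strictly above \<open>int p * (n - 1)\<close>
  forces the next integer \<open>n\<close>, so any excess over a multiple of \<open>p\<close> gains
  a full level.\<close>

lemma S_imp_vge: "c \<in> S s \<Longrightarrow> int p * (n - 1) < s \<Longrightarrow> V.vge n c"
proof -
  assume c: "c \<in> S s" and s: "int p * (n - 1) < s"
  have "n \<le> v c" if "c \<noteq> 0"
  proof -
    have "int p * (n - 1) < int p * v c" using c s that by (auto simp: S_def)
    then show ?thesis using p_gt_0 by (simp add: mult_less_cancel_left)
  qed
  then show ?thesis by (auto simp: val_ge_def)
qed

lemma S_add: "c \<in> S s \<Longrightarrow> d \<in> S s \<Longrightarrow> c + d \<in> S s"
proof -
  assume cd: "c \<in> S s" "d \<in> S s"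
  show ?thesis
  proof (cases "c = 0 \<or> d = 0 \<or> c + d = 0")
    case False
    then have "min (v c) (v d) \<le> v (c + d)" using cd by (intro V.val_add) (auto simp: S_def)
    then have "int p * min (v c) (v d) \<le> int p * v (c + d)" by (intro mult_left_mono) auto
    moreover have "s \<le> int p * min (v c) (v d)" using cd False by (auto simp: S_def min_def)
    ultimately show ?thesis using cd by (auto simp: S_def)
  qed (use cd in \<open>auto simp: S_def\<close>)
qed

lemma S_minus: "c \<in> S s \<Longrightarrow> - c \<in> S s"
  by (auto simp: S_def)

lemma S_mult: "c \<in> S s \<Longrightarrow> d \<in> S r \<Longrightarrow> c * d \<in> S (s + r)"
proof (cases "c = 0 \<or> d = 0")
  case False
  assume "c \<in> S s" "d \<in> S r"
  then show ?thesis using False by (auto simp: S_def V.val_mult algebra_simps)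
qed auto

lemma S_sum: "(\<And>i. i \<in> I \<Longrightarrow> g i \<in> S s) \<Longrightarrow> sum g I \<in> S s"
  by (induction I rule: infinite_finite_induct) (auto intro: S_add)

lemma val_of_nat: "0 < n \<Longrightarrow> n < p \<Longrightarrow> v (of_nat n) = 0 \<and> (of_nat n :: 'a) \<noteq> 0"
proof -
  assume n: "0 < n" "n < p"
  have eq: "(of_nat n :: 'a) ^ (p - 1) = 1"
    by (rule of_nat_power_CHAR_minus_one[OF prime_p CHAR_p n])
  then have nz: "(of_nat n :: 'a) \<noteq> 0" using p_ge_2 by (auto simp: zero_power)
  have "int (p - 1) * v (of_nat n) = 0"
    using V.val_power[of "of_nat n" "p - 1"] nz eq by simp
  then show ?thesis using nz p_ge_2 by simp
qed

definition W :: "int \<Rightarrow> 'a set"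
  where "W r = {z \<in> E. \<forall>i<p. coord z i \<in> S (r + int m * int i)}"

lemma W_E: "z \<in> W r \<Longrightarrow> z \<in> E"
  by (simp add: W_def)

lemma W_mono: "z \<in> W r \<Longrightarrow> s \<le> r \<Longrightarrow> z \<in> W s"
  by (auto simp: W_def elim!: S_mono)

lemma W_I:
  assumes "\<And>i. i < p \<Longrightarrow> a i \<in> S (r + int m * int i)" "z = (\<Sum>i<p. a i * y ^ i)"
  shows "z \<in> W r"
proof -
  have a: "i < p \<Longrightarrow> a i \<in> F" for i using assms(1) S_F by blast
  have "z \<in> E" unfolding assms(2) using a by (auto intro!: E.sum_mem monom_mem)
  moreover have "coord z i = a i" if "i < p" for i unfolding assms(2) using a that by (rule coord_eqI)
  ultimately show ?thesis using assms(1) by (simp add: W_def)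
qed

lemma coord_add: "z \<in> E \<Longrightarrow> w \<in> E \<Longrightarrow> i < p \<Longrightarrow> coord (z + w) i = coord z i + coord w i"
proof -
  assume zw: "z \<in> E" "w \<in> E" and i: "i < p"
  have "z + w = (\<Sum>i<p. (coord z i + coord w i) * y ^ i)"
    using coord(2)[OF zw(1)] coord(2)[OF zw(2)] by (simp add: distrib_right sum.distrib)
  moreover have "coord (\<Sum>i<p. (coord z i + coord w i) * y ^ i) i = coord z i + coord w i"
    using coord(1) zw i by (intro coord_eqI F.add_mem)
  ultimately show ?thesis by (simp only:)
qed

lemma W_add: "z \<in> W r \<Longrightarrow> w \<in> W r \<Longrightarrow> z + w \<in> W r"
  by (auto simp: W_def coord_add intro: S_add)

lemma W_low_monom: "c \<in> S (r + int m * int i) \<Longrightarrow> i < p \<Longrightarrow> c * y ^ i \<in> W r"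
  by (rule W_I[of "\<lambda>j. if j = i then c else 0"]) (auto simp: if_distrib[of "\<lambda>x. x * _"] sum.delta cong: if_cong)

lemma W_zero [simp]: "0 \<in> W r"
  using W_low_monom[of 0 r 0] p_gt_0 by simp

lemma W_sum: "(\<And>i. i \<in> I \<Longrightarrow> g i \<in> W r) \<Longrightarrow> sum g I \<in> W r"
  by (induction I rule: infinite_finite_induct) (auto intro: W_add)

lemma f_S: "f \<in> S (- int m * int p)"
  using val_f S_iff_vge[of f "- int m"] by (simp add: mult.commute)

text \<open>Exponents from \<open>p\<close> on are lowered by \<open>y ^ p = y + f\<close>. Both new
  terms keep the weight: one has a smaller exponent of \<open>y\<close>, and in the other the bound
  \<open>- m p\<close> on the weight of \<open>f\<close> matches the \<open>p\<close> factors of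
  \<open>y\<close> it replaces. This is what makes \<open>W\<close> multiplicative.\<close>

lemma W_monom: "c \<in> S (r + int m * int i) \<Longrightarrow> c * y ^ i \<in> W r"
proof (induction i arbitrary: c rule: less_induct)
  case (less i)
  show ?case
  proof (cases "i < p")
    case True
    then show ?thesis using less.prems by (intro W_low_monom)
  next
    case False
    define j where "j = i - p"
    have i: "i = p + j" using False by (simp add: j_def)
    have "c * y ^ i = c * y ^ j * (y + f)"
      by (simp add: i f_def power_add mult_ac)
    also have "\<dots> = c * y ^ (Suc j) + (c * f) * y ^ j" by (simp add: algebra_simps)
    also have "\<dots> \<in> W r"
    proof (rule W_add)
      show "c * y ^ Suc j \<in> W r"
      proof (rule less.IH)
        show "Suc j < i" using p_ge_2 by (simp add: i)
        then have "int m * int (Suc j) \<le> int m * int i" by (intro mult_left_mono) auto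
        then show "c \<in> S (r + int m * int (Suc j))" by (intro S_mono[OF less.prems]) auto
      qed
      show "(c * f) * y ^ j \<in> W r"
      proof (rule less.IH)
        show "j < i" using p_gt_0 by (simp add: i)
        show "c * f \<in> S (r + int m * int j)"
          using S_mult[OF less.prems f_S] by (simp add: i algebra_simps)
      qed
    qed
    finally show ?thesis .
  qed
qed

lemma W_mult: "z \<in> W r \<Longrightarrow> w \<in> W s \<Longrightarrow> z * w \<in> W (r + s)"
proof -
  assume zw: "z \<in> W r" "w \<in> W s"
  have "z * w = (\<Sum>i<p. coord z i * y ^ i) * (\<Sum>j<p. coord w j * y ^ j)"
    using coord(2)[OF W_E[OF zw(1)]] coord(2)[OF W_E[OF zw(2)]] by simp
  also have "\<dots> = (\<Sum>i<p. \<Sum>j<p. (coord z i * coord w j) * y ^ (i + j))"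
    by (subst sum_product, intro sum.cong refl) (simp add: power_add mult_ac)
  also have "\<dots> \<in> W (r + s)"
  proof (intro W_sum W_monom)
    fix i j assume "i \<in> {..<p}" "j \<in> {..<p}"
    then have "coord z i * coord w j \<in> S ((r + int m * int i) + (s + int m * int j))"
      using zw by (intro S_mult) (auto simp: W_def)
    then show "coord z i * coord w j \<in> S (r + s + int m * int (i + j))"
      by (simp add: algebra_simps)
  qed
  finally show ?thesis .
qed

lemma W_F: "c \<in> F \<Longrightarrow> c \<in> W r \<longleftrightarrow> c \<in> S r"
proof
  assume c: "c \<in> F"
  have "c = (\<Sum>i<p. (if i = 0 then c else 0) * y ^ i)"
    using p_gt_0 by (simp add: if_distrib[of "\<lambda>x. x * _"] sum.delta cong: if_cong)
  then have "coord c 0 = c"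
    using coord_eqI[of "\<lambda>i. if i = 0 then c else 0" 0] c p_gt_0 by auto
  then show "c \<in> W r \<Longrightarrow> c \<in> S r" using p_gt_0 by (auto simp: W_def dest: spec[of _ 0])
  show "c \<in> S r \<Longrightarrow> c \<in> W r" using W_low_monom[of c r 0] p_gt_0 by simp
qed

lemma W_one: "1 \<in> W 0"
  using W_F[of 1] by (simp add: S_def)

lemma W_minus: "z \<in> W r \<Longrightarrow> - z \<in> W r"
proof -
  assume z: "z \<in> W r"
  have "-1 \<in> S 0" by (auto simp: S_def)
  then have "-1 \<in> W 0" using W_F[of "-1"] by auto
  then show ?thesis using W_mult[of "-1" 0 z r] z by simp
qed

lemma W_diff: "z \<in> W r \<Longrightarrow> w \<in> W r \<Longrightarrow> z - w \<in> W r"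
  using W_add[of z r "- w"] W_minus[of w r] by simp

lemma W_power: "z \<in> W r \<Longrightarrow> z ^ n \<in> W (int n * r)"
proof (induction n)
  case (Suc n)
  then show ?case using W_mult[of z r "z ^ n" "int n * r"] by (simp add: algebra_simps)
qed (simp add: W_one)

lemma W_prod: "(\<And>i. i \<in> I \<Longrightarrow> g i \<in> W r) \<Longrightarrow> prod g I \<in> W (int (card I) * r)"
proof (induction I rule: infinite_finite_induct)
  case (insert x I)
  then show ?case using W_mult[of "g x" r "prod g I" "int (card I) * r"] by (simp add: algebra_simps)
qed (simp_all add: W_one)

text \<open>Substituting \<open>y + 1\<close> for \<open>y\<close> keeps weights, since
  \<open>1\<close> has weight \<open>0\<close>, which is at least \<open>- m\<close>.\<close>

lemma W_\<sigma>: "z \<in> W r \<Longrightarrow> \<sigma> z \<in> W r"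
proof -
  assume z: "z \<in> W r"
  note zE = W_E[OF z]
  have "1 * y ^ 1 \<in> W (- int m)" by (rule W_monom) (simp add: S_def)
  moreover have "1 \<in> W (- int m)" using W_one by (rule W_mono) simp
  ultimately have y1: "y + 1 \<in> W (- int m)" using W_add by simp
  have "\<sigma> z = \<sigma> (\<Sum>i<p. coord z i * y ^ i)" using coord(2)[OF zE] by simp
  also have "\<dots> = (\<Sum>i<p. \<sigma> (coord z i * y ^ i))"
    using pow_sum[of "{..<p}" "\<lambda>i. coord z i * y ^ i" 1] coord(1)[OF zE] monom_mem by simp
  also have "\<dots> = (\<Sum>i<p. coord z i * (y + 1) ^ i)"
    using coord(1)[OF zE] by (simp add: \<sigma>_mult F_E E.power_mem \<sigma>_F \<sigma>_power \<sigma>_y)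
  also have "\<dots> \<in> W r"
  proof (rule W_sum)
    fix i assume "i \<in> {..<p}"
    then have "coord z i \<in> S (r + int m * int i)" using z by (simp add: W_def)
    then have "coord z i \<in> W (r + int m * int i)" using W_F[of "coord z i"] S_F by blast
    then have "coord z i * (y + 1) ^ i \<in> W (r + int m * int i + int i * (- int m))"
      by (rule W_mult) (rule W_power[OF y1])
    then show "coord z i * (y + 1) ^ i \<in> W r" by (simp add: algebra_simps)
  qed
  finally show ?thesis .
qed

lemma W_pow: "z \<in> W r \<Longrightarrow> (\<sigma> ^^ j) z \<in> W r"
  by (induction j) (auto intro: W_\<sigma>)

text \<open>All \<open>p\<close> conjugates lie in \<open>W r\<close>, so their product has weight
  at least \<open>p * r\<close>, which on \<open>F\<close> means valuation at least
  \<open>r\<close>.\<close>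

lemma W_N: "z \<in> W r \<Longrightarrow> V.vge r (N z)"
proof -
  assume z: "z \<in> W r"
  have "N z \<in> W (int p * r)"
    unfolding N_def using W_prod[of "{..<p}" "\<lambda>j. (\<sigma> ^^ j) z" r] W_pow[OF z] by simp
  then show ?thesis using N_mem[OF W_E[OF z]] W_F S_iff_vge by blast
qed

text \<open>The surplus \<open>m * (p - 1)\<close> is the shift in weight of the top coordinate, the
  one that the trace selects. It drives the norm estimates below.\<close>

lemma W_Tr: "z \<in> W r \<Longrightarrow> Tr z \<in> S (r + int m * int (p - 1))"
proof -
  assume z: "z \<in> W r"
  then have "\<forall>i<p. coord z i \<in> S (r + int m * int i)" by (simp add: W_def)
  from this[rule_format, of "p - 1"] have "coord z (p - 1) \<in> S (r + int m * int (p - 1))" using p_gt_0 by simp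
  then show ?thesis unfolding Tr_eq[OF W_E[OF z]] by (rule S_minus)
qed

text \<open>The elementary symmetric functions of the conjugates of \<open>z\<close>.\<close>

definition esym :: "'a \<Rightarrow> nat \<Rightarrow> 'a"
  where "esym z n = coeff (\<Prod>j<p. [:1, (\<sigma> ^^ j) z:]) n"

lemma esym_0: "esym z 0 = 1"
  by (simp add: esym_def poly_0_coeff_0[symmetric] poly_prod)

lemma esym_p: "esym z p = N z"
  by (simp add: esym_def N_def coeff_prod_linear)

lemma esym_newton:
  "z \<in> E \<Longrightarrow> of_nat (Suc n) * esym z (Suc n) = (\<Sum>k\<le>n. esym z k * ((-1) ^ (n - k) * Tr (z ^ Suc (n - k))))"
  using newton_identity[of "{..<p}" n "\<lambda>j. (\<sigma> ^^ j) z"] pow_power[of z]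
  by (simp add: esym_def Tr_def del: of_nat_Suc power_Suc)

lemma esym_1: "z \<in> E \<Longrightarrow> esym z 1 = Tr z"
  using esym_newton[of z 0] by (simp add: esym_0)

lemma S_uminus_one_power: "(-1) ^ n \<in> S 0"
  by (cases "even n") (auto simp: S_def)

text \<open>Each summand of Newton's identity contains one trace and inherits its surplus; dividing
  by \<open>n\<close> costs nothing because \<open>0 < n < p\<close> makes it a unit. At
  \<open>n = 0\<close> and \<open>n = p\<close> the argument breaks down: these are \<open>1\<close>
  and the norm.\<close>

lemma esym_bound:
  assumes z: "z \<in> W r" and n: "0 < n" "n < p"
  shows "esym z n \<in> S (int n * r + int m * int (p - 1))"
  using n
proof (induction n rule: less_induct)
  case (less n)
  obtain l where l: "n = Suc l" using less.prems by (cases n) auto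
  have main: "of_nat (Suc l) * esym z (Suc l) \<in> S (int n * r + int m * int (p - 1))"
    unfolding esym_newton[OF W_E[OF z]]
  proof (rule S_sum)
    fix k assume k: "k \<in> {..l}"
    have "z ^ Suc (l - k) \<in> W (int (Suc (l - k)) * r)" by (rule W_power[OF z])
    then have "Tr (z ^ Suc (l - k)) \<in> S (int (Suc (l - k)) * r + int m * int (p - 1))" by (rule W_Tr)
    from S_mult[OF S_uminus_one_power this]
    have T: "(-1) ^ (l - k) * Tr (z ^ Suc (l - k)) \<in> S (int (Suc (l - k)) * r + int m * int (p - 1))"
      by (simp del: power_Suc)
    have e: "esym z k \<in> S (int k * r)"
    proof (cases "k = 0")
      case True
      then show ?thesis by (simp add: esym_0 S_def)
    next
      case False
      then have "esym z k \<in> S (int k * r + int m * int (p - 1))"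
        using less k l by (intro less.IH) auto
      then show ?thesis by (rule S_mono) simp
    qed
    have "int k * r + (int (Suc (l - k)) * r + int m * int (p - 1)) = int n * r + int m * int (p - 1)"
      using k l by (simp add: of_nat_diff algebra_simps)
    with S_mult[OF e T]
    show "esym z k * ((-1) ^ (l - k) * Tr (z ^ Suc (l - k))) \<in> S (int n * r + int m * int (p - 1))"
      by (simp only:)
  qed
  have un: "v (of_nat (Suc l)) = 0" "(of_nat (Suc l) :: 'a) \<noteq> 0" using val_of_nat[of n] less.prems l by auto
  have "inverse (of_nat (Suc l)) \<in> S 0"
    using un V.val_inverse[of "of_nat (Suc l)"] by (auto simp: S_def simp del: of_nat_Suc)
  from S_mult[OF this main]
  have "inverse (of_nat (Suc l)) * (of_nat (Suc l) * esym z (Suc l)) \<in> S (0 + (int n * r + int m * int (p - 1)))" .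
  then show ?case using un(2) l by (simp add: mult.assoc[symmetric] del: of_nat_Suc)
qed

text \<open>\<open>N (1 + z)\<close> is the sum of all \<open>esym z n\<close>. The terms
  \<open>n = 0, 1, p\<close> are kept, and those with \<open>2 \<le> n < p\<close> fall under
  \<open>esym_bound\<close>, where \<open>r \<ge> 0\<close> gives
  \<open>2 * r \<le> n * r\<close>.\<close>

lemma N_one_plus:
  assumes z: "z \<in> W r" and r: "r \<ge> 0"
  shows "N (1 + z) - (1 + Tr z + N z) \<in> S (2 * r + int m * int (p - 1))"
proof -
  let ?Q = "\<Prod>j<p. [:1, (\<sigma> ^^ j) z:]"
  have "N (1 + z) = poly ?Q 1"
    using W_E[OF z] pow_F[OF F.one_mem] by (simp add: N_def poly_prod pow_add)
  also have "\<dots> = (\<Sum>n\<le>p. esym z n)"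
    using coeff_prod_linear[of "\<lambda>j. (\<sigma> ^^ j) z" p] by (simp add: poly_altdef_le[of _ p] esym_def)
  also have "\<dots> = (\<Sum>n<p. esym z n) + N z" by (simp add: lessThan_Suc_atMost[symmetric] esym_p)
  also have "(\<Sum>n<p. esym z n) = esym z 0 + (\<Sum>n=1..<p. esym z n)"
    using p_gt_0 by (simp add: lessThan_atLeast0 sum.atLeast_Suc_lessThan)
  also have "(\<Sum>n=1..<p. esym z n) = esym z 1 + (\<Sum>n=2..<p. esym z n)"
    using p_ge_2 by (simp add: sum.atLeast_Suc_lessThan numeral_2_eq_2)
  finally have "N (1 + z) - (1 + Tr z + N z) = (\<Sum>n=2..<p. esym z n)"
    using esym_1[OF W_E[OF z]] by (simp add: esym_0)
  also have "\<dots> \<in> S (2 * r + int m * int (p - 1))"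
  proof (rule S_sum)
    fix n assume n: "n \<in> {2..<p}"
    then have "2 * r \<le> int n * r" using r by (intro mult_right_mono) auto
    then show "esym z n \<in> S (2 * r + int m * int (p - 1))"
      using n esym_bound[OF z, of n] by (auto elim!: S_mono)
  qed
  finally show ?thesis .
qed

lemma N_one_plus_close:
  assumes z: "z \<in> W 1"
  shows "V.vge 1 (N (1 + z) - 1)" "N (1 + z) \<noteq> 0" "v (N (1 + z)) = 0"
proof -
  have mem: "N (1 + z) \<in> F" "Tr z \<in> F" "N z \<in> F"
    using W_E[OF z] by (auto intro!: N_mem Tr_mem)
  have "V.vge 1 (Tr z)" using W_Tr[OF z] by (rule S_imp_vge) (simp add: add_pos_nonneg)
  moreover have "V.vge 1 (N z)" using W_N[OF z] .
  moreover have "V.vge 1 (N (1 + z) - (1 + Tr z + N z))"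
    by (rule S_imp_vge[OF N_one_plus[OF z]]) (simp_all add: add_pos_nonneg)
  ultimately have "V.vge 1 ((N (1 + z) - (1 + Tr z + N z)) + (Tr z + N z))"
    using mem by (intro V.vge_add) auto
  then show 1: "V.vge 1 (N (1 + z) - 1)" by simp
  show "N (1 + z) \<noteq> 0" "v (N (1 + z)) = 0"
    using V.val_eq_of_close[OF mem(1) _ _ 1] by auto
qed

subsection \<open>Units of high level are norms\<close>

text \<open>The correction \<open>z = - a * y ^ (p - 1)\<close> has trace exactly \<open>a\<close>.
  Its weight \<open>r = p * (n - m) + m\<close> exceeds \<open>n\<close> because
  \<open>n > m\<close>, so \<open>N z\<close> is negligible; the error in \<open>N_one_plus\<close>
  has weight at least \<open>p * n + r > p * n\<close>, hence level \<open>n + 1\<close>.\<close>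

lemma norm_step:
  assumes a: "a \<in> F" "V.vge n a" and n: "int m < n"
  shows "\<exists>z\<in>W (int p * n - int m * int (p - 1)). V.vge (n + 1) (N (1 + z) - (1 + a))"
proof -
  define r where "r = int p * n - int m * int (p - 1)"
  have pm: "int (p - 1) = int p - 1" using p_gt_0 by (simp add: of_nat_diff)
  have r: "r = int p * (n - int m) + int m" unfolding r_def pm by (simp add: algebra_simps)
  have pn: "int p * 1 \<le> int p * (n - int m)" "(int p - 1) * 1 \<le> (int p - 1) * (n - int m)"
    using n p_gt_0 by (intro mult_left_mono; simp)+
  have rn: "n + 1 \<le> r" using pn(2) p_ge_2 unfolding r by (simp add: algebra_simps)
  have r0: "r \<ge> 0" using pn(1) unfolding r by simp
  define z where "z = (- a) * y ^ (p - 1)"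
  have aS: "- a \<in> S (int p * n)" using a S_iff_vge S_minus by blast
  have z: "z \<in> W r" unfolding z_def
    by (rule W_monom) (use aS in \<open>simp only: r_def diff_add_cancel\<close>)
  have mem: "N (1 + z) \<in> F" "N z \<in> F" using W_E[OF z] by (auto intro!: N_mem)
  have Tr: "Tr z = a" unfolding z_def using a Tr_y_power[of "p - 1"] p_gt_0
    by (subst Tr_F_mult) (auto intro: F.uminus_mem E.power_mem)
  have "V.vge (n + 1) (N z)" using W_N[OF z] rn by (rule val_ge_mono)
  moreover have "V.vge (n + 1) (N (1 + z) - (1 + a + N z))"
  proof (rule S_imp_vge)
    show "N (1 + z) - (1 + a + N z) \<in> S (2 * r + int m * int (p - 1))"
      using N_one_plus[OF z r0] Tr by simp
    have "int p * n < 2 * r + int m * int (p - 1)"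
      using pn p_ge_2 unfolding r pm by (simp add: algebra_simps)
    then show "int p * (n + 1 - 1) < 2 * r + int m * int (p - 1)" by simp
  qed
  ultimately have "V.vge (n + 1) ((N (1 + z) - (1 + a + N z)) + N z)"
    using mem a by (intro V.vge_add) auto
  moreover have "(N (1 + z) - (1 + a + N z)) + N z = N (1 + z) - (1 + a)" by simp
  ultimately have "V.vge (n + 1) (N (1 + z) - (1 + a))" by (simp only:)
  with z show ?thesis unfolding r_def by blast
qed

text \<open>Multiplicative correction: \<open>w\<close> becomes \<open>w * (1 + z)\<close>, with
  \<open>norm_step\<close> applied to the relative error \<open>a\<close> of \<open>N w\<close>. The
  control of \<open>w' - w\<close> later makes the approximations Cauchy.\<close>

lemma norm_refine:
  assumes x: "x \<in> F" and w: "w \<in> W 0" "N w \<noteq> 0" "v (N w) = 0" "V.vge n (x - N w)" and n: "int m < n"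
  shows "\<exists>w'\<in>W 0. w' - w \<in> W (int p * n - int m * int (p - 1)) \<and> V.vge (n + 1) (x - N w')"
proof -
  have NF: "N w \<in> F" using w W_E N_mem by blast
  define a where "a = (x - N w) * inverse (N w)"
  have a: "a \<in> F" using x NF by (auto simp: a_def)
  have "V.vge (n + 0) a" unfolding a_def
    using x NF w by (intro V.vge_mult) (auto simp: val_ge_def V.val_inverse)
  then have "V.vge n a" by simp
  then obtain z where z: "z \<in> W (int p * n - int m * int (p - 1))" "V.vge (n + 1) (N (1 + z) - (1 + a))"
    using norm_step[OF a _ n] by blast
  have nonneg: "0 \<le> int p * n - int m * int (p - 1)"
  proof -
    have "int m * int (p - 1) \<le> n * int p" using n by (intro mult_mono) auto
    then show ?thesis by (simp add: mult.commute)
  qed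
  have z0: "z \<in> W 0" using z(1) nonneg by (rule W_mono)
  have wz: "w * z \<in> W (int p * n - int m * int (p - 1))" using W_mult[OF w(1) z(1)] by simp
  have N1: "N (1 + z) \<in> F" using W_E[OF z0] by (auto intro: N_mem)
  have "N w * a = x - N w" using w(2) by (simp add: a_def)
  then have "x - N w * N (1 + z) = - (N w * (N (1 + z) - (1 + a)))" by (simp add: algebra_simps)
  moreover have "N (w * (1 + z)) = N w * N (1 + z)"
    using W_E[OF w(1)] W_E[OF z0] by (intro N_mult E.add_mem E.one_mem)
  ultimately have "x - N (w * (1 + z)) = - (N w * (N (1 + z) - (1 + a)))" by (simp only:)
  moreover have "V.vge (n + 1) (N w * (N (1 + z) - (1 + a)))"
    using w(2,3) z(2) NF N1 a by (intro V.vge_mult0) (auto simp: val_ge_def)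
  ultimately have "V.vge (n + 1) (x - N (w * (1 + z)))"
    using V.vge_minus NF N1 a by (simp add: F.mult_mem F.diff_mem F.add_mem)
  moreover have "w * (1 + z) \<in> W 0" using W_mult[OF w(1) W_add[OF W_one z0]] by simp
  moreover have "w * (1 + z) - w = w * z" by (simp add: algebra_simps)
  ultimately show ?thesis using wz by (intro bexI[of _ "w * (1 + z)"]) auto
qed

text \<open>The target \<open>x n\<close> moves because an element of the completion is given only
  by a Cauchy sequence; \<open>close\<close> keeps the old approximation good enough to be refined
  towards the new target.\<close>

lemma norm_sequence:
  fixes x :: "nat \<Rightarrow> 'a"
  assumes x: "\<And>n. x n \<in> F" "\<And>n. x n \<noteq> 0" "\<And>n. v (x n) = 0"
    and close: "\<And>n. V.vge (int m + 1 + int n) (x (Suc n) - x n)"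
    and w0: "w0 \<in> W 0" "V.vge (int m + 1) (x 0 - N w0)"
  shows "\<exists>w. \<forall>n. w n \<in> W 0 \<and> V.vge (int m + 1 + int n) (x n - N (w n)) \<and>
    w (Suc n) - w n \<in> W (int p * (int m + 1 + int n) - int m * int (p - 1))"
proof -
  define P where "P n w \<longleftrightarrow> w \<in> W 0 \<and> V.vge (int m + 1 + int n) (x n - N w)" for n w
  define Q where "Q n w w' \<longleftrightarrow> w' - w \<in> W (int p * (int m + 1 + int n) - int m * int (p - 1))" for n w w'
  have "\<exists>w. \<forall>n. P n (w n) \<and> Q n (w n) (w (Suc n))"
  proof (rule dependent_nat_choice)
    show "\<exists>w. P 0 w" using w0 by (auto simp: P_def)
  next
    fix w n assume "P n w"
    then have w: "w \<in> W 0" "V.vge (int m + 1 + int n) (x n - N w)" by (auto simp: P_def)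
    have NF: "N w \<in> F" using w W_E N_mem by blast
    have "V.vge (int m + 1 + int n) (N w - x n)"
      by (rule V.vge_diff_commute[OF x(1) NF w(2)])
    then have "N w \<noteq> 0" "v (N w) = 0"
      using V.val_eq_of_close[OF NF x(1,2), of "int m + 1 + int n" n] x(3)[of n] by auto
    moreover have "V.vge (int m + 1 + int n) (x (Suc n) - N w)"
      by (rule V.vge_diff_trans[OF x(1) x(1) NF close w(2)])
    ultimately show "\<exists>w'. P (Suc n) w' \<and> Q n w w'"
      using norm_refine[OF x(1) w(1), of "int m + 1 + int n" "Suc n"]
      by (auto simp: P_def Q_def algebra_simps)
  qed
  then show ?thesis by (simp add: P_def Q_def)
qed

end

subsection \<open>The ramified case\<close>

locale ramified_artin_schreier = artin_schreier_valuation +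
  assumes m_pos: "m > 0" and p_not_dvd_m: "\<not> p dvd m" and f_nonzero [simp]: "f \<noteq> 0" and val_f_eq: "v f = - int m"
begin

lemma y_nonzero [simp]: "y \<noteq> 0"
  using N_y f_nonzero N_eq_0_iff[of y] y_mem by auto

text \<open>\<open>y\<close> is invertible within the filtration, with the opposite weight:
  \<open>f / y = y ^ (p - 1) - 1\<close> and the exact valuation of \<open>f\<close> give
  \<open>p m - m (p - 1) = m\<close>.\<close>

lemma inverse_y: "inverse y \<in> W (int m)"
proof -
  have "f * inverse y = y ^ (p - 1) - 1"
  proof -
    have "y ^ p = y * y ^ (p - 1)" using p_gt_0 by (metis power_eq_if neq0_conv)
    then show ?thesis by (simp add: f_def field_simps)
  qed
  then have eq: "inverse y = inverse f * (1 * y ^ (p - 1) - 1 * y ^ 0)"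
    by (simp add: field_simps)
  have pm: "int (p - 1) = int p - 1" using p_gt_0 by (simp add: of_nat_diff)
  have "inverse f \<in> S (int p * int m)"
    using V.val_inverse[of f] val_f_eq by (auto simp: S_def)
  then have "inverse f \<in> W (int p * int m)" using W_F[OF F.inverse_mem[OF f_mem]] by blast
  moreover have "1 * y ^ (p - 1) \<in> W (- (int m * int (p - 1)))"
    by (rule W_monom) (simp add: S_def)
  moreover have "1 * y ^ 0 \<in> W (- (int m * int (p - 1)))"
    by (rule W_monom) (simp add: S_def)
  ultimately have "inverse y \<in> W (int p * int m + - (int m * int (p - 1)))"
    unfolding eq by (intro W_mult W_diff)
  then show ?thesis unfolding pm by (simp add: algebra_simps)
qed

text \<open>The terms of \<open>\<Sum>i<p. coord z i * y ^ i\<close> have pairwise different weights, so one dominates.\<close>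

lemma leading_monomial:
  assumes z: "z \<in> E" "z \<noteq> 0"
  obtains i c b r where "i < p" "c = coord z i" "c \<in> F" "c \<noteq> 0" "r = int p * v c - int m * int i"
    "z = c * y ^ i * (1 + b)" "b \<in> W 1" "\<And>s. z \<in> W s \<longleftrightarrow> s \<le> r" "v (N z) = r"
proof -
  define wt where "wt i = int p * v (coord z i) - int m * int i" for i
  define I where "I = {i. i < p \<and> coord z i \<noteq> 0}"
  have "finite I" by (simp add: I_def)
  have "I \<noteq> {}"
  proof
    assume "I = {}"
    then have "(\<Sum>i<p. coord z i * y ^ i) = 0" by (intro sum.neutral) (auto simp: I_def)
    then show False using coord(2)[OF z(1)] z(2) by simp
  qed
  have "Min (wt ` I) \<in> wt ` I" using \<open>finite I\<close> \<open>I \<noteq> {}\<close> by (intro Min_in) auto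
  then obtain i where i: "i \<in> I" "wt i = Min (wt ` I)" by auto
  have min: "wt i \<le> wt j" if "j \<in> I" for j using i(2) that \<open>finite I\<close> by simp
  \<comment> \<open>Equal weights make \<open>p\<close> divide \<open>m * (i - j)\<close>. Since
    \<open>p\<close> does not divide \<open>m\<close> and both indices are below \<open>p\<close>,
    they coincide.\<close>
  have inj: "i = j" if "j \<in> I" "wt i = wt j" for j
  proof -
    have "int p * (v (coord z i) - v (coord z j)) = int m * (int i - int j)"
      using that(2) by (simp add: wt_def algebra_simps)
    then have "int p dvd int m * (int i - int j)" by (metis dvd_triv_left)
    moreover have "prime (int p)" using prime_p by simp
    ultimately have "int p dvd int m \<or> int p dvd int i - int j" by (rule prime_dvd_multD[rotated])
    then have "int p dvd int i - int j" using p_not_dvd_m by simp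
    moreover have "\<bar>int i - int j\<bar> < int p" using i that by (auto simp: I_def)
    ultimately have "int i - int j = 0" using dvd_imp_le_int[of "int i - int j" "int p"] by linarith
    then show ?thesis by simp
  qed
  define c where "c = coord z i"
  define r where "r = wt i"
  have ic: "i < p" "c \<in> F" "c \<noteq> 0" "r = int p * v c - int m * int i"
    using i coord(1)[OF z(1)] by (auto simp: I_def c_def r_def wt_def)
  define z' where "z' = (\<Sum>j\<in>{..<p} - {i}. coord z j * y ^ j)"
  have z_eq: "z = c * y ^ i + z'"
    using coord(2)[OF z(1)] ic(1) by (simp add: z'_def c_def sum.remove[of "{..<p}" i])
  have z': "z' \<in> W (r + 1)" unfolding z'_def
  proof (intro W_sum W_monom)
    fix j assume j: "j \<in> {..<p} - {i}"
    show "coord z j \<in> S (r + 1 + int m * int j)"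
    proof (cases "coord z j = 0")
      case False
      then have "j \<in> I" using j by (simp add: I_def)
      then have "r < wt j" using min[of j] inj[of j] j by (fastforce simp: r_def)
      then show ?thesis using coord(1)[OF z(1)] by (simp add: S_def wt_def)
    qed simp
  qed
  \<comment> \<open>Multiplying the remaining terms by this inverse of the leading one leaves weight
    at least \<open>1\<close>.\<close>
  define u where "u = inverse c * inverse y ^ i"
  have "inverse c \<in> S (- (int p * v c))" using ic V.val_inverse[of c] by (auto simp: S_def)
  then have "inverse c \<in> W (- (int p * v c))" using W_F[of "inverse c"] ic(2) by auto
  then have "u \<in> W (- (int p * v c) + int i * int m)"
    unfolding u_def by (intro W_mult W_power inverse_y)
  moreover have "- (int p * v c) + int i * int m = - r" using ic(4) by (simp add: algebra_simps)
  ultimately have u: "u \<in> W (- r)" by simp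
  define b where "b = u * z'"
  have b: "b \<in> W 1" using W_mult[OF u z'] by (simp add: b_def)
  have uc: "c * y ^ i * u = 1"
    using ic(3) by (simp add: u_def power_inverse field_simps)
  have "c * y ^ i * b = z'" using uc by (simp add: b_def mult.assoc[symmetric])
  then have zb: "z = c * y ^ i * (1 + b)" using z_eq by (simp add: distrib_left)
  have W_iff: "z \<in> W s \<longleftrightarrow> s \<le> r" for s
  proof
    assume "z \<in> W s"
    then have "c \<in> S (s + int m * int i)" using ic(1) by (simp add: W_def c_def)
    then show "s \<le> r" using ic by (auto simp: S_def)
  next
    assume s: "s \<le> r"
    have "c * y ^ i \<in> W r" using ic by (intro W_monom) (simp add: S_def)
    then have "z \<in> W r" using z_eq z' W_add[of "c * y ^ i" r z'] W_mono[of z' "r + 1" r] by simp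
    then show "z \<in> W s" using s by (rule W_mono)
  qed
  have cy: "c * y ^ i \<in> E" using ic(2) by (rule monom_mem)
  have bE: "1 + b \<in> E" using W_E[OF b] by auto
  have Ncy: "N (c * y ^ i) = c ^ p * f ^ i"
    using ic(2) by (simp add: N_mult F_E E.power_mem N_F N_power N_y)
  \<comment> \<open>The norm turns weight into valuation: \<open>c ^ p * f ^ i\<close> has valuation
    \<open>p v(c) - m i\<close>, and \<open>N (1 + b)\<close> is a unit.\<close>
  have "N z = c ^ p * f ^ i * N (1 + b)"
    unfolding zb N_mult[OF cy bE] Ncy ..
  moreover note N_one_plus_close[OF b]
  moreover have "N (1 + b) \<in> F" using bE by (rule N_mem)
  ultimately have "v (N z) = v (c ^ p * f ^ i) + 0"
    using ic by (simp only:) (subst V.val_mult, auto intro!: F.mult_mem F.power_mem)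
  also have "v (c ^ p * f ^ i) = r"
    using ic by (subst V.val_mult) (auto simp: V.val_power val_f_eq)
  finally have "v (N z) = r" by simp
  then show thesis using that[of i c r b] ic c_def zb b W_iff by blast
qed

text \<open>In the ramified case the filtration belongs to a valuation, since
  \<open>leading_monomial\<close> identifies the largest weight of \<open>z\<close> with
  \<open>v (N z)\<close>.\<close>

lemma W_iff_val_N: "z \<in> E \<Longrightarrow> z \<in> W s \<longleftrightarrow> val_ge (\<lambda>z. v (N z)) s z"
proof (cases "z = 0")
  case False
  assume z: "z \<in> E"
  obtain i c b r where "\<And>s. z \<in> W s \<longleftrightarrow> s \<le> r" "v (N z) = r"
    using leading_monomial[OF z False] by metis
  then show ?thesis using False by (simp add: val_ge_def)
qed simp

lemma val_N_F: "c \<in> F \<Longrightarrow> c \<noteq> 0 \<Longrightarrow> v (N c) = int p * v c"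
  by (simp add: N_F V.val_power)

text \<open>\<open>t\<close> has weight \<open>p\<close> and \<open>y\<close> has weight
  \<open>- m\<close>; as these are coprime, a Bezout relation yields an element of weight
  \<open>1\<close>. The ultrametric inequality is the closure of \<open>W\<close> under
  addition.\<close>

lemma val_N_discrete: "\<exists>\<pi>. discrete_valuation E (\<lambda>z. v (N z)) \<pi>"
proof -
  have "coprime (int p) (int m)"
    using prime_p p_not_dvd_m by (simp add: prime_imp_coprime)
  then obtain a b where ab: "a * int p + b * int m = 1"
    using bezout_int[of "int p" "int m"] by (auto simp: coprime_iff_gcd_eq_1)
  define \<pi> where "\<pi> = t powi a * y powi (- b)"
  have inv: "v (N (inverse z)) = - v (N z)" if "z \<in> E" "z \<noteq> 0" for z
    using that N_mem[OF that(1)] N_eq_0_iff[OF that(1)] by (simp add: N_inverse V.val_inverse)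
  have powi: "v (N (z powi k)) = k * v (N z)" if "z \<in> E" "z \<noteq> 0" for z k
    using that N_mem[OF that(1)] N_eq_0_iff[OF that(1)] inv[of "z ^ nat (- k)"]
    by (cases "k \<ge> 0") (auto simp: power_int_def N_power V.val_power E.power_mem power_inverse)
  have tE: "t \<in> E" using F_E by simp
  have mult: "v (N (z * w)) = v (N z) + v (N w)" if "z \<in> E" "w \<in> E" "z \<noteq> 0" "w \<noteq> 0" for z w
    using that by (simp add: N_mult V.val_mult N_mem N_eq_0_iff)
  have "v (N \<pi>) = a * int p + b * int m"
    unfolding \<pi>_def using tE by (subst mult) (auto simp: powi N_y val_f_eq val_N_F)
  then have "v (N \<pi>) = 1" using ab by simp
  moreover have "\<pi> \<in> E" "\<pi> \<noteq> 0" using tE by (auto simp: \<pi>_def intro!: E.mult_mem E.power_int_mem)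
  moreover have "min (v (N z)) (v (N w)) \<le> v (N (z + w))"
    if "z \<in> E" "w \<in> E" "z \<noteq> 0" "w \<noteq> 0" "z + w \<noteq> 0" for z w
  proof -
    define s where "s = min (v (N z)) (v (N w))"
    have "z \<in> W s" "w \<in> W s" using that W_iff_val_N[of _ s] by (auto simp: val_ge_def s_def)
    then have "z + w \<in> W s" by (rule W_add)
    then show ?thesis using that W_iff_val_N[of "z + w" s] by (auto simp: val_ge_def s_def)
  qed
  ultimately have "discrete_valuation E (\<lambda>z. v (N z)) \<pi>"
    by unfold_locales (auto simp: mult)
  then show ?thesis ..
qed

subsection \<open>Units of level \<open>m\<close> that are not norms\<close>

text \<open>
  Let \<open>N z\<close> be close to \<open>1\<close> and let \<open>z - 1\<close> have exact weight \<open>r\<close>. The level of \<open>N z - 1\<close> is \<open>r\<close> if \<open>r < m\<close> and above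
  \<open>m\<close> if \<open>r > m\<close>. If \<open>r = m\<close>, then \<open>z - 1\<close> has leading term \<open>(\<gamma> / f) y\<^sup>p\<^sup>-\<^sup>1\<close>, and \<open>N z\<close> is
  \<open>1 + (\<gamma>\<^sup>p - \<gamma>) / f\<close> up to level \<open>m + 1\<close>.
\<close>

lemma norm_obstruction:
  "\<exists>a\<in>F. V.vge (int m) a \<and> (\<forall>z\<in>E. \<not> V.vge (int m + 1) (N z - (1 + a)))"
proof -
  obtain a0 where a0: "a0 \<in> F" "V.vge 0 a0" "\<And>c. c \<in> F \<Longrightarrow> V.vge 0 c \<Longrightarrow> \<not> V.vge 1 (c ^ p - c - a0)"
    using V.artin_schreier_residue_not_surj[OF prime_p] by blast
  \<comment> \<open>The residue missed by the Artin-Schreier map, moved to level \<open>m\<close> by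
    the factor \<open>1 / f\<close>.\<close>
  define a where "a = a0 * inverse f"
  have invf: "inverse f \<in> F" "v (inverse f) = int m" "V.vge (int m) (inverse f)"
    using V.val_inverse[of f] val_f_eq by (auto simp: val_ge_def)
  have a: "a \<in> F" "V.vge (int m) a"
    using a0 invf V.vge_mult0[of a0 "inverse f" "int m"] by (auto simp: a_def)
  have key: False if \<gamma>: "\<gamma> \<in> F" "V.vge 0 \<gamma>" and close: "V.vge (int m + 1) ((\<gamma> ^ p - \<gamma>) * inverse f - a)" for \<gamma>
  proof -
    have "V.vge ((int m + 1) + - int m) (((\<gamma> ^ p - \<gamma>) * inverse f - a) * f)"
      using \<gamma>(1) a invf close by (intro V.vge_mult) (auto simp: val_ge_def val_f_eq)
    moreover have "((\<gamma> ^ p - \<gamma>) * inverse f - a) * f = \<gamma> ^ p - \<gamma> - a0"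
      by (simp add: a_def left_diff_distrib mult.assoc)
    ultimately have "V.vge 1 (\<gamma> ^ p - \<gamma> - a0)" by simp
    then show False using a0(3) \<gamma> by blast
  qed
  have pm: "int (p - 1) = int p - 1" using p_gt_0 by (simp add: of_nat_diff)
  have "\<not> V.vge (int m + 1) (N z - (1 + a))" if z: "z \<in> E" for z
  proof
    assume close: "V.vge (int m + 1) (N z - (1 + a))"
    have NzF: "N z \<in> F" using z by (rule N_mem)
    have "V.vge (int m) (N z - (1 + a))" using close by (rule val_ge_mono) simp
    from V.vge_add[OF _ a(1) this a(2)] NzF a(1)
    have closem: "V.vge (int m) (N z - 1)" by (auto simp: F.diff_mem F.add_mem)
    have close1: "V.vge 1 (N z - 1)" using closem by (rule val_ge_mono) (use m_pos in simp)
    have vNz: "N z \<noteq> 0" "v (N z) = 0"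
      using V.val_eq_of_close[OF NzF _ _ close1] by auto
    then have z0: "z \<noteq> 0" by auto
    obtain i c b' r where lead: "i < p" "c = coord z i" "c \<in> F" "c \<noteq> 0" "r = int p * v c - int m * int i"
      "z = c * y ^ i * (1 + b')" "b' \<in> W 1" "v (N z) = r"
      using leading_monomial[OF z z0] by metis
    \<comment> \<open>\<open>N z\<close> is a unit, so the leading term of \<open>z\<close> has
      weight \<open>0\<close>; as \<open>p\<close> does not divide \<open>m\<close>, this forces
      \<open>i = 0\<close> and a unit \<open>c\<close>.\<close>
    have eq0: "int p * v c = int m * int i" using lead(5,8) vNz by simp
    then have "int p dvd int m * int i" by (metis dvd_triv_left)
    then have "p dvd m * i" by (metis of_nat_dvd_iff of_nat_mult)
    then have "p dvd i" using prime_dvd_multD[OF prime_p] p_not_dvd_m by blast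
    then have i0: "i = 0" using lead(1) by (auto dest: dvd_imp_le)
    have vc: "v c = 0" using eq0 i0 p_gt_0 by simp
    have zc: "z = c * (1 + b')" using lead(6) i0 by simp
    have b'E: "1 + b' \<in> E" "b' \<in> E" using W_E[OF lead(7)] by auto
    have Nb': "N (1 + b') \<in> F" "V.vge 1 (N (1 + b') - 1)" using N_mem[OF b'E(1)] N_one_plus_close[OF lead(7)] by auto
    have Nz: "N z = c ^ p * N (1 + b')" using lead(3) b'E by (simp add: zc N_mult F_E N_F)
    have "V.vge 1 (c ^ p * (N (1 + b') - 1))"
      using lead(3) vc Nb' by (intro V.vge_mult0 V.vge_power0) (auto simp: val_ge_def)
    then have "V.vge 1 (N z - c ^ p)" by (simp add: Nz algebra_simps)
    from V.vge_diff[OF _ _ close1 this] have "V.vge 1 ((N z - 1) - (N z - c ^ p))"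
      using NzF lead(3) by (auto simp: F.diff_mem F.power_mem)
    \<comment> \<open>Injectivity of Frobenius on residues: \<open>c ^ p\<close> close to
      \<open>1\<close> makes \<open>c\<close> close to \<open>1\<close>, so that
      \<open>z - 1\<close> has positive weight.\<close>
    moreover have "(N z - 1) - (N z - c ^ p) = (c - 1) ^ p"
    proof -
      have "((c - 1) + 1) ^ p = (c - 1) ^ p + 1 ^ p"
        by (rule freshmans_dream) (simp_all add: prime_p CHAR_p)
      then show ?thesis by simp
    qed
    ultimately have cp: "V.vge 1 ((c - 1) ^ p)" by simp
    have c1: "V.vge 1 (c - 1)"
    proof (rule ccontr)
      assume "\<not> V.vge 1 (c - 1)"
      then have n: "c - 1 \<noteq> 0" "v (c - 1) \<le> 0" by (auto simp: val_ge_def)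
      then have "v ((c - 1) ^ p) \<le> 0" using lead(3) by (simp add: V.val_power F.diff_mem mult_nonneg_nonpos)
      then show False using cp n by (simp add: val_ge_def)
    qed
    define b where "b = z - 1"
    have bE: "b \<in> E" using z by (auto simp: b_def)
    have "c \<in> S 0" using lead(3) vc by (simp add: S_def)
    then have "c * b' \<in> W (0 + 1)" using lead(3,7) W_F[of c 0] by (intro W_mult) auto
    moreover have "c - 1 \<in> S (int p * 1)" using c1 lead(3) S_iff_vge[of "c - 1" 1] by auto
    then have "c - 1 \<in> S 1" by (rule S_mono) (use p_gt_0 in simp)
    then have "c - 1 \<in> W 1" using W_F[of "c - 1" 1] lead(3) by auto
    ultimately have "c * b' + (c - 1) \<in> W 1" using W_add by simp
    then have b1: "b \<in> W 1" by (simp add: b_def zc algebra_simps)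
    have zb: "z = 1 + b" by (simp add: b_def)
    have memb: "Tr b \<in> F" "N b \<in> F" using bE by (auto intro: Tr_mem N_mem)
    \<comment> \<open>If \<open>N z\<close> agreed with \<open>1\<close> up to level
      \<open>m + 1\<close>, then \<open>\<gamma> = 0\<close> would solve the excluded
      congruence.\<close>
    have triv: False if small: "V.vge (int m + 1) (N z - 1)"
    proof -
      from V.vge_diff[OF _ _ small close] have "V.vge (int m + 1) ((N z - 1) - (N z - (1 + a)))"
        using NzF a(1) by auto
      then have "V.vge (int m + 1) a" by simp
      from V.vge_minus[OF a(1) this] have "V.vge (int m + 1) ((0 ^ p - 0) * inverse f - a)"
        using p_gt_0 by (simp add: zero_power)
      then show False using key[of 0] by simp
    qed
    show False
    proof (cases "b = 0")
      case True
      then show False using triv zb by simp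
    next
      case False
      obtain i c b2 r where lb: "i < p" "c = coord b i" "c \<in> F" "c \<noteq> 0" "r = int p * v c - int m * int i"
        "b = c * y ^ i * (1 + b2)" "b2 \<in> W 1" "\<And>s. b \<in> W s \<longleftrightarrow> s \<le> r" "v (N b) = r"
        using leading_monomial[OF bE False] by metis
      have r1: "1 \<le> r" using lb(8) b1 by blast
      have br: "b \<in> W r" using lb(8) by blast
      have Trb: "Tr b \<in> S (r + int m * int (p - 1))" by (rule W_Tr[OF br])
      have Rb: "N z - (1 + Tr b + N b) \<in> S (2 * r + int m * int (p - 1))"
        unfolding zb using br r1 by (intro N_one_plus) auto
      have Nb0: "N b \<noteq> 0" using bE False by (simp add: N_eq_0_iff)
      consider "r < int m" | "r = int m" | "r > int m" by linarith
      then show False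
      proof cases
        case 1
        \<comment> \<open>Below weight \<open>m\<close> the term \<open>N b\<close>, of valuation
          \<open>r\<close>, dominates trace and error, which contradicts
          \<open>closem\<close>.\<close>
        have lt: "int p * r < r + int m * int (p - 1)"
        proof -
          have "(int p - 1) * r < (int p - 1) * int m" using 1 p_ge_2 by (intro mult_strict_left_mono) auto
          then show ?thesis unfolding pm by (simp add: algebra_simps)
        qed
        have "V.vge (r + 1) (Tr b)" using Trb by (rule S_imp_vge) (use lt in simp)
        moreover have "V.vge (r + 1) (N z - (1 + Tr b + N b))"
          using Rb by (rule S_imp_vge) (use lt r1 in simp)
        ultimately have "V.vge (r + 1) ((N z - (1 + Tr b + N b)) + Tr b)"
          using NzF memb by (intro V.vge_add) auto
        moreover have "(N z - (1 + Tr b + N b)) + Tr b = (N z - 1) - N b" by simp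
        ultimately have "V.vge (r + 1) ((N z - 1) - N b)" by (simp only:)
        from V.val_eq_of_close[OF _ memb(2) Nb0 this] have "N z - 1 \<noteq> 0" "v (N z - 1) = r"
          using NzF lb(9) by auto
        then show False using closem 1 by (simp add: val_ge_def)
      next
        case 2
        \<comment> \<open>At weight \<open>m\<close>, divisibility by \<open>p\<close> leaves only
          \<open>i = p - 1\<close>, and then \<open>v c = m\<close>: here trace and norm are of the
          same size.\<close>
        have "int p * v c = int m * (int i + 1)" using 2 lb(5) by (simp add: algebra_simps)
        then have "int p dvd int (m * (i + 1))" by (metis dvd_triv_left of_nat_1 of_nat_add of_nat_mult)
        then have "p dvd m * (i + 1)" by (simp only: of_nat_dvd_iff)
        then have "p dvd i + 1" using prime_dvd_multD[OF prime_p] p_not_dvd_m by blast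
        then have "p \<le> i + 1" by (rule dvd_imp_le) simp
        then have i: "i = p - 1" using lb(1) by simp
        have vc: "v c = int m"
        proof -
          have "int p * v c = int p * int m" using \<open>int p * v c = int m * (int i + 1)\<close> i p_gt_0 by (simp add: pm)
          then show ?thesis using p_gt_0 by simp
        qed
        have Trc: "Tr b = - c" using Tr_eq[OF bE] lb(2) i by simp
        have b2E: "1 + b2 \<in> E" "b2 \<in> E" using W_E[OF lb(7)] by auto
        have Nb2: "N (1 + b2) \<in> F" "V.vge 1 (N (1 + b2) - 1)" using N_mem[OF b2E(1)] N_one_plus_close[OF lb(7)] by auto
        \<comment> \<open>The norm of the leading term \<open>c * y ^ (p - 1)\<close>.\<close>
        define g where "g = c ^ p * f ^ (p - 1)"
        have gF: "g \<in> F" unfolding g_def using lb(3) by (intro F.mult_mem F.power_mem f_mem)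
        have vg: "v g = int m" "g \<noteq> 0"
        proof -
          have "v g = int p * int m - int m * int (p - 1)"
            using lb(3,4) vc by (simp add: g_def V.val_mult V.val_power val_f_eq F.power_mem)
          then show "v g = int m" unfolding pm by (simp add: algebra_simps)
        qed (use lb(4) in \<open>simp add: g_def\<close>)
        have "N (c * y ^ i) = g" unfolding i g_def using lb(3)
          by (simp add: N_mult F_E E.power_mem N_F N_power N_y)
        then have "N b = g * N (1 + b2)"
          using N_mult[OF monom_mem[OF lb(3)] b2E(1), of i] lb(6) by (simp only:)
        then have "N b - g = g * (N (1 + b2) - 1)" by (simp add: algebra_simps)
        moreover have "V.vge (int m + 1) (g * (N (1 + b2) - 1))"
          using gF vg Nb2 by (intro V.vge_mult) (auto simp: val_ge_def)
        ultimately have 1: "V.vge (int m + 1) (N b - g)" by simp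
        have 2: "V.vge (int m + 1) (N z - (1 + Tr b + N b))"
        proof (rule S_imp_vge[OF Rb])
          show "int p * (int m + 1 - 1) < 2 * r + int m * int (p - 1)"
            unfolding pm using \<open>r = int m\<close> m_pos by (simp add: algebra_simps)
        qed
        have mem: "N b - g \<in> F" "N z - (1 + Tr b + N b) \<in> F" "N z - (1 + a) \<in> F"
          using memb gF NzF a(1) by auto
        have "V.vge (int m + 1) ((N z - (1 + a)) - ((N z - (1 + Tr b + N b)) + (N b - g)))"
          by (intro V.vge_diff V.vge_add 1 2 close mem F.add_mem)
        moreover have "(N z - (1 + a)) - ((N z - (1 + Tr b + N b)) + (N b - g)) = (g - c) - a"
          by (simp add: Trc)
        ultimately have fin: "V.vge (int m + 1) ((g - c) - a)" by (simp only:)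
        \<comment> \<open>This scaling turns \<open>g - c\<close> into
          \<open>(\<gamma> ^ p - \<gamma>) / f\<close>, the excluded form; \<open>\<gamma>\<close>
          is integral because \<open>v c = m = - v f\<close>.\<close>
        define \<gamma> where "\<gamma> = c * f"
        have "\<gamma> ^ p * inverse f = g"
        proof -
          have "f ^ p = f ^ (p - 1) * f" using p_gt_0 by (metis power_minus_mult)
          then show ?thesis by (simp add: \<gamma>_def g_def power_mult_distrib)
        qed
        moreover have "\<gamma> * inverse f = c" by (simp add: \<gamma>_def)
        ultimately have "(\<gamma> ^ p - \<gamma>) * inverse f = g - c" by (simp add: left_diff_distrib)
        moreover have "\<gamma> \<in> F" using lb(3) by (auto simp: \<gamma>_def)
        moreover have "V.vge 0 \<gamma>"
          using lb(3,4) vc by (simp add: \<gamma>_def val_ge_def V.val_mult val_f_eq)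
        ultimately show False using key[of \<gamma>] fin by simp
      next
        case 3
        \<comment> \<open>Above weight \<open>m\<close>, trace, norm and error all reach level
          \<open>m + 1\<close>.\<close>
        have "V.vge (int m + 1) (Tr b)"
        proof (rule S_imp_vge[OF Trb])
          show "int p * (int m + 1 - 1) < r + int m * int (p - 1)"
            unfolding pm using 3 by (simp add: algebra_simps)
        qed
        moreover have "V.vge (int m + 1) (N b)" using lb(9) 3 by (simp add: val_ge_def)
        moreover have "V.vge (int m + 1) (N z - (1 + Tr b + N b))"
        proof (rule S_imp_vge[OF Rb])
          show "int p * (int m + 1 - 1) < 2 * r + int m * int (p - 1)"
            unfolding pm using 3 by (simp add: algebra_simps)
        qed
        ultimately have "V.vge (int m + 1) ((N z - (1 + Tr b + N b)) + (Tr b + N b))"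
          using NzF memb by (intro V.vge_add) auto
        moreover have "(N z - (1 + Tr b + N b)) + (Tr b + N b) = N z - 1" by simp
        ultimately have "V.vge (int m + 1) (N z - 1)" by (simp only:)
        then show False by (rule triv)
      qed
    qed
  qed
  with a show ?thesis by blast
qed

end

section \<open>Local discriminants and conductors\<close>

text \<open>\<open>restrict\<close> appears because \<open>Bij E\<close> consists of extensional
  functions. Injectivity turns sums and products over the Galois group into those over
  \<open>j < p\<close>.\<close>

locale galois_artin_schreier = artin_schreier_valuation E F \<sigma> p y "ord_at \<O>" t m
  for E F :: "'a::alg_closed_field set" and \<sigma> p y \<O> t m +
  assumes O_place: "\<O> \<in> places F"
    and gal: "carrier (gal_group F E) = (\<lambda>i. restrict (\<sigma> ^^ i) E) ` {..<p}"
    and gal_inj: "inj_on (\<lambda>i. restrict (\<sigma> ^^ i) E) {..<p}"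
begin

sublocale O: place F \<O>
  by unfold_locales (rule O_place)

lemma gal_trace_eq: "z \<in> E \<Longrightarrow> gal_trace F E z = Tr z"
  unfolding gal_trace_def gal Tr_def by (subst sum.reindex[OF gal_inj]) simp

lemma gal_norm_eq: "z \<in> E \<Longrightarrow> (\<Prod>\<tau>\<in>carrier (gal_group F E). \<tau> z) = N z"
  unfolding gal N_def by (subst prod.reindex[OF gal_inj]) simp

lemma O_iff_S: "c \<in> F \<Longrightarrow> c \<in> \<O> \<longleftrightarrow> c \<in> S 0"
  using O.O_iff_ord[of c] S_iff_vge[of c 0] by simp

text \<open>The characteristic polynomial of \<open>z\<close> is a monic equation for \<open>z\<close> over \<open>\<O>\<close>.\<close>

lemma W_integral: "z \<in> W 0 \<Longrightarrow> z \<in> integral_closure \<O> E"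
proof (cases "z = 0")
  case True
  assume "z \<in> W 0"
  have "lead_coeff [:0, 1:] = (1::'a)" by simp
  moreover have "set (coeffs [:0, 1::'a:]) \<subseteq> \<O>" using O.O_closed(1,2) by simp
  moreover have "poly [:0, 1:] z = 0" using True by simp
  ultimately show ?thesis using True unfolding integral_closure_def by blast
next
  case False
  assume z: "z \<in> W 0"
  have e: "esym z j \<in> \<O>" if jp: "j \<le> p" for j
  proof -
    have "esym z j \<in> S 0"
    proof -
      consider "j = 0" | "0 < j" "j < p" | "j = p" using jp by linarith
      then show ?thesis
      proof cases
        case 1 then show ?thesis by (simp add: esym_0 S_def)
      next
        case 2
        then have "esym z j \<in> S (int j * 0 + int m * int (p - 1))" by (intro esym_bound z)
        then show ?thesis by (rule S_mono) simp
      next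
        case 3
        then show ?thesis
          using W_N[OF z] S_iff_vge[of "N z" 0] N_mem[OF W_E[OF z]] by (simp add: esym_p)
      qed
    qed
    then show ?thesis using O_iff_S[of "esym z j"] S_F by blast
  qed
  define g where "g = (\<Sum>j\<le>p. monom ((-1) ^ j * esym z j) (p - j))"
  have cg: "coeff g i = (if i \<le> p then (-1) ^ (p - i) * esym z (p - i) else 0)" for i
  proof -
    have "coeff g i = (\<Sum>j\<le>p. if j = p - i \<and> i \<le> p then (-1) ^ j * esym z j else 0)"
      by (auto simp: g_def coeff_sum intro!: sum.cong)
    then show ?thesis by (cases "i \<le> p") (auto simp: sum.delta)
  qed
  have "degree g = p"
    by (rule antisym[OF degree_le le_degree]) (auto simp: cg esym_0)
  then have lead: "lead_coeff g = 1" by (simp add: cg esym_0)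
  have "c \<in> \<O>" if "c \<in> set (coeffs g)" for c
  proof -
    have "c \<in> range (coeff g)" using that range_coeff[of g] by simp
    then obtain i where i: "c = coeff g i" by blast
    have s: "(-1) ^ j \<in> \<O>" for j
      using O.O_closed(2) O.O_closed(5)[OF O.O_closed(2)] by (cases "even j") auto
    show ?thesis unfolding i cg using O.O_closed(1) e s O.O_closed(4) by simp
  qed
  moreover have "poly g z = 0"
  proof -
    let ?Q = "\<Prod>j<p. [:1, (\<sigma> ^^ j) z:]"
    have "poly g z = (\<Sum>j\<le>p. (-1) ^ j * esym z j * z ^ (p - j))"
      by (simp add: g_def poly_sum poly_monom)
    also have "\<dots> = (\<Sum>j\<le>p. z ^ p * (esym z j * (- inverse z) ^ j))"
    proof (rule sum.cong[OF refl])
      fix j assume "j \<in> {..p}"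
      then have "z ^ (p - j) = z ^ p * inverse z ^ j"
        using False by (simp add: power_diff power_inverse divide_inverse)
      then show "(-1) ^ j * esym z j * z ^ (p - j) = z ^ p * (esym z j * (- inverse z) ^ j)"
        by (simp add: power_minus[of "inverse z"])
    qed
    also have "\<dots> = z ^ p * poly ?Q (- inverse z)"
      using coeff_prod_linear[of "\<lambda>j. (\<sigma> ^^ j) z" p]
      by (simp add: poly_altdef_le[of ?Q p] esym_def sum_distrib_left)
    \<comment> \<open>The factor for \<open>j = 0\<close> is \<open>1 + z * (- inverse z)\<close>.
      This use of \<open>inverse z\<close> is why \<open>z = 0\<close> was settled
      separately.\<close>
    also have "poly ?Q (- inverse z) = 0"
      unfolding poly_prod using p_gt_0 False by (intro prod_zero bexI[of _ 0]) auto
    finally show ?thesis by simp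
  qed
  ultimately show ?thesis using W_E[OF z] lead unfolding integral_closure_def by blast
qed

subsection \<open>Discriminants of bases\<close>

definition coord_mat :: "'a list \<Rightarrow> 'a mat"
  where "coord_mat bs = mat p p (\<lambda>(i, j). coord (bs ! i) j)"

definition trace_mat :: "'a mat"
  where "trace_mat = mat p p (\<lambda>(i, j). Tr (y ^ (i + j)))"

text \<open>The entries of \<open>trace_mat\<close> above the antidiagonal vanish and those on it are \<open>-1\<close>.\<close>

lemma det_trace_mat: "det trace_mat * det trace_mat = 1"
proof -
  \<comment> \<open>Reversing the columns makes the matrix lower triangular with diagonal
    \<open>-1\<close>. Working with squares avoids the sign of the reversal.\<close>
  define J :: "'a mat" where "J = mat p p (\<lambda>(i, j). if j = p - 1 - i then 1 else 0)"
  have JJ: "J * J = 1\<^sub>m p"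
  proof (rule eq_matI)
    fix i j assume "i < dim_row (1\<^sub>m p :: 'a mat)" "j < dim_col (1\<^sub>m p :: 'a mat)"
    then have ij: "i < p" "j < p" by auto
    then have "(J * J) $$ (i, j) = (\<Sum>k = 0..<p. if k = p - 1 - i then (if j = p - 1 - k then 1 else 0) else 0)"
      by (simp add: J_def scalar_prod_def if_distrib[of "\<lambda>x. x * _"] cong: if_cong)
    also have "\<dots> = (if j = p - 1 - (p - 1 - i) then 1 else 0)" using ij by (simp add: sum.delta)
    finally show "(J * J) $$ (i, j) = 1\<^sub>m p $$ (i, j)" using ij by auto
  qed (auto simp: J_def)
  have "det J * det J = det (J * J)" by (rule det_mult[symmetric, of _ p]) (auto simp: J_def)
  then have dJ: "det J * det J = 1" by (simp add: JJ)
  have TJ: "(trace_mat * J) $$ (i, j) = Tr (y ^ (i + (p - 1 - j)))" if "i < p" "j < p" for i j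
  proof -
    have "(trace_mat * J) $$ (i, j) = (\<Sum>k = 0..<p. Tr (y ^ (i + k)) * (if j = p - 1 - k then 1 else 0))"
      using that by (simp add: trace_mat_def J_def scalar_prod_def)
    also have "\<dots> = (\<Sum>k = 0..<p. if k = p - 1 - j then Tr (y ^ (i + k)) else 0)"
      using that by (intro sum.cong) auto
    also have "\<dots> = Tr (y ^ (i + (p - 1 - j)))" using that by (simp add: sum.delta)
    finally show ?thesis .
  qed
  have "det (trace_mat * J) = prod_list (diag_mat (trace_mat * J))"
  proof (rule det_lower_triangular)
    show "(trace_mat * J) $$ (i, j) = 0" if "i < j" "j < p" for i j
      using that by (subst TJ) (auto simp: Tr_y_power)
  qed (auto simp: trace_mat_def J_def)
  also have "\<dots> = (\<Prod>i = 0..<p. (trace_mat * J) $$ (i, i))"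
    by (simp add: prod_list_diag_prod) (simp add: trace_mat_def J_def)
  also have "\<dots> = (\<Prod>i = 0..<p. -1)"
    by (intro prod.cong refl) (use p_gt_0 in \<open>simp add: TJ Tr_y_power\<close>)
  finally have "det (trace_mat * J) = (-1) ^ p" by simp
  moreover have "det (trace_mat * J) = det trace_mat * det J"
    by (rule det_mult[of _ p]) (auto simp: trace_mat_def J_def)
  ultimately have "det trace_mat * det J = (-1) ^ p" by simp
  then have "(det trace_mat * det J) * (det trace_mat * det J) = 1"
    by (simp flip: power_add)
  then have "(det trace_mat * det trace_mat) * (det J * det J) = 1" by (simp add: mult_ac)
  then show ?thesis using dJ by simp
qed

text \<open>The Gram matrix of \<open>bs\<close> is \<open>M * T * M^T\<close>, with the coordinate
  matrix \<open>M\<close> and the trace matrix \<open>T\<close> of the powers of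
  \<open>y\<close>.\<close>

lemma basis_discriminant_eq:
  assumes bs: "set bs \<subseteq> E" "length bs = p"
  shows "basis_discriminant F E bs = det (coord_mat bs) * det (coord_mat bs) * det trace_mat"
proof -
  let ?M = "coord_mat bs"
  have car [simp]: "?M \<in> carrier_mat p p" "trace_mat \<in> carrier_mat p p"
    by (auto simp: coord_mat_def trace_mat_def)
  have bE: "bs ! i \<in> E" if "i < p" for i using bs that by auto
  have "mat (length bs) (length bs) (\<lambda>(i, j). gal_trace F E (bs ! i * bs ! j)) = ?M * trace_mat * transpose_mat ?M"
  proof (rule eq_matI)
    fix i j assume "i < dim_row (?M * trace_mat * transpose_mat ?M)" "j < dim_col (?M * trace_mat * transpose_mat ?M)"
    then have ij: "i < p" "j < p" by (auto simp: coord_mat_def)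
    let ?a = "coord (bs ! i)" and ?b = "coord (bs ! j)"
    have cF: "?a k \<in> F" "?b k \<in> F" for k using coord(1) bE ij by auto
    have "Tr (bs ! i * bs ! j) = Tr ((\<Sum>k<p. ?a k * y ^ k) * (\<Sum>l<p. ?b l * y ^ l))"
      using coord(2)[OF bE[OF ij(1)]] coord(2)[OF bE[OF ij(2)]] by simp
    also have "(\<Sum>k<p. ?a k * y ^ k) * (\<Sum>l<p. ?b l * y ^ l) = (\<Sum>k<p. \<Sum>l<p. (?a k * ?b l) * y ^ (k + l))"
      by (subst sum_product, intro sum.cong refl) (simp add: power_add mult_ac)
    also have "Tr \<dots> = (\<Sum>k<p. Tr (\<Sum>l<p. (?a k * ?b l) * y ^ (k + l)))"
      by (rule Tr_sum) (intro E.sum_mem monom_mem F.mult_mem cF)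
    also have "\<dots> = (\<Sum>k<p. \<Sum>l<p. Tr ((?a k * ?b l) * y ^ (k + l)))"
      by (intro sum.cong refl Tr_sum monom_mem F.mult_mem cF)
    also have "\<dots> = (\<Sum>k<p. \<Sum>l<p. ?a k * ?b l * Tr (y ^ (k + l)))"
      by (intro sum.cong refl Tr_F_mult F.mult_mem cF E.power_mem y_mem)
    also have "\<dots> = (\<Sum>l<p. \<Sum>k<p. ?a k * Tr (y ^ (k + l)) * ?b l)"
      by (subst sum.swap) (simp add: mult_ac)
    also have "\<dots> = (?M * trace_mat * transpose_mat ?M) $$ (i, j)"
      using ij by (simp add: coord_mat_def trace_mat_def scalar_prod_def atLeast0LessThan sum_distrib_right)
    finally show "mat (length bs) (length bs) (\<lambda>(i, j). gal_trace F E (bs ! i * bs ! j)) $$ (i, j) =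
        (?M * trace_mat * transpose_mat ?M) $$ (i, j)"
      using ij bs(2) gal_trace_eq[of "bs ! i * bs ! j"] bE by (simp add: E.mult_mem)
  qed (use bs(2) in \<open>auto simp: coord_mat_def\<close>)
  then have "basis_discriminant F E bs = det (?M * trace_mat * transpose_mat ?M)"
    by (simp add: basis_discriminant_def)
  also have "\<dots> = det (?M * trace_mat) * det (transpose_mat ?M)"
    by (rule det_mult[of _ p]) (use mult_carrier_mat[OF car] in auto)
  also have "det (?M * trace_mat) = det ?M * det trace_mat"
    by (rule det_mult[of _ p]) auto
  also have "det (transpose_mat ?M) = det ?M" by (rule det_transpose[of _ p]) simp
  finally show ?thesis by (simp add: mult_ac)
qed

lemma det_mem:
  assumes "A \<in> carrier_mat n n" "\<And>i j. i < n \<Longrightarrow> j < n \<Longrightarrow> A $$ (i, j) \<in> F"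
  shows "det A \<in> F"
  unfolding det_def'[OF assms(1)]
proof (intro F.sum_mem F.mult_mem F.prod_mem)
  fix \<pi> :: "nat \<Rightarrow> nat" assume "\<pi> \<in> {\<pi>. \<pi> permutes {0..<n}}"
  then have \<pi>: "\<pi> permutes {0..<n}" by simp
  show "signof \<pi> \<in> F" by (simp add: sign_def F.uminus_mem)
  show "A $$ (i, \<pi> i) \<in> F" if "i \<in> {0..<n}" for i
    using that permutes_in_image[OF \<pi>, of i] by (intro assms(2)) auto
qed

lemma ord_basis_discriminant:
  assumes bs: "set bs \<subseteq> E" "length bs = p" and nz: "det (coord_mat bs) \<noteq> 0"
  shows "ord_at \<O> (basis_discriminant F E bs) = 2 * ord_at \<O> (det (coord_mat bs))"
proof -
  have bE: "bs ! i \<in> E" if "i < p" for i using bs that by (metis nth_mem subsetD)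
  have M: "det (coord_mat bs) \<in> F"
    by (rule det_mem[of _ p]) (auto simp: coord_mat_def intro!: coord(1) bE)
  have T: "det trace_mat \<in> F"
    by (rule det_mem[of _ p]) (auto simp: trace_mat_def intro!: Tr_mem)
  have Tnz: "det trace_mat \<noteq> 0" using det_trace_mat by auto
  have "2 * ord_at \<O> (det trace_mat) = 0"
    using V.val_mult[OF T T Tnz Tnz] det_trace_mat by simp
  then show ?thesis
    unfolding basis_discriminant_eq[OF bs] using M T nz Tnz by (simp add: V.val_mult F.mult_mem)
qed

lemma monomial_basis:
  assumes F: "subfield F \<Omega>" and c: "\<And>i. i < p \<Longrightarrow> c i \<in> F" "\<And>i. i < p \<Longrightarrow> c i \<noteq> 0"
  defines "bs \<equiv> map (\<lambda>i. c i * y ^ i) [0..<p]"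
  shows "ring.independent \<Omega> F bs" "ring.Span \<Omega> F bs = E"
proof -
  interpret R: ring "\<Omega> :: 'a ring" by (rule ring_from_type_algebra)
  have zero: "\<zero>\<^bsub>\<Omega>\<^esub> = (0::'a)" by (simp add: ring_of_type_algebra_def)
  have car: "set bs \<subseteq> carrier \<Omega>" by (simp add: ring_of_type_algebra_def)
  have len: "length bs = p" by (simp add: bs_def)
  have comb: "R.combine Ks bs = (\<Sum>i<p. (Ks ! i * c i) * y ^ i)" if "length Ks = p" for Ks
    using combine_ring_of_type[of Ks bs] that by (simp add: bs_def mult_ac)
  show "R.independent F bs"
  proof (rule ccontr)
    assume "\<not> R.independent F bs"
    then obtain Ks where Ks: "length Ks = length bs" "R.combine Ks bs = \<zero>\<^bsub>\<Omega>\<^esub>" "set Ks \<subseteq> F" "set Ks \<noteq> {\<zero>\<^bsub>\<Omega>\<^esub>}"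
      using R.dependent_imp_non_trivial_combine[OF F car] by blast
    have "Ks ! i = 0" if i: "i < p" for i
    proof -
      have "Ks ! i * c i = 0"
      proof (rule power_y_independent[OF _ _ i])
        show "(\<Sum>i<p. (Ks ! i * c i) * y ^ i) = 0" using comb[of Ks] Ks(1,2) len zero by simp
        show "Ks ! j * c j \<in> F" if "j < p" for j using that Ks(1,3) len c(1) by (intro F.mult_mem) auto
      qed
      then show ?thesis using c(2)[OF i] by simp
    qed
    then have "set Ks = {0}" using Ks(1) len p_gt_0 by (force simp: set_conv_nth)
    then show False using Ks(4) zero by simp
  qed
  show "R.Span F bs = E"
  proof (intro equalityI subsetI)
    fix z assume "z \<in> R.Span F bs"
    then obtain Ks where Ks: "set Ks \<subseteq> F" "length Ks = p" "z = R.combine Ks bs"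
      using R.Span_mem_iff_length_version[OF F car] len by auto
    then show "z \<in> E" unfolding Ks(3) comb[OF Ks(2)] using c(1)
      by (intro E.sum_mem monom_mem F.mult_mem) auto
  next
    fix z assume z: "z \<in> E"
    define Ks where "Ks = map (\<lambda>i. coord z i / c i) [0..<p]"
    have "z = (\<Sum>i<p. (Ks ! i * c i) * y ^ i)"
      using coord(2)[OF z] c(2) by (simp add: Ks_def)
    then have "z = R.combine Ks bs" using comb[of Ks] by (simp add: Ks_def)
    moreover have "set Ks \<subseteq> F" using coord(1)[OF z] c(1) by (auto simp: Ks_def intro!: F.divide_mem)
    moreover have "length Ks = length bs" by (simp add: Ks_def len)
    ultimately show "z \<in> R.Span F bs"
      using R.Span_mem_iff_length_version[OF F car] by blast
  qed
qed

text \<open>For the determinant: the matrix expressing the powers of \<open>y\<close> through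
  \<open>bs\<close> is a left inverse of \<open>coord_mat bs\<close>.\<close>

lemma basis_props:
  assumes F: "subfield F \<Omega>" and ind: "ring.independent \<Omega> F bs" and span: "ring.Span \<Omega> F bs = E"
  shows "set bs \<subseteq> E" "length bs = p" "det (coord_mat bs) \<noteq> 0"
proof -
  interpret R: ring "\<Omega> :: 'a ring" by (rule ring_from_type_algebra)
  have car: "set bs \<subseteq> carrier \<Omega>" by (simp add: ring_of_type_algebra_def)
  show bE: "set bs \<subseteq> E" using R.Span_base_incl[OF F car] span by simp
  have "R.dimension (length bs) F E" by (rule R.dimensionI[OF F ind span])
  moreover have "R.dimension (length (map (\<lambda>i. 1 * y ^ i) [0..<p])) F E"
    by (rule R.dimensionI[OF F monomial_basis[OF F]]) auto
  ultimately show len: "length bs = p" using R.dimension_is_inj[OF F] by fastforce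
  have "\<forall>j<p. \<exists>Ks. set Ks \<subseteq> F \<and> length Ks = p \<and> y ^ j = (\<Sum>i<p. Ks ! i * bs ! i)"
  proof (intro allI impI)
    fix j
    have "y ^ j \<in> R.Span F bs" unfolding span by (intro E.power_mem y_mem)
    then obtain Ks where "set Ks \<subseteq> F" "length Ks = length bs" "y ^ j = R.combine Ks bs"
      using R.Span_mem_iff_length_version[OF F car] by blast
    then show "\<exists>Ks. set Ks \<subseteq> F \<and> length Ks = p \<and> y ^ j = (\<Sum>i<p. Ks ! i * bs ! i)"
      using combine_ring_of_type[of Ks bs] len by (intro exI[of _ Ks]) simp
  qed
  then obtain K where K: "\<forall>j<p. set (K j) \<subseteq> F \<and> length (K j) = p \<and> y ^ j = (\<Sum>i<p. K j ! i * bs ! i)"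
    by (auto simp: choice_iff')
  have bsE: "bs ! i \<in> E" if "i < p" for i using bE len that by (metis nth_mem subsetD)
  have KF: "K j ! i \<in> F" if "j < p" "i < p" for i j using K that by (metis nth_mem subsetD)
  define A where "A = mat p p (\<lambda>(j, i). K j ! i)"
  have "A * coord_mat bs = 1\<^sub>m p"
  proof (rule eq_matI)
    fix j l assume "j < dim_row (1\<^sub>m p :: 'a mat)" "l < dim_col (1\<^sub>m p :: 'a mat)"
    then have jl: "j < p" "l < p" by auto
    have "(\<Sum>l<p. (\<Sum>i<p. K j ! i * coord (bs ! i) l) * y ^ l) = (\<Sum>i<p. K j ! i * (\<Sum>l<p. coord (bs ! i) l * y ^ l))"
      by (simp add: sum_distrib_right sum_distrib_left mult.assoc) (rule sum.swap)
    also have "\<dots> = (\<Sum>i<p. K j ! i * bs ! i)"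
    proof (intro sum.cong refl)
      fix i assume "i \<in> {..<p}"
      then have "bs ! i \<in> E" using bsE by simp
      then show "K j ! i * (\<Sum>l<p. coord (bs ! i) l * y ^ l) = K j ! i * bs ! i" using coord(2)[of "bs ! i"] by simp
    qed
    also have "\<dots> = y ^ j" using K jl by simp
    also have "\<dots> = (\<Sum>l<p. (if l = j then 1 else 0) * y ^ l)"
      using jl by (simp add: if_distrib[of "\<lambda>x. x * _"] sum.delta cong: if_cong)
    finally have eq: "(\<Sum>l<p. (\<Sum>i<p. K j ! i * coord (bs ! i) l) * y ^ l) = (\<Sum>l<p. (if l = j then 1 else 0) * y ^ l)" .
    have "coord (\<Sum>l<p. (\<Sum>i<p. K j ! i * coord (bs ! i) l) * y ^ l) l = (\<Sum>i<p. K j ! i * coord (bs ! i) l)"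
      by (intro coord_eqI F.sum_mem F.mult_mem) (auto intro!: KF coord(1) bsE jl)
    moreover have "coord (\<Sum>l<p. (if l = j then 1 else 0) * y ^ l) l = (if l = j then 1 else 0)"
      using jl by (intro coord_eqI) auto
    ultimately have "(\<Sum>i<p. K j ! i * coord (bs ! i) l) = (if l = j then 1 else 0)" using eq by simp
    then show "(A * coord_mat bs) $$ (j, l) = 1\<^sub>m p $$ (j, l)"
      using jl by (auto simp: A_def coord_mat_def scalar_prod_def atLeast0LessThan)
  qed (auto simp: A_def coord_mat_def)
  moreover have "det (A * coord_mat bs) = det A * det (coord_mat bs)"
    by (rule det_mult[of _ p]) (auto simp: A_def coord_mat_def)
  ultimately have "det A * det (coord_mat bs) = 1" by simp
  then show "det (coord_mat bs) \<noteq> 0" by auto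
qed

text \<open>\<open>level j\<close> is \<open>m j / p\<close> rounded up.\<close>

definition level :: "nat \<Rightarrow> nat"
  where "level j = (m * j + p - 1) div p"

lemma level_ge: "m * j \<le> p * level j"
proof -
  have "m * j + p - 1 = p * level j + (m * j + p - 1) mod p" by (simp add: level_def)
  moreover have "(m * j + p - 1) mod p \<le> p - 1" using p_gt_0 by (simp add: less_Suc_eq_le[symmetric])
  ultimately show ?thesis using p_gt_0 by linarith
qed

lemma level_less: "int p * (int (level j) - 1) < int m * int j"
proof -
  have "p * level j \<le> m * j + p - 1" by (simp add: level_def)
  then have "p * level j < m * j + p" using p_gt_0 by linarith
  then have "int (p * level j) < int (m * j + p)" by (simp only: of_nat_less_iff)
  then show ?thesis by (simp add: algebra_simps)
qed

text \<open>\<open>t ^ level i\<close> is the least power of \<open>t\<close> that brings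
  \<open>y ^ i\<close> into \<open>W 0\<close>.\<close>

definition std_basis :: "'a list"
  where "std_basis = map (\<lambda>i. t ^ level i * y ^ i) [0..<p]"

lemma std_basis_integral: "set std_basis \<subseteq> integral_closure \<O> E"
proof -
  have "t ^ level i * y ^ i \<in> W 0" for i
  proof (rule W_monom)
    have "int m * int i \<le> int p * int (level i)"
      using level_ge[of i] by (metis of_nat_le_iff of_nat_mult)
    then show "t ^ level i \<in> S (0 + int m * int i)" by (auto simp: S_def V.val_power)
  qed
  then show ?thesis by (auto simp: std_basis_def intro!: W_integral)
qed

lemma ord_std_basis: "ord_at \<O> (basis_discriminant F E std_basis) = 2 * (\<Sum>i<p. int (level i))"
proof -
  have bE: "set std_basis \<subseteq> E" by (auto simp: std_basis_def intro!: monom_mem)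
  have len: "length std_basis = p" by (simp add: std_basis_def)
  have coord_nth: "coord (std_basis ! i) j = (if j = i then t ^ level i else 0)" if "i < p" "j < p" for i j
  proof -
    have "std_basis ! i = (\<Sum>j<p. (if j = i then t ^ level i else 0) * y ^ j)"
      using that by (simp add: std_basis_def if_distrib[of "\<lambda>x. x * _"] sum.delta cong: if_cong)
    moreover have "coord (\<Sum>j<p. (if j = i then t ^ level i else 0) * y ^ j) j = (if j = i then t ^ level i else 0)"
      using that by (intro coord_eqI) auto
    ultimately show ?thesis by (simp only:)
  qed
  have "det (coord_mat std_basis) = prod_list (diag_mat (coord_mat std_basis))"
    by (rule det_lower_triangular[of p]) (auto simp: coord_mat_def coord_nth)
  also have "\<dots> = (\<Prod>i = 0..<p. t ^ level i)"
    by (simp add: prod_list_diag_prod) (simp add: coord_mat_def coord_nth)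
  finally have det: "det (coord_mat std_basis) = (\<Prod>i<p. t ^ level i)" by (simp add: atLeast0LessThan)
  then have "det (coord_mat std_basis) \<noteq> 0" by simp
  from ord_basis_discriminant[OF bE len this] show ?thesis
    unfolding det by (simp add: V.val_prod V.val_power F.power_mem)
qed

text \<open>The entries in column \<open>j\<close> have valuation at least \<open>level j\<close>,
  and each term of the Leibniz formula takes one entry from every column.\<close>

lemma det_coord_mat_vge:
  assumes "\<And>i. i < p \<Longrightarrow> bs ! i \<in> W 0"
  shows "V.vge (\<Sum>i<p. int (level i)) (det (coord_mat bs))"
proof -
  have car: "coord_mat bs \<in> carrier_mat p p" by (simp add: coord_mat_def)
  have ent: "coord (bs ! i) j \<in> F" "V.vge (int (level j)) (coord (bs ! i) j)" if "i < p" "j < p" for i j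
  proof -
    have S: "coord (bs ! i) j \<in> S (0 + int m * int j)" using assms that by (simp add: W_def)
    then show "coord (bs ! i) j \<in> F" by (rule S_F)
    from S show "V.vge (int (level j)) (coord (bs ! i) j)"
      by (rule S_imp_vge) (use level_less in simp)
  qed
  show ?thesis unfolding det_def'[OF car]
  proof (rule V.vge_sum)
    fix \<pi> :: "nat \<Rightarrow> nat" assume "\<pi> \<in> {\<pi>. \<pi> permutes {0..<p}}"
    then have \<pi>: "\<pi> permutes {0..<p}" by simp
    have \<pi>p: "\<pi> i < p" if "i < p" for i using permutes_in_image[OF \<pi>, of i] that by auto
    have sgn: "signof \<pi> \<in> F" "V.vge 0 (signof \<pi>)" by (auto simp: sign_def F.uminus_mem val_ge_def)
    have prodF: "(\<Prod>i = 0..<p. coord_mat bs $$ (i, \<pi> i)) \<in> F"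
      using ent \<pi>p by (intro F.prod_mem) (auto simp: coord_mat_def)
    show "signof \<pi> * (\<Prod>i = 0..<p. coord_mat bs $$ (i, \<pi> i)) \<in> F" using sgn prodF by (intro F.mult_mem)
    have "V.vge (\<Sum>i = 0..<p. int (level (\<pi> i))) (\<Prod>i = 0..<p. coord_mat bs $$ (i, \<pi> i))"
      using ent \<pi>p by (intro V.vge_prod) (auto simp: coord_mat_def)
    moreover have "(\<Sum>i = 0..<p. int (level (\<pi> i))) = (\<Sum>i<p. int (level i))"
      using sum.permute[OF \<pi>, of "\<lambda>i. int (level i)"] by (simp add: atLeast0LessThan)
    ultimately show "V.vge (\<Sum>i<p. int (level i)) (signof \<pi> * (\<Prod>i = 0..<p. coord_mat bs $$ (i, \<pi> i)))"
      using sgn prodF by (intro V.vge_mult0) auto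
  qed
qed

text \<open>With \<open>m = 0\<close> all levels are \<open>0\<close>, so the standard basis has a
  unit discriminant and attains the least natural number.\<close>

lemma discriminant_unramified:
  assumes F: "subfield F \<Omega>" and m: "m = 0"
  shows "discriminant F E \<O> = 0"
proof -
  have "level i = 0" for i unfolding level_def using p_gt_0 m by simp
  then have "ord_at \<O> (basis_discriminant F E std_basis) = int 0" using ord_std_basis by simp
  moreover have "ring.independent \<Omega> F std_basis" "ring.Span \<Omega> F std_basis = E"
    unfolding std_basis_def by (rule monomial_basis[OF F]; auto)+
  ultimately show ?thesis
    unfolding discriminant_def using std_basis_integral by (intro Least_eq_0) blast
qed

end

locale galois_ramified = galois_artin_schreier E F \<sigma> p y \<O> t m + ramified_artin_schreier E F \<sigma> p y "ord_at \<O>" t m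
  for E F :: "'a::alg_closed_field set" and \<sigma> p y \<O> t m
begin

text \<open>The coefficients of a monic equation over \<open>\<O>\<close> are integral for the
  valuation \<open>v (N z)\<close> of \<open>E\<close>, hence so is the root. With
  \<open>W_integral\<close>, \<open>W 0\<close> is the integral closure in the ramified
  case.\<close>

lemma integral_W: "z \<in> integral_closure \<O> E \<Longrightarrow> z \<in> W 0"
proof -
  assume "z \<in> integral_closure \<O> E"
  then obtain g where z: "z \<in> E" and g: "lead_coeff g = 1" "set (coeffs g) \<subseteq> \<O>" "poly g z = 0"
    unfolding integral_closure_def by blast
  obtain \<pi> where "discrete_valuation E (\<lambda>z. ord_at \<O> (N z)) \<pi>" using val_N_discrete by blast
  then interpret VN: discrete_valuation E "\<lambda>z. ord_at \<O> (N z)" \<pi> .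
  have "coeff g i \<in> E \<and> VN.vge 0 (coeff g i)" for i
  proof (cases "coeff g i = 0")
    case False
    then have "coeff g i \<in> set (coeffs g)" by (intro coeff_in_coeffs) (auto intro: le_degree)
    then have "coeff g i \<in> \<O>" using g(2) by blast
    then have F: "coeff g i \<in> F" "coeff g i \<in> S 0" using O.O_subset O_iff_S by blast+
    then have "coeff g i \<in> W 0" using W_F by blast
    then show ?thesis using W_iff_val_N[of "coeff g i" 0] F_E[OF F(1)] by simp
  qed simp
  then have "VN.vge 0 z" using VN.vge_root_of_monic[OF z g(3,1)] by blast
  then show ?thesis using W_iff_val_N[OF z] by simp
qed

text \<open>For \<open>0 < i < p\<close>, the fractions \<open>m i / p\<close> and
  \<open>m (p - i) / p\<close> add up to \<open>m\<close> and neither is an integer, so their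
  ceilings add up to \<open>m + 1\<close>.\<close>

lemma level_sum: "2 * (\<Sum>i<p. level i) = (p - 1) * (m + 1)"
proof -
  have l0: "level 0 = 0" using p_gt_0 by (simp add: level_def)
  have pair: "level i + level (p - i) = m + 1" if i: "0 < i" "i < p" for i
  proof -
    have nd: "\<not> p dvd m * i"
      using prime_dvd_mult_iff[OF prime_p, of m i] p_not_dvd_m i by (auto dest: dvd_imp_le)
    define q r where "q = m * i div p" and "r = m * i mod p"
    have qr: "m * i = p * q + r" "r < p" "0 < r"
      using nd p_gt_0 by (auto simp: q_def r_def dvd_eq_mod_eq_0)
    have "m * i + p - 1 = (r - 1) + p * (q + 1)" using qr p_gt_0 by (simp add: algebra_simps)
    then have "level i = ((r - 1) + p * (q + 1)) div p" by (simp only: level_def)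
    then have l1: "level i = q + 1" using qr p_gt_0 by (subst (asm) div_mult_self2) auto
    have "q < m"
    proof -
      have "m * i < p * m" using i m_pos by (simp add: mult.commute)
      then show ?thesis using qr by (metis add_lessD1 mult_less_cancel1)
    qed
    have "m * (p - i) = p * m - m * i" by (simp add: diff_mult_distrib2 mult.commute)
    also have "\<dots> = p * (m - 1 - q) + (p - r)"
    proof -
      obtain s where s: "m = q + 1 + s" using \<open>q < m\<close> by (metis Suc_eq_plus1 Suc_leI le_Suc_ex)
      show ?thesis using qr s by (simp add: algebra_simps)
    qed
    finally have "m * (p - i) + p - 1 = (p - r - 1) + p * (m - q)"
    proof -
      obtain s where s: "m = q + 1 + s" using \<open>q < m\<close> by (metis Suc_eq_plus1 Suc_leI le_Suc_ex)
      assume "m * (p - i) = p * (m - 1 - q) + (p - r)"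
      then show ?thesis using qr(2,3) s by (simp add: algebra_simps)
    qed
    then have "level (p - i) = ((p - r - 1) + p * (m - q)) div p" by (simp only: level_def)
    then have "level (p - i) = m - q" using qr p_gt_0 by (subst (asm) div_mult_self2) auto
    then show ?thesis using l1 \<open>q < m\<close> by simp
  qed
  have "(\<Sum>i<p. level i) = (\<Sum>i\<in>{1..<p}. level i)"
    using l0 p_gt_0 by (simp add: lessThan_atLeast0 sum.atLeast_Suc_lessThan)
  moreover have "(\<Sum>i\<in>{1..<p}. level i) = (\<Sum>i\<in>{1..<p}. level (p - i))"
    by (rule sum.reindex_bij_witness[of _ "\<lambda>i. p - i" "\<lambda>i. p - i"]) auto
  ultimately have "2 * (\<Sum>i<p. level i) = (\<Sum>i\<in>{1..<p}. level i + level (p - i))"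
    by (simp add: sum.distrib)
  also have "\<dots> = (\<Sum>i\<in>{1..<p}. m + 1)" by (intro sum.cong refl pair) auto
  finally show ?thesis by simp
qed

text \<open>The standard basis attains the value. Any other integral basis lies in
  \<open>W 0\<close> by \<open>integral_W\<close>, where the column bounds on its coordinates take
  over.\<close>

lemma discriminant_ramified:
  assumes F: "subfield F \<Omega>"
  shows "discriminant F E \<O> = (p - 1) * (m + 1)"
  unfolding discriminant_def
proof (rule Least_equality)
  have "2 * (\<Sum>i<p. int (level i)) = int ((p - 1) * (m + 1))"
    unfolding level_sum[symmetric] by simp
  then have "ord_at \<O> (basis_discriminant F E std_basis) = int ((p - 1) * (m + 1))"
    using ord_std_basis by (simp only:)
  moreover have "ring.independent \<Omega> F std_basis" "ring.Span \<Omega> F std_basis = E"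
    unfolding std_basis_def by (rule monomial_basis[OF F]; auto)+
  ultimately show "\<exists>bs. set bs \<subseteq> integral_closure \<O> E \<and> ring.independent \<Omega> F bs \<and>
      ring.Span \<Omega> F bs = E \<and> ord_at \<O> (basis_discriminant F E bs) = int ((p - 1) * (m + 1))"
    using std_basis_integral by blast
next
  fix d assume "\<exists>bs. set bs \<subseteq> integral_closure \<O> E \<and> ring.independent \<Omega> F bs \<and>
      ring.Span \<Omega> F bs = E \<and> ord_at \<O> (basis_discriminant F E bs) = int d"
  then obtain bs where bs: "set bs \<subseteq> integral_closure \<O> E" "ring.independent \<Omega> F bs"
      "ring.Span \<Omega> F bs = E" "ord_at \<O> (basis_discriminant F E bs) = int d" by blast
  note pr = basis_props[OF F bs(2,3)]
  have "bs ! i \<in> W 0" if "i < p" for i using bs(1) pr(2) that integral_W by (metis nth_mem subsetD)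
  then have "V.vge (\<Sum>i<p. int (level i)) (det (coord_mat bs))" by (rule det_coord_mat_vge)
  then have "(\<Sum>i<p. int (level i)) \<le> ord_at \<O> (det (coord_mat bs))" using pr(3) by (simp add: val_ge_def)
  then have "2 * (\<Sum>i<p. int (level i)) \<le> int d"
    using bs(4) ord_basis_discriminant[OF pr] by simp
  moreover have "2 * (\<Sum>i<p. int (level i)) = int ((p - 1) * (m + 1))"
    unfolding level_sum[symmetric] by simp
  ultimately show "(p - 1) * (m + 1) \<le> d" by (metis of_nat_le_iff)
qed

end

section \<open>Places of \<open>E\<close> above a place of \<open>F\<close>\<close>

locale galois_place_over = galois_artin_schreier E F \<sigma> p y \<O> t m
  for E F :: "'a::alg_closed_field set" and \<sigma> p y \<O> t m +
  fixes \<O>' :: "'a set"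
  assumes over: "\<O>' \<in> places_over F E \<O>"
begin

sublocale O': place E \<O>'
  by unfold_locales (use over in \<open>simp add: places_over_def\<close>)

lemma O'_inter_F: "\<O>' \<inter> F = \<O>"
  using over by (simp add: places_over_def)

text \<open>\<open>e\<close> is the ramification index, the valuation of \<open>t\<close> above.
  Units stay units because \<open>\<O>' \<inter> F = \<O>\<close>, and \<open>e \<ge> 1\<close>
  because \<open>inverse t\<close> is not in \<open>\<O>\<close>.\<close>

lemma valuation_over:
  obtains e t' where "discrete_valuation E (ord_at \<O>') t'" "e \<ge> 1"
    "\<And>c. c \<in> F \<Longrightarrow> c \<noteq> 0 \<Longrightarrow> ord_at \<O>' c = e * ord_at \<O> c"
proof -
  obtain t' where D: "discrete_valuation E (ord_at \<O>') t'" using O'.valuation by metis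
  interpret D: discrete_valuation E "ord_at \<O>'" t' by (rule D)
  have O_iff: "c \<in> \<O> \<longleftrightarrow> D.vge 0 c" "c \<in> \<O> \<longleftrightarrow> V.vge 0 c" if "c \<in> F" for c
    using that O'.O_iff_ord[OF F_E[OF that]] O.O_iff_ord[OF that] O'_inter_F by auto
  define e where "e = ord_at \<O>' t"
  have unit: "ord_at \<O>' c = 0" if c: "c \<in> F" "c \<noteq> 0" "ord_at \<O> c = 0" for c
  proof -
    have "D.vge 0 c" "D.vge 0 (inverse c)"
      using O_iff[OF c(1)] O_iff[OF F.inverse_mem[OF c(1)]] c by (auto simp: val_ge_def V.val_inverse)
    then show ?thesis using c F_E[OF c(1)] by (simp add: val_ge_def D.val_inverse)
  qed
  have tE: "t \<in> E" using F_E by simp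
  have "ord_at \<O>' c = e * ord_at \<O> c" if c: "c \<in> F" "c \<noteq> 0" for c
  proof -
    define n where "n = ord_at \<O> c"
    define u where "u = c * t powi (- n)"
    have u: "u \<in> F" "u \<noteq> 0" using c by (auto simp: u_def intro!: F.mult_mem F.power_int_mem)
    have "ord_at \<O> u = 0"
      unfolding u_def using c by (subst V.val_mult) (auto simp: V.val_power_int n_def intro!: F.power_int_mem)
    then have "ord_at \<O>' u = 0" using unit u by blast
    moreover have "c = u * t powi n" by (simp add: u_def power_int_minus)
    moreover have "ord_at \<O>' (u * t powi n) = ord_at \<O>' u + n * e"
      using u F_E[OF u(1)] tE by (subst D.val_mult) (auto simp: D.val_power_int e_def intro!: E.power_int_mem)
    ultimately show ?thesis by (simp add: n_def mult.commute)
  qed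
  moreover have "e \<ge> 1"
  proof (rule ccontr)
    assume "\<not> e \<ge> 1"
    then have "D.vge 0 (inverse t)" using tE by (simp add: val_ge_def D.val_inverse e_def)
    then have "V.vge 0 (inverse t)" using O_iff[OF F.inverse_mem[OF V.t_mem]] by blast
    then show False by (simp add: val_ge_def V.val_inverse)
  qed
  ultimately show thesis using that D by blast
qed

lemma y_ne_0: "y \<noteq> 0"
proof
  assume "y = 0"
  then have "\<sigma> y = y" using \<sigma>_F[of 0] by simp
  then show False using \<sigma>_y by simp
qed

lemma F_vge_over: "c \<in> F \<Longrightarrow> V.vge M c \<Longrightarrow> M \<ge> 0 \<Longrightarrow> val_ge (ord_at \<O>') M c"
proof -
  assume c: "c \<in> F" "V.vge M c" "M \<ge> 0"
  obtain e t' where e: "e \<ge> 1" "\<And>c. c \<in> F \<Longrightarrow> c \<noteq> 0 \<Longrightarrow> ord_at \<O>' c = e * ord_at \<O> c"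
    using valuation_over by metis
  show ?thesis
  proof (cases "c = 0")
    case False
    then have "M \<le> ord_at \<O> c" using c by (simp add: val_ge_def)
    moreover have "1 * ord_at \<O> c \<le> e * ord_at \<O> c" using e(1) calculation c(3) by (intro mult_right_mono) auto
    ultimately show ?thesis using e(2)[OF c(1) False] by (simp add: val_ge_def)
  qed simp
qed

text \<open>Links the filtration to an arbitrary place above. If \<open>y\<close> has a pole there,
  \<open>y ^ p\<close> dominates in \<open>f = y ^ p - y\<close>, so \<open>p\<close> times the pole
  order of \<open>y\<close> is at most \<open>e * m\<close>.\<close>

lemma W_vge_over: "z \<in> W (int p * M) \<Longrightarrow> M \<ge> 0 \<Longrightarrow> val_ge (ord_at \<O>') M z"
proof -
  assume z: "z \<in> W (int p * M)" and M: "M \<ge> 0"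
  obtain e t' where D: "discrete_valuation E (ord_at \<O>') t'" and e: "e \<ge> 1"
    "\<And>c. c \<in> F \<Longrightarrow> c \<noteq> 0 \<Longrightarrow> ord_at \<O>' c = e * ord_at \<O> c"
    using valuation_over by metis
  interpret D: discrete_valuation E "ord_at \<O>'" t' by (rule D)
  have y: "- (e * int m) \<le> int p * ord_at \<O>' y"
  proof (cases "ord_at \<O>' y < 0")
    case True
    have yp: "ord_at \<O>' (y ^ p) = int p * ord_at \<O>' y" using y_ne_0 by (simp add: D.val_power)
    have "1 * ord_at \<O>' y > int p * ord_at \<O>' y" using True p_ge_2 by (intro mult_strict_right_mono_neg) auto
    then have "ord_at \<O>' (y ^ p) < ord_at \<O>' y" using yp by simp
    moreover have "D.vge (ord_at \<O>' y) (f - y ^ p)" using D.val_minus[of y] by (simp add: f_def val_ge_def)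
    ultimately have "f \<noteq> 0" "ord_at \<O>' f = int p * ord_at \<O>' y"
      using D.val_eq_of_close[of f "y ^ p" "ord_at \<O>' y"] F_E[OF f_mem] y_ne_0 yp by (auto simp: E.power_mem)
    moreover have "e * (- int m) \<le> e * ord_at \<O> f"
      using val_f \<open>f \<noteq> 0\<close> e(1) by (intro mult_left_mono) (auto simp: val_ge_def)
    ultimately show ?thesis using e(2)[OF f_mem] by simp
  next
    case False
    have "0 \<le> e * int m" using e(1) by simp
    moreover have "0 \<le> int p * ord_at \<O>' y" using False by simp
    ultimately show ?thesis by linarith
  qed
  have zE: "z \<in> E" using z by (rule W_E)
  have "D.vge M (\<Sum>i<p. coord z i * y ^ i)"
  proof (rule D.vge_sum)
    fix i assume i: "i \<in> {..<p}"
    let ?c = "coord z i"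
    have cF: "?c \<in> F" using zE by (rule coord)
    show "?c * y ^ i \<in> E" using cF by (rule monom_mem)
    show "D.vge M (?c * y ^ i)"
    proof (cases "?c = 0")
      case False
      have "int p * M + int m * int i \<le> int p * ord_at \<O> ?c"
        using z i False by (auto simp: W_def S_def)
      then have "e * (int p * M + int m * int i) \<le> e * (int p * ord_at \<O> ?c)"
        using e(1) by (intro mult_left_mono) auto
      moreover have "int i * - (e * int m) \<le> int i * (int p * ord_at \<O>' y)"
        using y by (intro mult_left_mono) auto
      moreover have "ord_at \<O>' (?c * y ^ i) = e * ord_at \<O> ?c + int i * ord_at \<O>' y"
        using False y_ne_0 cF F_E[OF cF] by (simp add: D.val_mult D.val_power E.power_mem e(2))
      ultimately have "int p * (e * M) \<le> int p * ord_at \<O>' (?c * y ^ i)" by (simp add: algebra_simps)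
      then have "e * M \<le> ord_at \<O>' (?c * y ^ i)" using p_gt_0 by simp
      moreover have "1 * M \<le> e * M" using e(1) M by (intro mult_right_mono) auto
      ultimately show ?thesis by (simp add: val_ge_def)
    qed simp
  qed
  then show ?thesis using coord(2)[OF zE] by simp
qed

lemma pow_mod: "z \<in> E \<Longrightarrow> (\<sigma> ^^ n) z = (\<sigma> ^^ (n mod p)) z"
proof -
  assume z: "z \<in> E"
  have "(\<sigma> ^^ (p * k)) w = w" if "w \<in> E" for k w
  proof (induction k)
    case (Suc k)
    have "(\<sigma> ^^ (p * Suc k)) w = (\<sigma> ^^ p) ((\<sigma> ^^ (p * k)) w)" by (simp add: funpow_add)
    then show ?case using Suc \<sigma>_order[OF that] by simp
  qed simp
  then have "(\<sigma> ^^ (p * (n div p) + n mod p)) z = (\<sigma> ^^ (n mod p)) z"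
    using pow_mem[OF z] by (simp only: funpow_add comp_apply)
  then show ?thesis by simp
qed

lemma restrict_image_O': "restrict (\<sigma> ^^ j) E ` \<O>' = (\<sigma> ^^ j) ` \<O>'"
  using O'.O_subset by (intro image_cong) auto

lemma decomposition_group_full:
  assumes "\<And>j. j < p \<Longrightarrow> (\<sigma> ^^ j) ` \<O>' = \<O>'"
  shows "decomposition_group F E \<O>' = carrier (gal_group F E)"
proof -
  have "\<tau> ` \<O>' = \<O>'" if "\<tau> \<in> carrier (gal_group F E)" for \<tau>
  proof -
    obtain j where j: "j < p" "\<tau> = restrict (\<sigma> ^^ j) E" using \<open>\<tau> \<in> _\<close> unfolding gal by blast
    show ?thesis unfolding j(2) restrict_image_O' by (rule assms[OF j(1)])
  qed
  then show ?thesis unfolding decomposition_group_def by blast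
qed

text \<open>A group of prime order has no proper nontrivial subgroups.\<close>

lemma decomposition_group_cases:
  "decomposition_group F E \<O>' = carrier (gal_group F E) \<or> decomposition_group F E \<O>' = {restrict id E}"
proof (cases "\<exists>j. 0 < j \<and> j < p \<and> (\<sigma> ^^ j) ` \<O>' = \<O>'")
  case True
  then obtain j where j: "0 < j" "j < p" "(\<sigma> ^^ j) ` \<O>' = \<O>'" by blast
  have it: "(\<sigma> ^^ (j * k)) ` \<O>' = \<O>'" for k
  proof (induction k)
    case (Suc k)
    have "(\<sigma> ^^ (j * Suc k)) ` \<O>' = (\<sigma> ^^ j) ` ((\<sigma> ^^ (j * k)) ` \<O>')"
      by (simp add: funpow_add image_comp)
    then show ?case using Suc j(3) by simp
  qed simp
  have "coprime j p" using prime_p j by (metis coprime_commute dvd_imp_le linorder_not_less prime_imp_coprime)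
  \<comment> \<open>\<open>l\<close> inverts \<open>j\<close> modulo \<open>p\<close>, so iterating
    the automorphism of index \<open>j\<close> reaches every index \<open>i\<close>.\<close>
  then obtain l where l: "[j * l = 1] (mod p)" using cong_solve_coprime_nat[of j p] by auto
  have "(\<sigma> ^^ i) ` \<O>' = \<O>'" if "i < p" for i
  proof -
    have "[j * (l * i) = i] (mod p)" using cong_mult[OF l cong_refl[of i p]] by (simp add: mult.assoc)
    then have "j * (l * i) mod p = i" using that by (simp add: cong_def)
    then have "(\<sigma> ^^ i) z = (\<sigma> ^^ (j * (l * i))) z" if "z \<in> \<O>'" for z
      using pow_mod[of z "j * (l * i)"] that O'.O_subset by auto
    then have "(\<sigma> ^^ i) ` \<O>' = (\<sigma> ^^ (j * (l * i))) ` \<O>'" by (intro image_cong) auto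
    then show ?thesis using it by simp
  qed
  then have "decomposition_group F E \<O>' = carrier (gal_group F E)"
    by (rule decomposition_group_full)
  then show ?thesis ..
next
  case False
  have "\<tau> \<in> decomposition_group F E \<O>' \<longleftrightarrow> \<tau> = restrict id E" for \<tau>
  proof
    assume "\<tau> \<in> decomposition_group F E \<O>'"
    then obtain j where j: "\<tau> = restrict (\<sigma> ^^ j) E" "j < p" "\<tau> ` \<O>' = \<O>'"
      unfolding decomposition_group_def gal by blast
    have "(\<sigma> ^^ j) ` \<O>' = \<O>'" using j(3) unfolding j(1) restrict_image_O' .
    then have "\<not> 0 < j" using False j(2) by metis
    then show "\<tau> = restrict id E" using j(1) by simp
  next
    assume \<tau>: "\<tau> = restrict id E"
    then have "\<tau> = restrict (\<sigma> ^^ 0) E" by simp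
    moreover have "restrict (\<sigma> ^^ 0) E ` \<O>' = \<O>'" unfolding restrict_image_O' by simp
    ultimately show "\<tau> \<in> decomposition_group F E \<O>'"
      unfolding decomposition_group_def gal using p_gt_0 by blast
  qed
  then show ?thesis by blast
qed

lemma cauchy_over:
  assumes "cauchy_at F \<O> x" shows "cauchy_at E \<O>' x"
  unfolding cauchy_at_def ord_ge_eq_val_ge
proof (intro conjI allI)
  show "range x \<subseteq> E" using assms F_subset by (auto simp: cauchy_at_def)
  fix M :: int
  have xF: "x i \<in> F" for i using assms by (auto simp: cauchy_at_def)
  obtain N0 where N0: "\<forall>i\<ge>N0. \<forall>j\<ge>N0. V.vge (max 0 M) (x i - x j)"
    using assms unfolding cauchy_at_def ord_ge_eq_val_ge by blast
  have "val_ge (ord_at \<O>') (max 0 M) (x i - x j)" if "i \<ge> N0" "j \<ge> N0" for i j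
    using N0 that xF by (intro F_vge_over) auto
  then show "\<exists>N. \<forall>i\<ge>N. \<forall>j\<ge>N. val_ge (ord_at \<O>') M (x i - x j)"
    by (meson max.cobounded2 val_ge_mono)
qed

text \<open>\<open>z i\<close> divides its norm with an integral cofactor, so a zero of
  \<open>z i\<close> at the place above would be a zero of the unit \<open>N (z i)\<close>.\<close>

lemma unit_not_null:
  assumes "\<And>i. z i \<in> W 0" "\<And>i. N (z i) \<noteq> 0" "\<And>i. ord_at \<O> (N (z i)) = 0"
  shows "\<not> null_at \<O>' z"
proof
  assume "null_at \<O>' z"
  then obtain n where n: "val_ge (ord_at \<O>') 1 (z n)" unfolding null_at_def ord_ge_eq_val_ge by blast
  obtain e t' where D: "discrete_valuation E (ord_at \<O>') t'" and e:
    "\<And>c. c \<in> F \<Longrightarrow> c \<noteq> 0 \<Longrightarrow> ord_at \<O>' c = e * ord_at \<O> c"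
    using valuation_over by metis
  interpret D: discrete_valuation E "ord_at \<O>'" t' by (rule D)
  have zE: "z n \<in> E" using assms(1) W_E by blast
  have N_eq: "N (z n) = (\<Prod>j\<in>{..<p} - {0}. (\<sigma> ^^ j) (z n)) * z n"
    using p_gt_0 by (simp add: N_def prod.remove[of "{..<p}" 0] mult.commute)
  have c0: "D.vge 0 ((\<sigma> ^^ j) (z n))" for j
    using W_vge_over[of "(\<sigma> ^^ j) (z n)" 0] W_pow[OF assms(1)] by simp
  have "D.vge (\<Sum>j\<in>{..<p} - {0}. 0) (\<Prod>j\<in>{..<p} - {0}. (\<sigma> ^^ j) (z n))"
    using c0 zE by (intro D.vge_prod pow_mem)
  then have "D.vge 1 (N (z n))" unfolding N_eq using n zE
    by (intro D.vge_mult0 E.prod_mem pow_mem) auto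
  then show False using e[of "N (z n)"] N_mem[OF zE] assms(2,3) by (simp add: val_ge_def)
qed

text \<open>If the decomposition group is trivial, the local norm is the identity and
  \<open>x\<close> is its own preimage. Otherwise the local norm is \<open>N\<close>, and
  \<open>norm_sequence\<close> starts from one of the given approximations of level
  \<open>m + 1\<close>.\<close>

lemma units_are_local_norms:
  assumes x: "cauchy_at F \<O> x"
    and unit: "\<forall>\<^sub>F i in sequentially. x i \<noteq> 0 \<and> ord_at \<O> (x i) = 0 \<and> (\<exists>w\<in>W 0. V.vge (int m + 1) (x i - N w))"
  shows "x \<in> local_norms F E \<O>'"
proof -
  have xF: "x i \<in> F" for i using x by (auto simp: cauchy_at_def)
  from decomposition_group_cases show ?thesis
  proof
    assume D: "decomposition_group F E \<O>' = {restrict id E}"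
    have "\<not> null_at \<O>' x"
    proof
      assume nl: "null_at \<O>' x"
      obtain n1 where n1: "\<forall>i\<ge>n1. val_ge (ord_at \<O>') 1 (x i)"
        using nl unfolding null_at_def ord_ge_eq_val_ge by blast
      obtain n2 where n2: "\<forall>i\<ge>n2. x i \<noteq> 0 \<and> ord_at \<O> (x i) = 0"
        using unit unfolding eventually_sequentially by blast
      obtain e t' where e: "\<And>c. c \<in> F \<Longrightarrow> c \<noteq> 0 \<Longrightarrow> ord_at \<O>' c = e * ord_at \<O> c"
        using valuation_over by metis
      have "val_ge (ord_at \<O>') 1 (x (max n1 n2))" "x (max n1 n2) \<noteq> 0" "ord_at \<O> (x (max n1 n2)) = 0"
        using n1 n2 by auto
      then show False using e[OF xF] by (simp add: val_ge_def)
    qed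
    moreover have "null_at \<O>' (\<lambda>i. (\<Prod>\<tau>\<in>decomposition_group F E \<O>'. \<tau> (x i)) - x i)"
      using F_E[OF xF] by (simp add: D null_at_def ord_ge_def)
    ultimately show ?thesis
      unfolding local_norms_def O'_inter_F using x cauchy_over[OF x] by blast
  next
    assume D: "decomposition_group F E \<O>' = carrier (gal_group F E)"
    obtain n0 where n0: "\<And>i. i \<ge> n0 \<Longrightarrow> x i \<noteq> 0 \<and> ord_at \<O> (x i) = 0 \<and> (\<exists>w\<in>W 0. V.vge (int m + 1) (x i - N w))"
      using unit unfolding eventually_sequentially by blast
    have "\<forall>n::nat. \<exists>k. \<forall>i\<ge>k. \<forall>j\<ge>k. V.vge (int m + 1 + int n) (x i - x j)"
      using x unfolding cauchy_at_def ord_ge_eq_val_ge by blast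
    from choice[OF this] obtain k where k: "\<forall>n. \<forall>i\<ge>k n. \<forall>j\<ge>k n. V.vge (int m + 1 + int n) (x i - x j)" ..
    \<comment> \<open>Nondecreasing indices beyond \<open>n0\<close> and all \<open>k l\<close> with
      \<open>l \<le> n\<close>; along them consecutive terms of \<open>x\<close> are as close as
      \<open>norm_sequence\<close> demands.\<close>
    define r where "r n = n0 + (\<Sum>l\<le>n. k l)" for n
    have r: "k n \<le> r n" "n0 \<le> r n" for n
      using member_le_sum[of n "{..n}" k] by (auto simp: r_def)
    have rmono: "r i \<le> r j" if "i \<le> j" for i j
      unfolding r_def using that by (intro add_left_mono sum_mono2) auto
    obtain w0 where w0: "w0 \<in> W 0" "V.vge (int m + 1) (x (r 0) - N w0)" using n0[OF r(2)[of 0]] by blast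
    have "\<exists>w. \<forall>n. w n \<in> W 0 \<and> V.vge (int m + 1 + int n) (x (r n) - N (w n)) \<and>
        w (Suc n) - w n \<in> W (int p * (int m + 1 + int n) - int m * int (p - 1))"
    proof (rule norm_sequence[of "\<lambda>n. x (r n)"])
      show "x (r n) \<in> F" for n by (rule xF)
      show "x (r n) \<noteq> 0" "ord_at \<O> (x (r n)) = 0" for n using n0[OF r(2)] by auto
      show "V.vge (int m + 1 + int n) (x (r (Suc n)) - x (r n))" for n
      proof -
        have "k n \<le> r (Suc n)" using r(1)[of n] rmono[of n "Suc n"] by simp
        then show ?thesis using k r(1)[of n] by blast
      qed
    qed (rule w0)+
    then obtain w where w: "\<And>n. w n \<in> W 0" "\<And>n. V.vge (int m + 1 + int n) (x (r n) - N (w n))"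
      "\<And>n. w (Suc n) - w n \<in> W (int p * (int m + 1 + int n) - int m * int (p - 1))"
      by blast
    have wE: "w n \<in> E" for n using w(1) by (rule W_E)
    have NF: "N (w n) \<in> F" for n using wE by (rule N_mem)
    \<comment> \<open>The surplus weight is dropped to reach a multiple of \<open>p\<close>, the
      form that \<open>W_vge_over\<close> turns into valuation \<open>n\<close> above.\<close>
    have step: "w (Suc n) - w n \<in> W (int p * int n)" for n
    proof (rule W_mono[OF w(3)])
      have "int m * int (p - 1) \<le> int m * int p" by (intro mult_left_mono) auto
      then show "int p * int n \<le> int p * (int m + 1 + int n) - int m * int (p - 1)"
        by (simp add: algebra_simps)
    qed
    have diff: "w (n + d) - w n \<in> W (int p * int n)" for n d
    proof (induction d)
      case (Suc d)
      have "w (Suc (n + d)) - w (n + d) \<in> W (int p * int n)" by (rule W_mono[OF step]) (simp add: mult_left_mono)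
      from W_add[OF this Suc] show ?case by simp
    qed simp
    have "cauchy_at E \<O>' w"
      unfolding cauchy_at_def ord_ge_eq_val_ge
    proof (intro conjI allI)
      show "range w \<subseteq> E" using wE by blast
      fix M :: int
      define n where "n = nat M"
      have n: "M \<le> int n" by (simp add: n_def)
      have "val_ge (ord_at \<O>') M (w i - w j)" if "i \<ge> n" "j \<ge> n" for i j
      proof -
        have "w i - w n \<in> W (int p * int n)" "w j - w n \<in> W (int p * int n)"
          using diff[of n "i - n"] diff[of n "j - n"] that by auto
        from W_diff[OF this] have "w i - w j \<in> W (int p * int n)" by simp
        then have "val_ge (ord_at \<O>') (int n) (w i - w j)" by (rule W_vge_over) simp
        then show ?thesis using n by (rule val_ge_mono)
      qed
      then show "\<exists>k. \<forall>i\<ge>k. \<forall>j\<ge>k. val_ge (ord_at \<O>') M (w i - w j)" by blast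
    qed
    moreover have "\<not> null_at \<O>' w"
    proof (rule unit_not_null[OF w(1)])
      fix n
      have "V.vge (int m + 1 + int n) (N (w n) - x (r n))"
        by (rule V.vge_diff_commute[OF xF NF w(2)])
      then show "N (w n) \<noteq> 0" "ord_at \<O> (N (w n)) = 0"
        using V.val_eq_of_close[OF NF xF, of "r n" "int m + 1 + int n" n] n0[OF r(2)[of n]] by auto
    qed
    moreover have "null_at \<O>' (\<lambda>i. (\<Prod>\<tau>\<in>decomposition_group F E \<O>'. \<tau> (w i)) - x i)"
      unfolding null_at_def ord_ge_eq_val_ge D gal_norm_eq[OF wE]
    proof
      fix M :: int
      define n where "n = nat M"
      have n: "M \<le> int n" by (simp add: n_def)
      have "val_ge (ord_at \<O>') M (N (w i) - x i)" if i: "i \<ge> max n (r n)" for i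
      proof -
        have "V.vge (int m + 1 + int i) (N (w i) - x (r i))"
          by (rule V.vge_diff_commute[OF xF NF w(2)])
        then have "V.vge (int n) (N (w i) - x (r i))" by (rule val_ge_mono) (use i in simp)
        moreover have "V.vge (int n) (x (r i) - x i)"
        proof -
          have "k n \<le> r i" "k n \<le> i" using r(1)[of n] rmono[of n i] i by auto
          then have "V.vge (int m + 1 + int n) (x (r i) - x i)" using k by blast
          then show ?thesis by (rule val_ge_mono) simp
        qed
        ultimately have "V.vge (int n) (N (w i) - x i)" by (rule V.vge_diff_trans[OF NF xF xF])
        then have "val_ge (ord_at \<O>') (int n) (N (w i) - x i)"
          using NF xF by (intro F_vge_over) auto
        then show ?thesis using n by (rule val_ge_mono)
      qed
      then show "\<exists>k. \<forall>i\<ge>k. val_ge (ord_at \<O>') M (N (w i) - x i)" by blast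
    qed
    ultimately show ?thesis
      unfolding local_norms_def O'_inter_F using x by blast
  qed
qed

end

section \<open>Conductor exponents\<close>

context galois_artin_schreier
begin

lemma unit_set_eq: "c \<in> unit_set \<O> \<longleftrightarrow> c \<in> F \<and> c \<noteq> 0 \<and> ord_at \<O> c = 0"
proof (cases "c \<in> F")
  case True
  then show ?thesis
    using O.O_iff_ord[OF True] O.O_iff_ord[OF F.inverse_mem[OF True]]
    by (cases "c = 0") (auto simp: unit_set_def val_ge_def V.val_inverse)
next
  case False
  then show ?thesis using O.O_subset by (auto simp: unit_set_def)
qed

text \<open>Level \<open>m + 1\<close> is level \<open>1\<close> here, so it suffices to approximate
  a unit by a norm modulo the maximal ideal. Norms from \<open>F\<close> do this:
  \<open>N w = w ^ p\<close>, and every residue is a \<open>p\<close>-th power.\<close>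

lemma conductor_unramified:
  assumes m: "m = 0"
  shows "conductor F E \<O> = 0"
  unfolding conductor_def
proof (rule Least_eq_0, intro ballI subsetI)
  fix \<O>' x assume over: "\<O>' \<in> places_over F E \<O>" and x: "x \<in> local_units F \<O> 0"
  interpret galois_place_over E F \<sigma> p y \<O> t m \<O>' by unfold_locales (rule over)
  have "cauchy_at F \<O> x" and ev: "\<forall>\<^sub>F i in sequentially. x i \<in> unit_set \<O>"
    using x by (auto simp: local_units_def)
  then show "x \<in> local_norms F E \<O>'"
  proof (intro units_are_local_norms)
    from ev show "\<forall>\<^sub>F i in sequentially. x i \<noteq> 0 \<and> ord_at \<O> (x i) = 0 \<and> (\<exists>w\<in>W 0. V.vge (int m + 1) (x i - N w))"
    proof (rule eventually_mono)
      fix i assume "x i \<in> unit_set \<O>"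
      then have xi: "x i \<in> F" "x i \<noteq> 0" "ord_at \<O> (x i) = 0" by (auto simp: unit_set_eq)
      then have "V.vge 0 (x i)" by (simp add: val_ge_def)
      then obtain w where w: "w \<in> F" "V.vge 0 w" "V.vge 1 (x i - w ^ p)"
        using V.frobenius_residue_surj[OF prime_p CHAR_p xi(1)] by blast
      have "w \<in> W 0" using w W_F[of w 0] S_iff_vge[of w 0] by simp
      then show "x i \<noteq> 0 \<and> ord_at \<O> (x i) = 0 \<and> (\<exists>w\<in>W 0. V.vge (int m + 1) (x i - N w))"
        using xi w N_F[OF w(1)] m by (intro conjI bexI[of _ w]) auto
    qed
  qed
qed

lemma local_units_subset_local_norms:
  assumes "\<O>' \<in> places_over F E \<O>"
  shows "local_units F \<O> (m + 1) \<subseteq> local_norms F E \<O>'"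
proof
  fix x assume x: "x \<in> local_units F \<O> (m + 1)"
  interpret galois_place_over E F \<sigma> p y \<O> t m \<O>' by unfold_locales (rule assms)
  have cau: "cauchy_at F \<O> x" and ev: "\<forall>\<^sub>F i in sequentially. V.vge (int m + 1) (x i - 1)"
    using x by (auto simp: local_units_def ord_ge_eq_val_ge algebra_simps)
  have xF: "x i \<in> F" for i using cau by (auto simp: cauchy_at_def)
  from ev have "\<forall>\<^sub>F i in sequentially. x i \<noteq> 0 \<and> ord_at \<O> (x i) = 0 \<and> (\<exists>w\<in>W 0. V.vge (int m + 1) (x i - N w))"
  proof (rule eventually_mono)
    fix i assume 1: "V.vge (int m + 1) (x i - 1)"
    then have "x i \<noteq> 0" "ord_at \<O> (x i) = 0"
      using V.val_eq_of_close[OF xF, of 1 "int m + 1" i] by auto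
    then show "x i \<noteq> 0 \<and> ord_at \<O> (x i) = 0 \<and> (\<exists>w\<in>W 0. V.vge (int m + 1) (x i - N w))"
      using 1 W_one by (intro conjI bexI[of _ 1]) auto
  qed
  with cau show "x \<in> local_norms F E \<O>'" by (rule units_are_local_norms)
qed

end

context galois_ramified
begin

text \<open>Building the place from the valuation \<open>v (N z)\<close> guarantees that a place
  above exists. Its ring \<open>W 0\<close> is stable under \<open>\<sigma>\<close>, so the
  decomposition group is full and the local norm is \<open>N\<close>; the constant sequence
  \<open>1 + a\<close> from \<open>norm_obstruction\<close> is then no local norm.\<close>

lemma local_units_not_subset_local_norms:
  "\<exists>\<O>'\<in>places_over F E \<O>. \<not> local_units F \<O> m \<subseteq> local_norms F E \<O>'"
proof -
  define v' where "v' = (\<lambda>z. ord_at \<O> (N z))"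
  obtain \<pi> where "discrete_valuation E v' \<pi>" using val_N_discrete unfolding v'_def by blast
  then interpret VN: discrete_valuation E v' \<pi> .
  define \<O>' where "\<O>' = {z \<in> E. val_ge v' 0 z}"
  have pl: "\<O>' \<in> places E" unfolding \<O>'_def by (rule vring_place(1)) unfold_locales
  have ord': "ord_at \<O>' z = v' z" if "z \<in> E" "z \<noteq> 0" for z
    unfolding \<O>'_def using that by (intro vring_place(2)) unfold_locales
  have inter: "\<O>' \<inter> F = \<O>"
  proof -
    have "c \<in> \<O>' \<longleftrightarrow> c \<in> \<O>" if c: "c \<in> F" for c
      using W_iff_val_N[OF F_E[OF c], of 0] W_F[OF c, of 0] O_iff_S[OF c] F_E[OF c] by (simp add: \<O>'_def v'_def)
    then show ?thesis using O.O_subset by blast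
  qed
  have over: "\<O>' \<in> places_over F E \<O>" using pl inter by (simp add: places_over_def)
  interpret galois_place_over E F \<sigma> p y \<O> t m \<O>' by unfold_locales (rule over)
  have W0: "\<O>' = W 0" using W_iff_val_N[of _ 0] W_E by (auto simp: \<O>'_def v'_def)
  have img: "(\<sigma> ^^ j) ` \<O>' = \<O>'" if "j < p" for j
  proof (intro equalityI subsetI)
    fix z assume "z \<in> (\<sigma> ^^ j) ` \<O>'"
    then show "z \<in> \<O>'" using W0 W_pow by blast
  next
    fix z assume z: "z \<in> \<O>'"
    then have zE: "z \<in> E" by (simp add: \<O>'_def)
    have "(\<sigma> ^^ (j + (p - j))) z = (\<sigma> ^^ j) ((\<sigma> ^^ (p - j)) z)" by (simp only: funpow_add comp_apply)
    then have "z = (\<sigma> ^^ j) ((\<sigma> ^^ (p - j)) z)" using \<sigma>_order[OF zE] that by simp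
    moreover have "(\<sigma> ^^ (p - j)) z \<in> \<O>'" using z W0 W_pow by blast
    ultimately show "z \<in> (\<sigma> ^^ j) ` \<O>'" by blast
  qed
  have D: "decomposition_group F E \<O>' = carrier (gal_group F E)"
    by (rule decomposition_group_full) (rule img)
  obtain a where a: "a \<in> F" "V.vge (int m) a" "\<And>z. z \<in> E \<Longrightarrow> \<not> V.vge (int m + 1) (N z - (1 + a))"
    using norm_obstruction by blast
  define x where "x = (\<lambda>i::nat. 1 + a)"
  have aF: "1 + a \<in> F" using a by auto
  have "x \<in> local_units F \<O> m"
    using a aF m_pos by (auto simp: local_units_def x_def cauchy_at_def ord_ge_eq_val_ge)
  moreover have "x \<notin> local_norms F E \<O>'"
  proof
    assume "x \<in> local_norms F E \<O>'"
    then obtain z where z: "cauchy_at E \<O>' z"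
      "null_at \<O>' (\<lambda>i. (\<Prod>\<tau>\<in>decomposition_group F E \<O>'. \<tau> (z i)) - x i)"
      unfolding local_norms_def by blast
    have zE: "z i \<in> E" for i using z(1) by (auto simp: cauchy_at_def)
    \<comment> \<open>On \<open>F\<close> the valuation of this place is \<open>p\<close> times the
      one at \<open>\<O>\<close>, so level \<open>m + 1\<close> below is level
      \<open>p (m + 1)\<close> above.\<close>
    obtain i where "val_ge (ord_at \<O>') (int p * (int m + 1)) (N (z i) - (1 + a))"
      using z(2) unfolding null_at_def ord_ge_eq_val_ge D gal_norm_eq[OF zE] x_def by blast
    moreover have d: "N (z i) - (1 + a) \<in> F" using N_mem[OF zE] aF by blast
    ultimately have "val_ge v' (int p * (int m + 1)) (N (z i) - (1 + a))"
      using ord'[OF F_E[OF d]] by (cases "N (z i) - (1 + a) = 0") (simp_all add: val_ge_def)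
    then have "val_ge (\<lambda>z. ord_at \<O> (N z)) (int p * (int m + 1)) (N (z i) - (1 + a))"
      by (simp only: v'_def)
    then have "N (z i) - (1 + a) \<in> S (int p * (int m + 1))"
      using W_iff_val_N[OF F_E[OF d]] W_F[OF d] by blast
    then show False using a(3)[OF zE] S_iff_vge[OF d] by blast
  qed
  ultimately show ?thesis using over by blast
qed

lemma conductor_ramified: "conductor F E \<O> = m + 1"
  unfolding conductor_def
proof (rule Least_equality)
  show "\<forall>\<O>'\<in>places_over F E \<O>. local_units F \<O> (m + 1) \<subseteq> local_norms F E \<O>'"
    using local_units_subset_local_norms by blast
next
  fix n assume n: "\<forall>\<O>'\<in>places_over F E \<O>. local_units F \<O> n \<subseteq> local_norms F E \<O>'"
  show "m + 1 \<le> n"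
  proof (rule ccontr)
    assume "\<not> m + 1 \<le> n"
    then have nm: "n \<le> m" by simp
    \<comment> \<open>The unit filtration decreases. Level \<open>0\<close> is defined by units
      instead of congruences; there \<open>m > 0\<close> makes elements of level \<open>m\<close>
      units.\<close>
    have "local_units F \<O> m \<subseteq> local_units F \<O> n"
    proof
      fix x assume "x \<in> local_units F \<O> m"
      then have cau: "cauchy_at F \<O> x" and ev: "\<forall>\<^sub>F i in sequentially. V.vge (int m) (x i - 1)"
        using m_pos by (auto simp: local_units_def ord_ge_eq_val_ge)
      have xF: "x i \<in> F" for i using cau by (auto simp: cauchy_at_def)
      have "\<forall>\<^sub>F i in sequentially. x i \<in> unit_set \<O>"
        using ev
      proof (rule eventually_mono)
        fix i assume "V.vge (int m) (x i - 1)"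
        then show "x i \<in> unit_set \<O>"
          using V.val_eq_of_close[OF xF, of 1 "int m" i] m_pos xF by (auto simp: unit_set_eq)
      qed
      moreover have "\<forall>\<^sub>F i in sequentially. V.vge (int n) (x i - 1)"
        using ev by (rule eventually_mono) (use nm in \<open>auto elim: val_ge_mono\<close>)
      ultimately show "x \<in> local_units F \<O> n"
        using cau by (simp add: local_units_def ord_ge_eq_val_ge)
    qed
    then show False using n local_units_not_subset_local_norms by blast
  qed
qed

end

subsection \<open>Choosing the generator at a place\<close>

text \<open>While the pole order \<open>Suc n = p * l\<close> of \<open>f\<close> is divisible by
  \<open>p\<close>, subtract \<open>s = w / t ^ l\<close> from \<open>y\<close>, with
  \<open>w ^ p\<close> matching the leading coefficient modulo the maximal ideal. This changes
  \<open>f\<close> into \<open>f - s ^ p + s\<close>, of smaller pole order, since \<open>s\<close>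
  has pole order at most \<open>l \<le> n\<close>.\<close>

lemma (in cyclic_extension) reduced_generator:
  assumes V: "finite_residue_valuation F v t" and y: "y \<in> E" "\<sigma> y = y + 1"
  shows "\<exists>y\<in>E. \<sigma> y = y + 1 \<and> (val_ge v 0 (y ^ p - y) \<or>
    (\<exists>m>0. \<not> p dvd m \<and> y ^ p - y \<noteq> 0 \<and> v (y ^ p - y) = - int m))"
proof -
  interpret V: finite_residue_valuation F v t by (rule V)
  have "\<lbrakk>y \<in> E; \<sigma> y = y + 1; V.vge (- int n) (y ^ p - y)\<rbrakk> \<Longrightarrow> ?thesis" for n y
  proof (induction n arbitrary: y)
    case 0
    then show ?case by auto
  next
    case (Suc n)
    interpret A: artin_schreier E F \<sigma> p y by unfold_locales (use Suc.prems in auto)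
    have fF: "y ^ p - y \<in> F" using A.f_mem by (simp add: A.f_def)
    show ?case
    proof (cases "V.vge (- int n) (y ^ p - y)")
      case True
      then show ?thesis using Suc by blast
    next
      case False
      then have f: "y ^ p - y \<noteq> 0" "v (y ^ p - y) = - int (Suc n)"
        using Suc.prems(3) by (auto simp: val_ge_def)
      show ?thesis
      proof (cases "p dvd Suc n")
        case False
        then show ?thesis using f Suc.prems(1,2) by (intro bexI[of _ y] conjI disjI2 exI[of _ "Suc n"]) auto
      next
        case True
        then obtain l where l: "Suc n = p * l" by blast
        define u where "u = (y ^ p - y) * t ^ Suc n"
        have u: "u \<in> F" "V.vge 0 u"
          using fF f by (auto simp: u_def val_ge_def V.val_mult V.val_power F.power_mem F.mult_mem simp del: power_Suc)
        obtain w where w: "w \<in> F" "V.vge 0 w" "V.vge 1 (u - w ^ p)"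
          using V.frobenius_residue_surj[OF prime_p CHAR_p u] by blast
        define s where "s = w * inverse (t ^ l)"
        have tl: "inverse (t ^ l) \<in> F" "V.vge (- int l) (inverse (t ^ l))"
          by (auto simp: val_ge_def V.val_inverse V.val_power F.power_mem F.inverse_mem)
        have s: "s \<in> F" "V.vge (- int l) s"
          using w tl by (auto simp: s_def intro: V.vge_mult0)
        have sp: "(y ^ p - y) - s ^ p = (u - w ^ p) * inverse (t ^ Suc n)"
        proof -
          have "inverse (t ^ l) ^ p = inverse (t ^ Suc n)"
            by (simp only: l power_inverse power_mult mult.commute[of p l])
          then have "s ^ p = w ^ p * inverse (t ^ Suc n)" by (simp only: s_def power_mult_distrib)
          moreover have "y ^ p - y = u * inverse (t ^ Suc n)"
            by (simp add: u_def mult.assoc del: power_Suc)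
          ultimately show ?thesis by (simp only: left_diff_distrib)
        qed
        have tn: "inverse (t ^ Suc n) \<in> F" "V.vge (- int (Suc n)) (inverse (t ^ Suc n))"
          by (auto simp: val_ge_def V.val_inverse V.val_power F.power_mem F.inverse_mem simp del: power_Suc)
        have "V.vge (1 + - int (Suc n)) ((y ^ p - y) - s ^ p)"
          unfolding sp using u w tn by (intro V.vge_mult) auto
        then have 1: "V.vge (- int n) ((y ^ p - y) - s ^ p)" by simp
        have "l \<le> n"
        proof -
          have "l > 0" using l by (cases l) auto
          moreover have "2 * l \<le> p * l" using p_ge_2 by (intro mult_right_mono) auto
          ultimately show ?thesis using l by linarith
        qed
        then have 2: "V.vge (- int n) s" using s(2) by (elim val_ge_mono) simp
        define y' where "y' = y - s"
        have y'E: "y' \<in> E" using Suc.prems(1) s(1) F_E by (auto simp: y'_def)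
        have "\<sigma> y' = \<sigma> y - \<sigma> s" unfolding y'_def using Suc.prems(1) s(1) F_E by (intro \<sigma>_diff)
        then have \<sigma>y': "\<sigma> y' = y' + 1" using \<sigma>_F[OF s(1)] Suc.prems(2) by (simp add: y'_def)
        have "(y' + s) ^ p = y' ^ p + s ^ p"
          by (rule freshmans_dream) (simp_all add: prime_p CHAR_p)
        then have eq: "y' ^ p - y' = ((y ^ p - y) - s ^ p) + s" by (simp add: y'_def)
        have "V.vge (- int n) (y' ^ p - y')"
          unfolding eq using 1 2 fF s(1) by (intro V.vge_add) auto
        then show ?thesis using Suc.IH[OF y'E \<sigma>y'] by blast
      qed
    qed
  qed
  moreover have "V.vge (- int (nat (- v (y ^ p - y)))) (y ^ p - y)" by (simp add: val_ge_def)
  ultimately show ?thesis using y by blast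
qed

section \<open>Comparison of discriminant and conductor\<close>

lemma ring_hom_on_carrier_iff:
  fixes E :: "'a::alg_closed_field set"
  shows "\<tau> \<in> Ring.ring_hom (on_carrier E) (on_carrier E) \<longleftrightarrow>
    (\<forall>x\<in>E. \<tau> x \<in> E) \<and> (\<forall>x\<in>E. \<forall>y\<in>E. \<tau> (x * y) = \<tau> x * \<tau> y \<and> \<tau> (x + y) = \<tau> x + \<tau> y) \<and> \<tau> 1 = 1"
  unfolding Ring.ring_hom_def by (auto simp: ring_of_type_algebra_def)

lemma gal_group_props:
  fixes E :: "'a::alg_closed_field set"
  assumes "\<tau> \<in> carrier (gal_group F E)"
  shows "\<tau> \<in> extensional E" "bij_betw \<tau> E E" "\<And>x. x \<in> E \<Longrightarrow> \<tau> x \<in> E"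
    "\<And>x y. x \<in> E \<Longrightarrow> y \<in> E \<Longrightarrow> \<tau> (x * y) = \<tau> x * \<tau> y"
    "\<And>x y. x \<in> E \<Longrightarrow> y \<in> E \<Longrightarrow> \<tau> (x + y) = \<tau> x + \<tau> y"
    "\<tau> 1 = 1" "\<And>x. x \<in> F \<Longrightarrow> \<tau> x = x" "\<tau> \<in> Bij E"
  using assms unfolding gal_group_def by (auto simp: Bij_def ring_hom_on_carrier_iff)

lemma gal_group_mult:
  assumes "\<tau> \<in> carrier (gal_group F E)" "\<rho> \<in> carrier (gal_group F E)"
  shows "\<tau> \<otimes>\<^bsub>gal_group F E\<^esub> \<rho> = compose E \<tau> \<rho>"
  using gal_group_props(8)[OF assms(1)] gal_group_props(8)[OF assms(2)]
  by (simp add: gal_group_def BijGroup_def)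

lemma gal_group_closed:
  fixes E :: "'a::alg_closed_field set"
  assumes E: "subfield E \<Omega>" "F \<subseteq> E" and \<tau>: "\<tau> \<in> carrier (gal_group F E)" and \<rho>: "\<rho> \<in> carrier (gal_group F E)"
  shows "compose E \<tau> \<rho> \<in> carrier (gal_group F E)"
proof -
  interpret E: subfield_set E by (rule subfield_set_of_subfield[OF E(1)])
  note t = gal_group_props[OF \<tau>] and r = gal_group_props[OF \<rho>]
  have "compose E \<tau> \<rho> \<in> Bij E" using t(8) r(8) by (rule compose_Bij)
  moreover have "compose E \<tau> \<rho> \<in> Ring.ring_hom (on_carrier E) (on_carrier E)"
    unfolding ring_hom_on_carrier_iff using t(3-6) r(3-6) by (simp add: compose_def E.mult_mem E.add_mem)
  moreover have "\<forall>x\<in>F. compose E \<tau> \<rho> x = x" using t(7) r(7) E(2) by (auto simp: compose_def)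
  ultimately show ?thesis by (simp add: gal_group_def)
qed

text \<open>\<open>s k\<close> is the preimage of \<open>k\<close> under the isomorphism with the
  integers modulo \<open>p\<close>, and \<open>\<sigma>\<close> is that of \<open>1\<close>;
  \<open>comp\<close> then shows \<open>s k\<close> to be the \<open>k\<close>-th iterate of
  \<open>\<sigma>\<close> on \<open>E\<close>.\<close>

lemma cyclic_extension_of_galois:
  fixes E F :: "'a::alg_closed_field set"
  assumes F: "subfield F \<Omega>" and gal: "galois_extension F E"
    and iso: "is_iso (gal_group F E) (integer_mod_group p)" and p: "prime p" "CHAR('a) = p"
  obtains \<sigma> where "cyclic_extension E F \<sigma> p" "E \<noteq> F"
    "carrier (gal_group F E) = (\<lambda>i. restrict (\<sigma> ^^ i) E) ` {..<p}"
    "inj_on (\<lambda>i. restrict (\<sigma> ^^ i) E) {..<p}"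
proof -
  let ?G = "gal_group F E"
  have E: "subfield E \<Omega>" "F \<subseteq> E" and fixed: "{x \<in> E. \<forall>\<tau>\<in>carrier ?G. \<tau> x = x} = F"
    using gal by (auto simp: galois_extension_def)
  interpret E: subfield_set E by (rule subfield_set_of_subfield[OF E(1)])
  have p2: "p \<ge> 2" using prime_ge_2_nat[OF p(1)] .
  obtain h where h: "h \<in> hom ?G (integer_mod_group p)" "bij_betw h (carrier ?G) (carrier (integer_mod_group p))"
    using iso unfolding is_iso_def iso_def by blast
  have carr: "carrier (integer_mod_group p) = {0..<int p}" using p2 by (simp add: carrier_integer_mod_group)
  have inj_h: "inj_on h (carrier ?G)" using h(2) by (simp add: bij_betw_def)
  have "\<exists>\<tau>. \<tau> \<in> carrier ?G \<and> h \<tau> = int k" if "k < p" for k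
  proof -
    have "int k \<in> h ` carrier ?G" using h(2) carr that by (simp add: bij_betw_def)
    then show ?thesis by force
  qed
  then have "\<forall>k. \<exists>\<tau>. k < p \<longrightarrow> \<tau> \<in> carrier ?G \<and> h \<tau> = int k" by blast
  from choice[OF this] obtain s where s: "\<forall>k. k < p \<longrightarrow> s k \<in> carrier ?G \<and> h (s k) = int k" ..
  then have sG: "s k \<in> carrier ?G" and hs: "h (s k) = int k" if "k < p" for k using that by auto
  have comp: "compose E (s i) (s j) = s ((i + j) mod p)" if "i < p" "j < p" for i j
  proof (rule inj_onD[OF inj_h])
    show "compose E (s i) (s j) \<in> carrier ?G" using that by (intro gal_group_closed[OF E] sG)
    show "s ((i + j) mod p) \<in> carrier ?G" using p2 by (intro sG) simp
    have "h (compose E (s i) (s j)) = h (s i \<otimes>\<^bsub>?G\<^esub> s j)" using sG that by (simp add: gal_group_mult)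
    also have "\<dots> = (int i + int j) mod int p"
      using hom_mult[OF h(1) sG[OF that(1)] sG[OF that(2)]] hs that by simp
    also have "\<dots> = h (s ((i + j) mod p))" using p2 by (subst hs) (simp_all add: zmod_int)
    finally show "h (compose E (s i) (s j)) = h (s ((i + j) mod p))" .
  qed
  have p0: "0 < p" "1 < p" using p2 by auto
  \<comment> \<open>An idempotent injective map is the identity.\<close>
  have s0: "s 0 z = z" if z: "z \<in> E" for z
  proof -
    note pr = gal_group_props[OF sG[OF p0(1)]]
    have "s 0 (s 0 z) = s 0 z" using comp[OF p0(1) p0(1)] z by (metis add_0 compose_eq mod_0)
    then show ?thesis using pr(2) pr(3)[OF z] z by (auto simp: bij_betw_def dest: inj_onD)
  qed
  define \<sigma> where "\<sigma> = s 1"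
  note s1 = gal_group_props[OF sG[OF p0(2)], folded \<sigma>_def]
  have pow: "s i z = (\<sigma> ^^ i) z" if "i < p" "z \<in> E" for i z
    using that
  proof (induction i)
    case 0
    then show ?case using s0 by simp
  next
    case (Suc i)
    have "s (Suc i) = compose E (s 1) (s i)" using comp[of 1 i] Suc.prems p0 by simp
    then show ?case using Suc by (simp add: compose_eq \<sigma>_def)
  qed
  have restr: "s i = restrict (\<sigma> ^^ i) E" if "i < p" for i
  proof
    fix z
    show "s i z = restrict (\<sigma> ^^ i) E z"
      using pow[OF that, of z] gal_group_props(1)[OF sG[OF that]] by (cases "z \<in> E") (auto simp: extensional_def)
  qed
  have order: "(\<sigma> ^^ p) z = z" if z: "z \<in> E" for z
  proof -
    have "compose E (s 1) (s (p - 1)) = s 0" using comp[of 1 "p - 1"] p0 by simp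
    then have "\<sigma> (s (p - 1) z) = z" using z s0[OF z] by (metis \<sigma>_def compose_eq)
    then have "\<sigma> ((\<sigma> ^^ (p - 1)) z) = z" using pow[of "p - 1" z] p0 z by simp
    then have "(\<sigma> ^^ Suc (p - 1)) z = z" by simp
    then show ?thesis using p0 by simp
  qed
  have carr_eq: "carrier ?G = (\<lambda>i. restrict (\<sigma> ^^ i) E) ` {..<p}"
  proof (intro equalityI subsetI)
    fix \<tau> assume \<tau>: "\<tau> \<in> carrier ?G"
    then have "h \<tau> \<in> {0..<int p}" using h(2) carr by (auto simp: bij_betw_def)
    then have k: "nat (h \<tau>) < p" "h \<tau> = int (nat (h \<tau>))" by auto
    then have "\<tau> = s (nat (h \<tau>))" using inj_onD[OF inj_h _ \<tau> sG[OF k(1)]] hs[OF k(1)] by simp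
    then have "\<tau> = restrict (\<sigma> ^^ nat (h \<tau>)) E" unfolding restr[OF k(1), symmetric] .
    then show "\<tau> \<in> (\<lambda>i. restrict (\<sigma> ^^ i) E) ` {..<p}" using k(1) by blast
  next
    fix \<tau> assume "\<tau> \<in> (\<lambda>i. restrict (\<sigma> ^^ i) E) ` {..<p}"
    then obtain i where i: "i < p" "\<tau> = restrict (\<sigma> ^^ i) E" by blast
    then show "\<tau> \<in> carrier ?G" using restr[OF i(1)] sG[OF i(1)] by simp
  qed
  have inj: "inj_on (\<lambda>i. restrict (\<sigma> ^^ i) E) {..<p}"
  proof (rule inj_onI)
    fix i j assume ij: "i \<in> {..<p}" "j \<in> {..<p}" "restrict (\<sigma> ^^ i) E = restrict (\<sigma> ^^ j) E"
    then have "s i = s j" using restr[of i] restr[of j] by simp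
    then have "h (s i) = h (s j)" by simp
    then show "i = j" using hs ij by simp
  qed
  have fix_iff: "\<sigma> z = z \<longleftrightarrow> z \<in> F" if z: "z \<in> E" for z
  proof
    assume "\<sigma> z = z"
    then have "(\<sigma> ^^ i) z = z" for i by (induction i) auto
    then have "\<forall>\<tau>\<in>carrier ?G. \<tau> z = z" unfolding carr_eq using z by auto
    then show "z \<in> F" using fixed z by blast
  qed (rule s1(7))
  have "E \<noteq> F"
  proof
    assume "E = F"
    then have "\<sigma> z = s 0 z" for z
      using s1(1,7) s0 gal_group_props(1)[OF sG[OF p0(1)]]
      by (cases "z \<in> E") (auto simp: extensional_def)
    then have "\<sigma> = s 0" by blast
    then have "h \<sigma> = h (s 0)" by (rule arg_cong)
    then show False using hs[OF p0(1)] hs[OF p0(2), folded \<sigma>_def] by linarith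
  qed
  moreover have "cyclic_extension E F \<sigma> p"
    by unfold_locales (use subfield_set.diff_mem subfield_set_of_subfield[OF F] p E(2) s1(3-5) fix_iff order
      in \<open>auto simp: subfield_set_def\<close>)
  ultimately show thesis using that carr_eq inj by blast
qed

text \<open>A generator reduced at the given place leads to one of the two local cases,
  \<open>m = 0\<close> or \<open>m\<close> positive and prime to \<open>p\<close>. The choice of
  \<open>y\<close> depends on the place, while \<open>\<sigma>\<close> is attached to the extension
  alone.\<close>

lemma discriminant_eq_conductor:
  fixes E F :: "'a::alg_closed_field set"
  assumes gff: "global_function_field k F" and gal: "galois_extension F E"
    and iso: "is_iso (gal_group F E) (integer_mod_group p)" and p: "prime p" "CHAR('a) = p"
    and \<O>: "\<O> \<in> places F"
  shows "discriminant F E \<O> = (p - 1) * conductor F E \<O>"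
proof -
  have sfF: "subfield F \<Omega>" using gff by (simp add: global_function_field_def)
  obtain \<sigma> where \<sigma>: "cyclic_extension E F \<sigma> p" "E \<noteq> F"
    "carrier (gal_group F E) = (\<lambda>i. restrict (\<sigma> ^^ i) E) ` {..<p}"
    "inj_on (\<lambda>i. restrict (\<sigma> ^^ i) E) {..<p}"
    using cyclic_extension_of_galois[OF sfF gal iso p] .
  interpret cyclic_extension E F \<sigma> p by (rule \<sigma>(1))
  interpret O: place F \<O> by unfold_locales (rule \<O>)
  obtain t where "discrete_valuation F (ord_at \<O>) t" using O.valuation by metis
  then have V: "finite_residue_valuation F (ord_at \<O>) t"
    by (rule finite_residue_valuation_of_function_field[OF gff])
  obtain y0 where "y0 \<in> E" "\<sigma> y0 = y0 + 1" using exists_artin_schreier_generator[OF \<sigma>(2)] by blast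
  from reduced_generator[OF V this] obtain y where y: "y \<in> E" "\<sigma> y = y + 1"
    "val_ge (ord_at \<O>) 0 (y ^ p - y) \<or> (\<exists>m>0. \<not> p dvd m \<and> y ^ p - y \<noteq> 0 \<and> ord_at \<O> (y ^ p - y) = - int m)"
    by blast
  interpret A: artin_schreier E F \<sigma> p y by unfold_locales (use y in auto)
  from y(3) show ?thesis
  proof
    assume "val_ge (ord_at \<O>) 0 (y ^ p - y)"
    then have "galois_artin_schreier E F \<sigma> p y \<O> t 0"
      using V \<O> \<sigma>(3,4) A.artin_schreier_axioms
      by (intro galois_artin_schreier.intro artin_schreier_valuation.intro
          galois_artin_schreier_axioms.intro artin_schreier_valuation_axioms.intro)
         (auto simp: A.f_def)
    then interpret G: galois_artin_schreier E F \<sigma> p y \<O> t 0 .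
    show ?thesis using G.discriminant_unramified[OF sfF] G.conductor_unramified by simp
  next
    assume "\<exists>m>0. \<not> p dvd m \<and> y ^ p - y \<noteq> 0 \<and> ord_at \<O> (y ^ p - y) = - int m"
    then obtain m where m: "m > 0" "\<not> p dvd m" "y ^ p - y \<noteq> 0" "ord_at \<O> (y ^ p - y) = - int m" by blast
    have "galois_artin_schreier E F \<sigma> p y \<O> t m"
      using V \<O> \<sigma>(3,4) A.artin_schreier_axioms m
      by (intro galois_artin_schreier.intro artin_schreier_valuation.intro
          galois_artin_schreier_axioms.intro artin_schreier_valuation_axioms.intro)
         (auto simp: A.f_def val_ge_def)
    then interpret G: galois_artin_schreier E F \<sigma> p y \<O> t m .
    have "ramified_artin_schreier E F \<sigma> p y (ord_at \<O>) t m"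
      using G.artin_schreier_valuation_axioms m[folded A.f_def]
      by (intro ramified_artin_schreier.intro ramified_artin_schreier_axioms.intro)
    with G.galois_artin_schreier_axioms have G: "galois_ramified E F \<sigma> p y \<O> t m"
      by (rule galois_ramified.intro)
    show ?thesis
      using galois_ramified.discriminant_ramified[OF G sfF] galois_ramified.conductor_ramified[OF G] by simp
  qed
qed

section \<open>Passage to the counting functions\<close>

lemma prime_CHAR_of_function_field:
  fixes k F :: "'a::alg_closed_field set"
  assumes "global_function_field k F"
  shows "prime CHAR('a)" "card k \<ge> 2"
proof -
  have k: "subfield k \<Omega>" "finite k" using assms by (auto simp: global_function_field_def)
  interpret k: subfield_set k by (rule subfield_set_of_subfield[OF k(1)])
  have "\<not> inj (of_nat :: nat \<Rightarrow> 'a)"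
  proof
    assume "inj (of_nat :: nat \<Rightarrow> 'a)"
    moreover have "finite (range (of_nat :: nat \<Rightarrow> 'a))"
      by (rule finite_subset[OF _ k(2)]) auto
    ultimately show False using finite_imageD infinite_UNIV_nat by blast
  qed
  then have "CHAR('a) > 0"
    by (intro gr0I) (auto simp: inj_on_def of_nat_eq_iff_cong_CHAR cong_def)
  then show "prime CHAR('a)" by (rule prime_CHAR_semidom)
  have "card {0, 1 :: 'a} \<le> card k" using k(2) by (intro card_mono) auto
  then show "card k \<ge> 2" by simp
qed

text \<open>Divisor norms are powers of \<open>q\<close>, and the degree of the discriminant is
  \<open>p - 1\<close> times that of the conductor, the supports being equal because
  \<open>p - 1 > 0\<close>. At these bounds the two counted sets coincide.\<close>

lemma count_discriminant_eq_count_conductor: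
  fixes k F :: "'a::alg_closed_field set"
  assumes gff: "global_function_field k F" and p: "CHAR('a) = p" and q: "card k = q"
  shows "count_discriminant k F (integer_mod_group p) (real q ^ ((p - 1) * n)) =
    count_conductor k F (integer_mod_group p) (real q ^ n)"
proof -
  have pr: "prime p" and q2: "q \<ge> 2" using prime_CHAR_of_function_field[OF gff] p q by auto
  have p1: "p - 1 > 0" using prime_gt_1_nat[OF pr] by simp
  have "divisor_norm k F (discriminant F E) \<le> real q ^ ((p - 1) * n) \<longleftrightarrow>
      divisor_norm k F (conductor F E) \<le> real q ^ n"
    if E: "galois_extension F E" "is_iso (gal_group F E) (integer_mod_group p)" for E
  proof -
    have eq: "discriminant F E \<O> = (p - 1) * conductor F E \<O>" if "\<O> \<in> places F" for \<O>
      using discriminant_eq_conductor[OF gff E pr p that] .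
    have "{\<O> \<in> places F. discriminant F E \<O> \<noteq> 0} = {\<O> \<in> places F. conductor F E \<O> \<noteq> 0}"
      using eq p1 by auto
    then have "divisor_degree k F (discriminant F E) = (p - 1) * divisor_degree k F (conductor F E)"
      unfolding divisor_degree_def sum_distrib_left using eq by (intro sum.cong) auto
    then show ?thesis using q2 p1 by (simp add: divisor_norm_def q)
  qed
  then have "{E. galois_extension F E \<and> is_iso (gal_group F E) (integer_mod_group p) \<and>
      divisor_norm k F (discriminant F E) \<le> real q ^ ((p - 1) * n)} =
    {E. galois_extension F E \<and> is_iso (gal_group F E) (integer_mod_group p) \<and>
      divisor_norm k F (conductor F E) \<le> real q ^ n}" by blast
  then show ?thesis unfolding count_discriminant_def count_conductor_def by (rule arg_cong)
qed

theorem theorem2p1: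
  fixes k F :: "'a::alg_closed_field set" and p q :: nat and \<gamma> :: real
  assumes "global_function_field k F"
    and "is_algebraic_closure_of F"
    and "CHAR('a) = p"
    and "card k = q"
    and "\<gamma> > 0"
    and "asymp_equiv_q q
      (\<lambda>B. real (count_conductor k F (integer_mod_group p) B))
      (\<lambda>B. \<gamma> * B * ln B ^ (log_exponent p - 1))"
  shows "asymp_equiv_q q
      (\<lambda>B. real (count_discriminant k F (integer_mod_group p) B))
      (\<lambda>B. \<gamma> / (real p - 1) ^ (log_exponent p - 1)
            * B powr disc_exponent p * ln B ^ (log_exponent p - 1))"
proof -
  have pr: "prime p" and q2: "q \<ge> 2" using prime_CHAR_of_function_field[OF assms(1)] assms by auto
  have p1: "p > 1" using prime_gt_1_nat[OF pr] .
  define b where "b = log_exponent p - 1"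
  obtain l e where le: "l \<ge> 1" "(\<lambda>n. real (count_conductor k F (integer_mod_group p) (real q ^ (l * n + e))) /
      (\<gamma> * real q ^ (l * n + e) * ln (real q ^ (l * n + e)) ^ b)) \<longlonglongrightarrow> 1"
    using assms(6) unfolding asymp_equiv_q_def b_def by blast
  have exps: "(p - 1) * l * n + (p - 1) * e = (p - 1) * (l * n + e)" for n
    by (simp add: algebra_simps)
  \<comment> \<open>The exponent \<open>1 / (p - 1)\<close> turns \<open>q ^ ((p - 1) * N)\<close>
    back into \<open>q ^ N\<close>, and each logarithm contributes a factor \<open>p - 1\<close>;
    the denominator of the constant cancels these \<open>b\<close> factors.\<close>
  have rhs: "\<gamma> / (real p - 1) ^ b * (real q ^ ((p - 1) * N)) powr disc_exponent p * ln (real q ^ ((p - 1) * N)) ^ b =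
      \<gamma> * real q ^ N * ln (real q ^ N) ^ b" for N
  proof -
    have q0: "real q > 0" using q2 by simp
    have pm: "real (p - 1) = real p - 1" using p1 by simp
    have "(real q ^ ((p - 1) * N)) powr disc_exponent p = real q powr (real ((p - 1) * N) * disc_exponent p)"
      using q0 by (simp add: powr_realpow[symmetric] powr_powr)
    also have "real ((p - 1) * N) * disc_exponent p = real N"
      using p1 by (simp add: disc_exponent_def pm)
    also have "real q powr real N = real q ^ N" using q0 by (rule powr_realpow)
    finally have 1: "(real q ^ ((p - 1) * N)) powr disc_exponent p = real q ^ N" .
    have "ln (real q ^ ((p - 1) * N)) = (real p - 1) * ln (real q ^ N)"
      using q0 pm by (simp add: ln_realpow)
    then show ?thesis using 1 p1 by (simp add: power_mult_distrib)
  qed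
  show ?thesis
    unfolding asymp_equiv_q_def b_def[symmetric]
  proof (intro exI conjI)
    show "(p - 1) * l \<ge> 1" using p1 le(1) by simp
    show "(\<lambda>n. real (count_discriminant k F (integer_mod_group p) (real q ^ ((p - 1) * l * n + (p - 1) * e))) /
        (\<gamma> / (real p - 1) ^ b * (real q ^ ((p - 1) * l * n + (p - 1) * e)) powr disc_exponent p *
          ln (real q ^ ((p - 1) * l * n + (p - 1) * e)) ^ b)) \<longlonglongrightarrow> 1"
      unfolding exps rhs count_discriminant_eq_count_conductor[OF assms(1,3,4)] by (rule le(2))
  qed
qed

end
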